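(* Let $G=(V,E)$ be a finite connected graph, let $Y\subseteq V$ be nonempty, let $(T,d_T)$ be a metric tree, and let $f:Y\to T$ be a function. View $G$ as a length space (with all edges having length one) and let $\widetilde f:G\to T$ be the AMLE of $f$. Then for every initial vertex $x_0\in V\setminus Y$ and every initial target $t_0\in T$, the value of the game of Politics with these parameters is $$d_T\big(\widetilde f(x_0),t_0\big).$$
   Context: A metric tree is the one-dimensional simplicial complex associated to a finite graph-theoretical tree with arbitrary (positive, finite) edge lengths, with edges present as actual intervals, equipped with the shortest-path metric $d_T$. AMLE: the graph $G$ is regarded as a $1$-dimensional simplicial complex whose edges are intervals of length $1$, with shortest-path metric $d_G$. For metric spaces $X,Z$, $h:X\to Z$ and $S\subseteq X$, put $\mathrm{Lip}_S(h)=\sup_{x,y\in S,\ x\neq y}\frac{d_Z(h(x),h(y))}{d_X(x,y)}$. Given a closed $Y\subseteq X$ and a Lipschitz mapping $f:Y\to Z$, a Lipschitz mapping $\widetilde f:X\to Z$ is an absolutely minimal Lipschitz extension (AMLE) of $f$ if $\widetilde f|_Y=f$ and for every open $U\subseteq X\setminus Y$ and every Lipschitz $h:X\to Z$ coinciding with $\widetilde f$ on $X\setminus U$ one has $\mathrm{Lip}_U(h)\ge\mathrm{Lip}_U(\widetilde f)$. For a locally compact length space $X$, nonempty closed $Y$ and a metric tree $Z=T$, the AMLE exists and is unique. The game of Politics. $G=(V,E)$ is an unweighted undirected graph, which may have self loops; $Y\subseteq V$ and $f:Y\to T$ are given. The game is a two-player zero-sum stochastic game. It begins with a game position $x_0\in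 V\setminus Y$ and a target $t_0\in T$. In the $k$-th round ($k=1,2,\dots$): (1) Player I chooses an "opposition target" $o_k\in T$ and collects $d_T(o_k,t_{k-1})$ units from Player II; (2) Player II chooses a new target $t_k\in T$ and collects $d_T(o_k,t_k)$ units from Player I; (3) a fair coin is tossed (independently of everything before) and the winner of the toss chooses a new game position $x_k\in V$ with $\{x_{k-1},x_k\}\in E$. The game ends after round $K$, where $K$ is the smallest $k$ with $x_k\in Y$; at that point Player I collects an additional $d_T(f(x_K),t_K)$ units from Player II. (If the game never ends, the total payout for each player is declared to be zero.) The total payoff is the total net amount collected by Player I from Player II. Value. A strategy for a player is a way of choosing the player's next move as a function of all previously played moves and all previous coin tosses (for a random strategy, the choice is a probability distribution on moves). For strategies $\mathcal S_{\mathrm I},\mathcal S_{\mathrm{II}}$ let $\mathcal F(\mathcal S_{\mathrm I},\mathcal S_{\mathrm{II}})$ be the expected total payoff (including the running payoffs) to Player I when the players adopt these strategies, and let $\mathcal F$ be some fixed constant $C$ if the game does not terminate with probability one or if this expectation does not exist. The value for Player I is $\sup_{\mathcal S_{\mathrm I}}\inf_{\mathcal S_{\mathrm{II}}}\mathcal F(\mathcal S_{\mathrm I},\mathcal S_{\mathrm{II}})$, the value for Player II is $\inf_{\mathcal S_{\mathrm{II}}}\sup_{\mathcal S_{\mathrm I}}\mathcal F(\mathcal S_{\mathrm I},\mathcal S_{\mathrm{II}})$, and the game has a value, equal to the common quantity, when these two are equal. *)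

theory Defs
  imports "HOL-Analysis.Analysis" "HOL-Probability.Probability"
begin

section \<open>Finite graphs and trees\<close>

text \<open>Edges are sets of one vertex (self loops) or two vertices.\<close>

definition finite_graph :: "'v set \<Rightarrow> 'v set set \<Rightarrow> bool" where
  "finite_graph V E \<longleftrightarrow> finite V \<and> (\<forall>e\<in>E. \<exists>x\<in>V. \<exists>y\<in>V. e = {x, y})"

definition connected_graph :: "'v set \<Rightarrow> 'v set set \<Rightarrow> bool" where
  "connected_graph V E \<longleftrightarrow> V \<noteq> {} \<and> (\<forall>x\<in>V. \<forall>y\<in>V. (x, y) \<in> {(a, b). {a, b} \<in> E}\<^sup>*)"

definition graph_cycle :: "'v set set \<Rightarrow> 'v list \<Rightarrow> bool" where
  "graph_cycle E xs \<longleftrightarrow> 3 \<le> length xs \<and> distinct xs \<and>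
     (\<forall>i<length xs. {xs ! i, xs ! (Suc i mod length xs)} \<in> E)"

definition finite_tree :: "'v set \<Rightarrow> 'v set set \<Rightarrow> bool" where
  "finite_tree V E \<longleftrightarrow> finite_graph V E \<and> connected_graph V E \<and>
     (\<forall>x. {x} \<notin> E) \<and> (\<nexists>xs. graph_cycle E xs)"


section \<open>Metric graphs\<close>

text \<open>
  The one-dimensional complex of a graph with edge lengths \<open>len\<close>. Every edge is given an arbitrary
  orientation; \<open>edge_point len e s\<close> is the point of the closed edge \<open>e\<close> at arc length \<open>s\<close> from its
  tail. A self loop becomes a circle of circumference \<open>len e\<close>.
\<close>

definition edge_tail :: "'v set \<Rightarrow> 'v" where
  "edge_tail e = (SOME x. x \<in> e)"

definition edge_head :: "'v set \<Rightarrow> 'v" where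
  "edge_head e = (SOME y. e = {edge_tail e, y})"

datatype 'v cpoint = Vertex (the_vertex: 'v) | Interior "'v set" real

definition edge_point :: "('v set \<Rightarrow> real) \<Rightarrow> 'v set \<Rightarrow> real \<Rightarrow> 'v cpoint" where
  "edge_point len e s =
     (if s = 0 then Vertex (edge_tail e)
      else if s = len e then Vertex (edge_head e)
      else Interior e s)"

definition complex_points :: "'v set \<Rightarrow> 'v set set \<Rightarrow> ('v set \<Rightarrow> real) \<Rightarrow> 'v cpoint set" where
  "complex_points V E len =
     Vertex ` V \<union> {edge_point len e s | e s. e \<in> E \<and> s \<in> {0..len e}}"

text \<open>
  \<open>linear_path V E len p r q\<close>: some path from \<open>p\<close> to \<open>q\<close>, made of finitely many segments of closed
  edges, has length \<open>r\<close>.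
\<close>

inductive linear_path ::
  "'v set \<Rightarrow> 'v set set \<Rightarrow> ('v set \<Rightarrow> real) \<Rightarrow> 'v cpoint \<Rightarrow> real \<Rightarrow> 'v cpoint \<Rightarrow> bool"
  for V E len where
  refl: "p \<in> complex_points V E len \<Longrightarrow> linear_path V E len p 0 p"
| step: "e \<in> E \<Longrightarrow> s \<in> {0..len e} \<Longrightarrow> s' \<in> {0..len e} \<Longrightarrow>
    linear_path V E len (edge_point len e s') r q \<Longrightarrow>
    linear_path V E len (edge_point len e s) (\<bar>s - s'\<bar> + r) q"

definition path_dist ::
  "'v set \<Rightarrow> 'v set set \<Rightarrow> ('v set \<Rightarrow> real) \<Rightarrow> 'v cpoint \<Rightarrow> 'v cpoint \<Rightarrow> real" where
  "path_dist V E len p q =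
     (if p \<in> complex_points V E len \<and> q \<in> complex_points V E len
      then Inf {r. linear_path V E len p r q} else 0)"

definition metric_graph :: "'v set \<Rightarrow> 'v set set \<Rightarrow> ('v set \<Rightarrow> real) \<Rightarrow> 'v cpoint metric" where
  "metric_graph V E len = metric (complex_points V E len, path_dist V E len)"

definition metric_tree :: "'w cpoint metric \<Rightarrow> bool" where
  "metric_tree T \<longleftrightarrow>
     (\<exists>W D len. finite_tree W D \<and> (\<forall>e\<in>D. 0 < len e) \<and> T = metric_graph W D len)"

text \<open>The value of \<open>metric\<close> is only meaningful on metric spaces, so we check that this is one.\<close>

lemma edge_tail_head:
  assumes "finite_graph V E" "e \<in> E"
  shows "e = {edge_tail e, edge_head e}" "edge_tail e \<in> V" "edge_head e \<in> V"
proof -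
  obtain x y where xy: "x \<in> V" "y \<in> V" "e = {x, y}"
    using assms unfolding finite_graph_def by blast
  then have t: "edge_tail e \<in> e"
    unfolding edge_tail_def by (metis insertI1 someI)
  then have "\<exists>y. e = {edge_tail e, y}"
    using xy by auto
  then show *: "e = {edge_tail e, edge_head e}"
    unfolding edge_head_def by (rule someI_ex)
  have "edge_head e \<in> e"
    by (subst *) simp
  with t xy show "edge_tail e \<in> V" "edge_head e \<in> V"
    by auto
qed

lemma edge_point_in: "e \<in> E \<Longrightarrow> s \<in> {0..len e} \<Longrightarrow> edge_point len e s \<in> complex_points V E len"
  unfolding complex_points_def by auto

lemma linear_path_in:
  "linear_path V E len p r q \<Longrightarrow>
     0 \<le> r \<and> p \<in> complex_points V E len \<and> q \<in> complex_points V E len"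
  by (induction rule: linear_path.induct) (auto intro: edge_point_in)

lemma linear_path_trans:
  "linear_path V E len p r q \<Longrightarrow> linear_path V E len q r' z \<Longrightarrow> linear_path V E len p (r + r') z"
proof (induction rule: linear_path.induct)
  case (step e s s' r q)
  then show ?case
    using linear_path.step[of e E s len s' V "r + r'" z] by (simp add: add.assoc)
qed simp

lemma linear_path_edge:
  assumes "e \<in> E" "s \<in> {0..len e}" "s' \<in> {0..len e}"
  shows "linear_path V E len (edge_point len e s) \<bar>s - s'\<bar> (edge_point len e s')"
proof -
  have "edge_point len e s' \<in> complex_points V E len"
    using assms(1,3) by (rule edge_point_in)
  from linear_path.step[OF assms linear_path.refl[OF this]] show ?thesis
    by simp
qed

lemma linear_path_sym: "linear_path V E len p r q \<Longrightarrow> linear_path V E len q r p"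
proof (induction rule: linear_path.induct)
  case (step e s s' r q)
  have "linear_path V E len (edge_point len e s') \<bar>s - s'\<bar> (edge_point len e s)"
    using linear_path_edge[of e E s' len s V] step by (simp add: abs_minus_commute)
  from linear_path_trans[OF step.IH this] show ?case
    by (simp add: add.commute)
qed (rule linear_path.refl)

lemma linear_path_lower_bound:
  assumes "linear_path V E len p r q"
    and "\<And>e s s'. e \<in> E \<Longrightarrow> s \<in> {0..len e} \<Longrightarrow> s' \<in> {0..len e} \<Longrightarrow>
      \<phi> (edge_point len e s') - \<phi> (edge_point len e s) \<le> \<bar>s - s'\<bar>"
  shows "\<phi> q - \<phi> p \<le> r"
  using assms(1)
proof (induction rule: linear_path.induct)
  case (step e s s' r q)
  then show ?case using assms(2)[of e s s'] by linarith
qed simp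

lemma linear_path_exists:
  assumes "finite_graph V E" "connected_graph V E" "\<And>e. e \<in> E \<Longrightarrow> 0 < len e"
    and p: "p \<in> complex_points V E len" and q: "q \<in> complex_points V E len"
  shows "\<exists>r. linear_path V E len p r q"
proof -
  have adj: "\<exists>r. linear_path V E len (Vertex a) r (Vertex b)" if "{a, b} \<in> E" for a b
  proof -
    let ?e = "{a, b}"
    have l: "0 < len ?e" using assms(3) that .
    have 1: "linear_path V E len (Vertex (edge_tail ?e)) (len ?e) (Vertex (edge_head ?e))"
      using linear_path_edge[OF that, of 0 len "len ?e" V] l by (simp add: edge_point_def)
    have ab: "{a, b} = {edge_tail ?e, edge_head ?e}"
      using edge_tail_head(1)[OF assms(1) that] .
    then consider "a = edge_tail ?e" "b = edge_head ?e" | "a = edge_head ?e" "b = edge_tail ?e"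
      by (auto simp: doubleton_eq_iff)
    then show ?thesis
      by (metis 1 linear_path_sym)
  qed
  have vv: "\<exists>r. linear_path V E len (Vertex a) r (Vertex b)" if "a \<in> V" "b \<in> V" for a b
  proof -
    have "(a, b) \<in> {(a, b). {a, b} \<in> E}\<^sup>*"
      using assms(2) that unfolding connected_graph_def by blast
    then show ?thesis
    proof (induction rule: rtrancl_induct)
      case base
      show ?case
        using linear_path.refl[of "Vertex a" V E len] that by (auto simp: complex_points_def)
    next
      case (step y z)
      then show ?case
        using adj[of y z] linear_path_trans by blast
    qed
  qed
  have pv: "\<exists>v\<in>V. \<exists>r. linear_path V E len p r (Vertex v)" if p: "p \<in> complex_points V E len" for p
  proof -
    consider v where "v \<in> V" "p = Vertex v"
      | e s where "e \<in> E" "s \<in> {0..len e}" "p = edge_point len e s"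
      using p unfolding complex_points_def by blast
    then show ?thesis
    proof cases
      case 1
      then show ?thesis using linear_path.refl[OF p] by blast
    next
      case 2
      then have "linear_path V E len p \<bar>s - 0\<bar> (edge_point len e 0)"
        using linear_path_edge[of e E s len 0 V] assms(3)[of e] by auto
      then show ?thesis
        using edge_tail_head(2)[OF assms(1) 2(1)] unfolding edge_point_def by auto
    qed
  qed
  show ?thesis
    using pv[OF p] pv[OF q] vv linear_path_trans linear_path_sym by metis
qed

lemma linear_path_separated:
  assumes "finite_graph V E" and pos: "\<And>e. e \<in> E \<Longrightarrow> 0 < len e"
    and p: "p \<in> complex_points V E len" and q: "q \<in> complex_points V E len" and "p \<noteq> q"
  shows "\<exists>c>0. \<forall>r. linear_path V E len p r q \<longrightarrow> c \<le> r"
proof -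
  have E_sub: "E \<subseteq> Pow V"
    using assms(1) unfolding finite_graph_def by auto
  have finE: "finite E"
    using finite_subset[OF E_sub] assms(1) unfolding finite_graph_def by simp
  define m where "m = Min (insert 1 (len ` E))"
  have m: "0 < m" "\<And>e. e \<in> E \<Longrightarrow> m \<le> len e"
    unfolding m_def using finE pos by auto
  have "\<exists>\<phi> :: 'a cpoint \<Rightarrow> real. \<phi> p = 0 \<and> 0 < \<phi> q \<and>
      (\<forall>e s s'. e \<in> E \<longrightarrow> s \<in> {0..len e} \<longrightarrow> s' \<in> {0..len e} \<longrightarrow>
        \<phi> (edge_point len e s') - \<phi> (edge_point len e s) \<le> \<bar>s - s'\<bar>)"
  proof (cases p)
    case (Vertex x)
    define \<psi> where "\<psi> e s = min m (min (if edge_tail e = x then s else m)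
        (if edge_head e = x then len e - s else m))" for e s
    define \<phi> where "\<phi> z = (case z of Vertex y \<Rightarrow> if y = x then 0 else m | Interior e s \<Rightarrow> \<psi> e s)" for z
    have eq: "\<phi> (edge_point len e s) = \<psi> e s" if "e \<in> E" "s \<in> {0..len e}" for e s
      using that m(1) pos[OF that(1)] m(2)[OF that(1)]
      by (auto simp: edge_point_def \<phi>_def \<psi>_def min_def)
    have "\<phi> q > 0"
    proof (cases q)
      case (Vertex y)
      then show ?thesis using \<open>p \<noteq> q\<close> \<open>p = Vertex x\<close> m(1) by (simp add: \<phi>_def)
    next
      case (Interior e s)
      then have "0 < s" "s < len e"
        using q unfolding complex_points_def
        by (auto simp: edge_point_def split: if_splits)
      then show ?thesis using Interior m(1) by (simp add: \<phi>_def \<psi>_def)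
    qed
    moreover have "\<psi> e s' - \<psi> e s \<le> \<bar>s - s'\<bar>" for e s s'
      unfolding \<psi>_def by (auto simp: min_def)
    ultimately show ?thesis
      using Vertex eq by (intro exI[of _ \<phi>]) (auto simp: \<phi>_def)
  next
    case (Interior e0 s0)
    then have s0: "0 < s0" "s0 < len e0" "e0 \<in> E"
      using p unfolding complex_points_def
      by (auto simp: edge_point_def split: if_splits)
    define c where "c = min s0 (len e0 - s0)"
    have c: "0 < c" using s0 by (simp add: c_def)
    define \<psi> where "\<psi> e s = (if e = e0 then min c \<bar>s - s0\<bar> else c)" for e s
    define \<phi> where "\<phi> z = (case z of Vertex y \<Rightarrow> c | Interior e s \<Rightarrow> \<psi> e s)" for z
    have eq: "\<phi> (edge_point len e s) = \<psi> e s" if "e \<in> E" "s \<in> {0..len e}" for e s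
      using that by (auto simp: edge_point_def \<phi>_def \<psi>_def c_def min_def)
    have "\<phi> q > 0"
      using c \<open>p \<noteq> q\<close> Interior by (cases q) (auto simp: \<phi>_def \<psi>_def)
    moreover have "\<psi> e s' - \<psi> e s \<le> \<bar>s - s'\<bar>" for e s s'
      unfolding \<psi>_def by (auto simp: min_def)
    moreover have "\<phi> p = 0"
      using Interior c by (simp add: \<phi>_def \<psi>_def)
    ultimately show ?thesis
      using eq by (intro exI[of _ \<phi>]) auto
  qed
  then obtain \<phi> :: "'a cpoint \<Rightarrow> real" where \<phi>: "\<phi> p = 0" "0 < \<phi> q"
    "\<And>e s s'. e \<in> E \<Longrightarrow> s \<in> {0..len e} \<Longrightarrow> s' \<in> {0..len e} \<Longrightarrow>
        \<phi> (edge_point len e s') - \<phi> (edge_point len e s) \<le> \<bar>s - s'\<bar>"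
    by blast
  show ?thesis
    using linear_path_lower_bound[of V E len p _ q \<phi>] \<phi> by (intro exI[of _ "\<phi> q"]) auto
qed

lemma Metric_space_path_dist:
  assumes "finite_graph V E" "connected_graph V E" "\<And>e. e \<in> E \<Longrightarrow> 0 < len e"
  shows "Metric_space (complex_points V E len) (path_dist V E len)"
proof
  let ?L = "\<lambda>p q. {r. linear_path V E len p r q}"
  have bdd: "bdd_below (?L p q)" for p q
    using linear_path_in[of V E len p _ q] by (intro bdd_belowI[of _ 0]) auto
  have ne: "?L p q \<noteq> {}" if "p \<in> complex_points V E len" "q \<in> complex_points V E len" for p q
    using linear_path_exists[OF assms that] by auto
  have nn: "0 \<le> path_dist V E len p q" for p q
    unfolding path_dist_def using ne[of p q] linear_path_in[of V E len p _ q]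
    by (auto intro!: cInf_greatest)
  show "0 \<le> path_dist V E len p q" for p q
    by (rule nn)
  have "linear_path V E len p r q = linear_path V E len q r p" for p q r
    using linear_path_sym by blast
  then show "path_dist V E len p q = path_dist V E len q p" for p q
    unfolding path_dist_def by auto
  show "path_dist V E len p q = 0 \<longleftrightarrow> p = q"
    if pq: "p \<in> complex_points V E len" "q \<in> complex_points V E len" for p q
  proof
    assume 0: "path_dist V E len p q = 0"
    show "p = q"
    proof (rule ccontr)
      assume "p \<noteq> q"
      then obtain c where c: "0 < c" "\<And>r. linear_path V E len p r q \<Longrightarrow> c \<le> r"
        using linear_path_separated[OF assms(1,3) pq] by blast
      then have "c \<le> Inf (?L p q)"
        using ne[OF pq] by (intro cInf_greatest) auto
      then show False
        using 0 c(1) pq by (simp add: path_dist_def)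
    qed
  next
    assume "p = q"
    then have "0 \<in> ?L p q"
      using linear_path.refl[OF pq(1)] by simp
    then have "Inf (?L p q) \<le> 0"
      by (rule cInf_lower[OF _ bdd])
    then show "path_dist V E len p q = 0"
      using nn[of p q] pq by (simp add: path_dist_def)
  qed
  show "path_dist V E len p z \<le> path_dist V E len p q + path_dist V E len q z"
    if pqz: "p \<in> complex_points V E len" "q \<in> complex_points V E len" "z \<in> complex_points V E len"
    for p q z
  proof -
    have le: "Inf (?L p z) \<le> r + r'" if "r \<in> ?L p q" "r' \<in> ?L q z" for r r'
      using that by (intro cInf_lower[OF _ bdd]) (auto intro: linear_path_trans)
    have "Inf (?L p z) - r \<le> Inf (?L q z)" if "r \<in> ?L p q" for r
      using ne[OF pqz(2,3)] le[OF that] by (intro cInf_greatest) (auto simp: diff_le_eq add.commute)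
    then have "Inf (?L p z) - Inf (?L q z) \<le> Inf (?L p q)"
      using ne[OF pqz(1,2)] by (intro cInf_greatest) (auto simp: diff_le_eq add.commute)
    then show ?thesis
      using pqz by (simp add: path_dist_def)
  qed
qed

lemma
  assumes "finite_graph V E" "connected_graph V E" "\<And>e. e \<in> E \<Longrightarrow> 0 < len e"
  shows mspace_metric_graph: "mspace (metric_graph V E len) = complex_points V E len"
    and mdist_metric_graph: "mdist (metric_graph V E len) = path_dist V E len"
proof -
  interpret Metric_space "complex_points V E len" "path_dist V E len"
    using assms by (rule Metric_space_path_dist)
  show "mspace (metric_graph V E len) = complex_points V E len"
    and "mdist (metric_graph V E len) = path_dist V E len"
    by (simp_all add: metric_graph_def)
qed


section \<open>Absolutely minimal Lipschitz extensions\<close>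

definition Lip :: "'a metric \<Rightarrow> 'b metric \<Rightarrow> 'a set \<Rightarrow> ('a \<Rightarrow> 'b) \<Rightarrow> ennreal" where
  "Lip X Z S h =
     (SUP (x, y)\<in>{(x, y). x \<in> S \<and> y \<in> S \<and> x \<noteq> y}. ennreal (mdist Z (h x) (h y) / mdist X x y))"

definition AMLE ::
  "'a metric \<Rightarrow> 'b metric \<Rightarrow> 'a set \<Rightarrow> ('a \<Rightarrow> 'b) \<Rightarrow> ('a \<Rightarrow> 'b) \<Rightarrow> bool" where
  "AMLE X Z Y f g \<longleftrightarrow>
     Lipschitz_continuous_map X Z g \<and> (\<forall>y\<in>Y. g y = f y) \<and>
     (\<forall>U h. openin (mtopology_of X) U \<and> U \<subseteq> mspace X - Y \<and>
        Lipschitz_continuous_map X Z h \<and> (\<forall>x\<in>mspace X - U. h x = g x)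
        \<longrightarrow> Lip X Z U g \<le> Lip X Z U h)"


section \<open>The game of Politics\<close>

text \<open>
  A round is a tuple \<open>(opposition target, new target, coin, new position)\<close>, where the coin shows
  \<^term>\<open>True\<close> if Player I wins the toss. The entry \<open>h k\<close> of a history \<open>h\<close> is the round number
  \<open>k + 1\<close>; the game position and the target before that round are \<open>position k h\<close> and \<open>target k h\<close>.
\<close>

type_synonym ('v, 't) round = "'t \<times> 't \<times> bool \<times> 'v"
type_synonym ('v, 't) history = "nat \<Rightarrow> ('v, 't) round"

text \<open>
  Strategies are random: given the number \<open>n\<close> of completed rounds, the history of these rounds and
  the moves already made in the current round, they yield a probability distribution on moves. A
  deterministic choice is a point mass. As usual, the choices have to depend measurably on the past,
  so that a pair of strategies determines a law of the play. The move functions \<open>moveI\<close> and \<open>moveII\<close> apply if the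
  respective player has won the toss of the current round.
\<close>

record ('v, 't) strategyI =
  opposeI :: "nat \<Rightarrow> ('v, 't) history \<Rightarrow> 't measure"
  moveI :: "nat \<Rightarrow> ('v, 't) history \<Rightarrow> 't \<Rightarrow> 't \<Rightarrow> 'v measure"

record ('v, 't) strategyII =
  targetII :: "nat \<Rightarrow> ('v, 't) history \<Rightarrow> 't \<Rightarrow> 't measure"
  moveII :: "nat \<Rightarrow> ('v, 't) history \<Rightarrow> 't \<Rightarrow> 't \<Rightarrow> 'v measure"

definition metric_borel :: "'a metric \<Rightarrow> 'a measure" where
  "metric_borel X = sigma (mspace X) {U. openin (mtopology_of X) U}"

locale politics =
  fixes V :: "'v set" and E :: "'v set set" and Y :: "'v set"
    and T :: "'t metric" and f :: "'v \<Rightarrow> 't"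
    and x0 :: 'v and t0 :: 't
begin

definition round_space :: "('v, 't) round measure" where
  "round_space =
     metric_borel T \<Otimes>\<^sub>M metric_borel T \<Otimes>\<^sub>M count_space (UNIV :: bool set) \<Otimes>\<^sub>M count_space V"

definition history_space :: "nat \<Rightarrow> ('v, 't) history measure" where
  "history_space n = Pi\<^sub>M {0..<n} (\<lambda>_. round_space)"

fun position :: "nat \<Rightarrow> ('v, 't) history \<Rightarrow> 'v" where
  "position 0 h = x0"
| "position (Suc k) h = (case h k of (_, _, _, x) \<Rightarrow> x)"

fun target :: "nat \<Rightarrow> ('v, 't) history \<Rightarrow> 't" where
  "target 0 h = t0"
| "target (Suc k) h = (case h k of (_, t, _, _) \<Rightarrow> t)"

definition opposition :: "nat \<Rightarrow> ('v, 't) history \<Rightarrow> 't" where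
  "opposition k h = (case h k of (q, _, _, _) \<Rightarrow> q)"

definition legal_moves ::
  "(nat \<Rightarrow> ('v, 't) history \<Rightarrow> 't \<Rightarrow> 't \<Rightarrow> 'v measure) \<Rightarrow> bool" where
  "legal_moves m \<longleftrightarrow> (\<forall>n.
     (\<lambda>(h, q, t). m n h q t) \<in>
       history_space n \<Otimes>\<^sub>M metric_borel T \<Otimes>\<^sub>M metric_borel T \<rightarrow>\<^sub>M prob_algebra (count_space V) \<and>
     (\<forall>h\<in>space (history_space n). \<forall>q\<in>mspace T. \<forall>t\<in>mspace T.
       AE x in m n h q t. {position n h, x} \<in> E))"

definition strategiesI :: "('v, 't) strategyI set" where
  "strategiesI = {\<sigma>.
     (\<forall>n. opposeI \<sigma> n \<in> history_space n \<rightarrow>\<^sub>M prob_algebra (metric_borel T)) \<and>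
     legal_moves (moveI \<sigma>)}"

definition strategiesII :: "('v, 't) strategyII set" where
  "strategiesII = {\<tau>.
     (\<forall>n. (\<lambda>(h, q). targetII \<tau> n h q) \<in>
        history_space n \<Otimes>\<^sub>M metric_borel T \<rightarrow>\<^sub>M prob_algebra (metric_borel T)) \<and>
     legal_moves (moveII \<tau>)}"

definition round_law ::
  "('v, 't) strategyI \<Rightarrow> ('v, 't) strategyII \<Rightarrow> nat \<Rightarrow> ('v, 't) history \<Rightarrow> ('v, 't) round measure" where
  "round_law \<sigma> \<tau> n h = do {
     q \<leftarrow> opposeI \<sigma> n h;
     t \<leftarrow> targetII \<tau> n h q;
     c \<leftarrow> measure_pmf (bernoulli_pmf (1 / 2));
     x \<leftarrow> (if c then moveI \<sigma> n h q t else moveII \<tau> n h q t);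
     return round_space (q, t, c, x)
   }"

text \<open>
  The law of the infinite sequence of rounds, by the Ionescu-Tulcea theorem. It is convenient to let
  the players go on after the end of the game; the payoff ignores these rounds.
\<close>

definition play_law ::
  "('v, 't) strategyI \<Rightarrow> ('v, 't) strategyII \<Rightarrow> ('v, 't) history measure" where
  "play_law \<sigma> \<tau> =
     projective_family.lim UNIV (Ionescu_Tulcea.CI (round_law \<sigma> \<tau>) (\<lambda>_. round_space))
       (\<lambda>_. round_space)"

definition terminates :: "('v, 't) history \<Rightarrow> bool" where
  "terminates h \<longleftrightarrow> (\<exists>k\<ge>1. position k h \<in> Y)"

definition last_round :: "('v, 't) history \<Rightarrow> nat" where
  "last_round h = (LEAST k. k \<ge> 1 \<and> position k h \<in> Y)"

definition payoff :: "('v, 't) history \<Rightarrow> real" where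
  "payoff h =
     (if terminates h then
        (\<Sum>k<last_round h.
           mdist T (opposition k h) (target k h) - mdist T (opposition k h) (target (Suc k) h))
        + mdist T (f (position (last_round h) h)) (target (last_round h) h)
      else 0)"

text \<open>
  \<open>C\<close> is the value assigned by convention if the game may fail to terminate or if the payoff has no
  (finite) expectation.
\<close>

definition expected_payoff ::
  "real \<Rightarrow> ('v, 't) strategyI \<Rightarrow> ('v, 't) strategyII \<Rightarrow> real" where
  "expected_payoff C \<sigma> \<tau> =
     (if (AE h in play_law \<sigma> \<tau>. terminates h) \<and> integrable (play_law \<sigma> \<tau>) payoff
      then (\<integral>h. payoff h \<partial>play_law \<sigma> \<tau>) else C)"

definition valueI :: "real \<Rightarrow> ereal" where
  "valueI C = (SUP \<sigma>\<in>strategiesI. INF \<tau>\<in>strategiesII. ereal (expected_payoff C \<sigma> \<tau>))"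

definition valueII :: "real \<Rightarrow> ereal" where
  "valueII C = (INF \<tau>\<in>strategiesII. SUP \<sigma>\<in>strategiesI. ereal (expected_payoff C \<sigma> \<tau>))"

definition has_value :: "real \<Rightarrow> real \<Rightarrow> bool" where
  "has_value C v \<longleftrightarrow> valueI C = ereal v \<and> valueII C = ereal v"

text \<open>For strategies as above, the transition laws satisfy the hypotheses of Ionescu-Tulcea.\<close>

lemma round_law_measurable:
  assumes "\<sigma> \<in> strategiesI" "\<tau> \<in> strategiesII"
  shows "round_law \<sigma> \<tau> n \<in> history_space n \<rightarrow>\<^sub>M prob_algebra round_space"
proof -
  let ?T = "metric_borel T" and ?B = "count_space (UNIV :: bool set)" and ?H = "history_space n"
  have q: "opposeI \<sigma> n \<in> ?H \<rightarrow>\<^sub>M prob_algebra ?T"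
    and t: "(\<lambda>(h, q). targetII \<tau> n h q) \<in> ?H \<Otimes>\<^sub>M ?T \<rightarrow>\<^sub>M prob_algebra ?T"
    and moves:
      "(\<lambda>(h, q, t). moveI \<sigma> n h q t) \<in> ?H \<Otimes>\<^sub>M ?T \<Otimes>\<^sub>M ?T \<rightarrow>\<^sub>M prob_algebra (count_space V)"
      "(\<lambda>(h, q, t). moveII \<tau> n h q t) \<in> ?H \<Otimes>\<^sub>M ?T \<Otimes>\<^sub>M ?T \<rightarrow>\<^sub>M prob_algebra (count_space V)"
    using assms by (auto simp: strategiesI_def strategiesII_def legal_moves_def)
  let ?M = "(?H \<Otimes>\<^sub>M ?T) \<Otimes>\<^sub>M ?T"
  have reassoc: "(\<lambda>((h, q), t). (h, q, t)) \<in> ?M \<rightarrow>\<^sub>M ?H \<Otimes>\<^sub>M ?T \<Otimes>\<^sub>M ?T"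
    unfolding split_def by measurable
  have moves': "(\<lambda>((h, q), t). moveI \<sigma> n h q t) \<in> ?M \<rightarrow>\<^sub>M prob_algebra (count_space V)"
    "(\<lambda>((h, q), t). moveII \<tau> n h q t) \<in> ?M \<rightarrow>\<^sub>M prob_algebra (count_space V)"
    using measurable_compose[OF reassoc moves(1)] measurable_compose[OF reassoc moves(2)]
    by (simp_all add: split_def)
  have branch: "(\<lambda>(x, c). if c then A x else B x) \<in> M \<Otimes>\<^sub>M ?B \<rightarrow>\<^sub>M prob_algebra (count_space V)"
    if [measurable]: "A \<in> M \<rightarrow>\<^sub>M prob_algebra (count_space V)" "B \<in> M \<rightarrow>\<^sub>M prob_algebra (count_space V)"
    for A B and M :: "((('v, 't) history \<times> 't) \<times> 't) measure"
    by measurable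
  have move: "(\<lambda>(((h, q), t), c). if c then moveI \<sigma> n h q t else moveII \<tau> n h q t)
      \<in> ?M \<Otimes>\<^sub>M ?B \<rightarrow>\<^sub>M prob_algebra (count_space V)"
    using branch[OF moves'[unfolded split_def]] unfolding split_def .
  have ret: "(\<lambda>((((h, q), t), c), x). return round_space (q, t, c, x))
      \<in> (?M \<Otimes>\<^sub>M ?B) \<Otimes>\<^sub>M count_space V \<rightarrow>\<^sub>M prob_algebra round_space"
    unfolding round_space_def split_def
    by (rule measurable_compose[OF _ measurable_return_prob_space]) measurable
  have coin: "measure_pmf (bernoulli_pmf (1 / 2)) \<in> space (prob_algebra ?B)"
    by (simp add: space_prob_algebra measure_pmf.prob_space_axioms)
  show ?thesis
    unfolding round_law_def[abs_def]
    apply (rule measurable_bind_prob_space2[OF q])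
    unfolding split_def
    apply (rule measurable_bind_prob_space2[OF t[unfolded split_def]])
    unfolding split_def
    apply (rule measurable_bind_prob_space2[OF measurable_const[OF coin]])
    unfolding split_def
    apply (rule measurable_bind_prob_space2[OF move[unfolded split_def]])
    unfolding split_def
    apply (rule ret[unfolded split_def])
    done
qed

lemma Ionescu_Tulcea_round_law:
  assumes "\<sigma> \<in> strategiesI" "\<tau> \<in> strategiesII"
  shows "Ionescu_Tulcea (round_law \<sigma> \<tau>) (\<lambda>_. round_space)"
proof (rule Ionescu_Tulcea.intro)
  show "round_law \<sigma> \<tau> i \<in> Pi\<^sub>M {0..<i} (\<lambda>_. round_space) \<rightarrow>\<^sub>M subprob_algebra round_space" for i
    using round_law_measurable[OF assms, of i] by (simp add: history_space_def measurable_prob_algebraD)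
  show "prob_space (round_law \<sigma> \<tau> i h)" if "h \<in> space (Pi\<^sub>M {0..<i} (\<lambda>_. round_space))" for i h
    using measurable_space[OF round_law_measurable[OF assms, of i], of h] that
    by (simp add: history_space_def space_prob_algebra)
qed

end

end

theory Submission
  imports Defs
begin

text \<open>
  Write \<open>u\<close> for the AMLE on the vertices. If some neighbour of \<open>x \<notin> Y\<close> has image different from \<open>u x\<close>,
  there are neighbours \<open>y\<close> and \<open>z\<close> whose images are as far from \<open>u x\<close> as possible and lie in opposite
  directions. Player I opposes at \<open>u x\<close> and, on winning the toss, moves to the one of \<open>y\<close>, \<open>z\<close> whose image
  is farther from the new target; Player II picks as target the image of the one farther from the
  opposition target, and moves there. By the four-point condition of the tree, the running payoff
  plus \<open>d (u x) t\<close>, where \<open>t\<close> is the current target, is then a submartingale, respectively a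
  supermartingale, against every opponent.

  The opponent could still prolong the game forever. Adding to the payoff a small multiple of the
  squared distance of \<open>u x\<close> to a base point and a much smaller term that rewards leaving the region
  where \<open>u\<close> is locally constant makes the drift uniformly positive. Hence playing in this way for a
  large fixed number of rounds, and walking straight to \<open>Y\<close> afterwards, costs at most \<open>\<epsilon>\<close>: the cost of
  the second phase is paid by the drift accumulated in the first.
\<close>

section \<open>Metric trees\<close>

text \<open>Each round is judged by a pair of hypothetical moves, one for each outcome of the toss.
  If the opponent's move \<open>w\<close> misses the opposite of the chosen neighbour
  \<open>a\<close> by a defect \<open>s\<close>, that is
  \<open>2 * slope x - s \<le> d (u a) (u w)\<close>, the opponent pays at least \<open>s\<close> in
  the running terms summed over both outcomes. The same defect costs the squared distance at most a
  multiple of \<open>s\<close>, and its coefficient is so small that the payment covers this loss.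
  Hence a strict drift survives every reply. The drift alone does not settle the game: a play that
  may fail to end is worth \<open>C\<close>, however much the opponent has paid. So the end has to
  be forced. Walking to \<open>Y\<close> takes at most \<open>\<Psi>\<close> rounds on average, each
  costing at most \<open>2 * D\<close>, where \<open>D\<close> bounds the diameter of the tree. This
  cost is known in advance, which fixes the length of the first phase. The AMLE provides two
  opposite steepest neighbours at every vertex outside \<open>Y\<close>; they come from competitors
  that change it on one open edge or on a small star around one vertex.\<close>

inductive grown_tree :: "'v set \<Rightarrow> 'v set set \<Rightarrow> bool" where
  single: "grown_tree {r} {}"
| leaf: "grown_tree W D \<Longrightarrow> a \<in> W \<Longrightarrow> b \<notin> W \<Longrightarrow> grown_tree (insert b W) (insert {a, b} D)"

lemma grown_tree_finite_graph: "grown_tree W D \<Longrightarrow> finite_graph W D"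
  by (induction rule: grown_tree.induct) (auto simp: finite_graph_def)

lemma finite_graph_edge_subset: "finite_graph V E \<Longrightarrow> e \<in> E \<Longrightarrow> e \<subseteq> V"
  by (auto simp: finite_graph_def)

lemma grown_tree_simple_path:
  assumes "grown_tree W D" "x \<in> W" "y \<in> W"
  shows "\<exists>xs. xs \<noteq> [] \<and> distinct xs \<and> set xs \<subseteq> W \<and> hd xs = x \<and> last xs = y \<and>
    successively (\<lambda>a b. {a, b} \<in> D) xs"
  using assms
proof (induction arbitrary: x y rule: grown_tree.induct)
  case (single r)
  then show ?case by (intro exI[of _ "[r]"]) auto
next
  case (leaf W D a b)
  let ?D = "insert {a, b} D"
  have mono: "successively (\<lambda>u v. {u, v} \<in> ?D) xs" if "successively (\<lambda>u v. {u, v} \<in> D) xs" for xs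
    using that by (rule successively_mono) auto
  consider "x = b" "y = b" | "x \<in> W" "y \<in> W" | "x \<in> W" "y = b" | "x = b" "y \<in> W"
    using leaf.prems by auto
  then show ?case
  proof cases
    case 1
    then show ?thesis by (intro exI[of _ "[b]"]) auto
  next
    case 2
    then obtain xs where "xs \<noteq> [] \<and> distinct xs \<and> set xs \<subseteq> W \<and> hd xs = x \<and> last xs = y \<and>
        successively (\<lambda>a b. {a, b} \<in> D) xs"
      using leaf.IH by blast
    then show ?thesis using mono by (intro exI[of _ xs]) auto
  next
    case 3
    then obtain xs where "xs \<noteq> [] \<and> distinct xs \<and> set xs \<subseteq> W \<and> hd xs = x \<and> last xs = a \<and>
        successively (\<lambda>a b. {a, b} \<in> D) xs"
      using leaf.IH leaf.hyps by blast
    then show ?thesis using mono 3 leaf.hyps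
      by (intro exI[of _ "xs @ [b]"]) (auto simp: successively_append_iff)
  next
    case 4
    then obtain xs where "xs \<noteq> [] \<and> distinct xs \<and> set xs \<subseteq> W \<and> hd xs = a \<and> last xs = y \<and>
        successively (\<lambda>a b. {a, b} \<in> D) xs"
      using leaf.IH leaf.hyps by blast
    then show ?thesis using mono 4 leaf.hyps
      by (intro exI[of _ "b # xs"]) (auto simp: successively_Cons insert_commute)
  qed
qed

lemma grown_tree_connected: "grown_tree W D \<Longrightarrow> connected_graph W D"
proof (induction rule: grown_tree.induct)
  case (single r)
  then show ?case by (auto simp: connected_graph_def)
next
  case (leaf W D a b)
  let ?R = "{(u, v). {u, v} \<in> insert {a, b} D}"
  have sub: "{(u, v). {u, v} \<in> D}\<^sup>* \<subseteq> ?R\<^sup>*"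
    by (rule rtrancl_mono) auto
  have W: "(u, v) \<in> ?R\<^sup>*" if "u \<in> W" "v \<in> W" for u v
    using leaf.IH that sub unfolding connected_graph_def by blast
  have ab: "(a, b) \<in> ?R\<^sup>*" "(b, a) \<in> ?R\<^sup>*"
    by (auto simp: insert_commute)
  have "(u, a) \<in> ?R\<^sup>* \<and> (a, u) \<in> ?R\<^sup>*" if "u \<in> insert b W" for u
    using that W leaf.hyps(2) ab by blast
  then show ?case
    unfolding connected_graph_def by (meson insert_not_empty rtrancl_trans)
qed

text \<open>Growth leaf by leaf is what lets metric facts be proved by gluing one interval at a
  time. A maximal grown subtree contains all vertices, since connectedness would otherwise supply a
  new leaf, and all edges, since an extra edge would close a simple path of the subtree into a
  cycle.\<close>

lemma finite_tree_grown:
  assumes "finite_tree W D"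
  shows "grown_tree W D"
proof -
  have gr: "finite_graph W D" and con: "connected_graph W D"
    and noloop: "\<And>x. {x} \<notin> D" and acyc: "\<And>xs. \<not> graph_cycle D xs"
    using assms unfolding finite_tree_def by blast+
  have fin: "finite W" using gr by (simp add: finite_graph_def)
  let ?S = "{W0. W0 \<subseteq> W \<and> (\<exists>D0\<subseteq>D. grown_tree W0 D0)}"
  obtain r where "r \<in> W"
    using con by (auto simp: connected_graph_def)
  then have "{r} \<in> ?S"
    by (auto intro!: exI[of _ "{}"] grown_tree.single)
  then have "?S \<noteq> {}" by (rule ex_in_conv[THEN iffD1, OF exI])
  moreover have "finite ?S"
    by (rule finite_subset[of _ "Pow W"]) (use fin in auto)
  ultimately have "\<exists>W0\<in>?S. \<forall>W1\<in>?S. W0 \<subseteq> W1 \<longrightarrow> W0 = W1"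
    by (intro finite_has_maximal)
  then obtain W0 where W0: "W0 \<in> ?S" and max: "\<forall>W1\<in>?S. W0 \<subseteq> W1 \<longrightarrow> W0 = W1" ..
  from W0 obtain D0 where D0: "W0 \<subseteq> W" "D0 \<subseteq> D" "grown_tree W0 D0" by auto
  have closed: "b \<in> W0" if "a \<in> W0" "{a, b} \<in> D" for a b
  proof (rule ccontr)
    assume b: "b \<notin> W0"
    have "{a, b} \<subseteq> W" using finite_graph_edge_subset[OF gr that(2)] .
    moreover have "insert {a, b} D0 \<subseteq> D" using D0 that by simp
    ultimately have "insert b W0 \<in> ?S"
      using D0(1) grown_tree.leaf[OF D0(3) that(1) b] by blast
    then have "W0 = insert b W0" using max by (meson subset_insertI)
    then show False using b by blast
  qed
  have "W0 \<noteq> {}" using grown_tree_connected[OF D0(3)] by (auto simp: connected_graph_def)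
  then obtain w where w: "w \<in> W0" by auto
  have "v \<in> W0" if "v \<in> W" for v
  proof -
    have "(w, v) \<in> {(a, b). {a, b} \<in> D}\<^sup>*"
      using con that w D0(1) unfolding connected_graph_def by blast
    then show ?thesis
    proof (induction rule: rtrancl_induct)
      case (step y z)
      then show ?case using closed[of y z] by simp
    qed (rule w)
  qed
  then have WW: "W0 = W" using D0 by auto
  have "e \<in> D0" if e: "e \<in> D" for e
  proof (rule ccontr)
    assume e0: "e \<notin> D0"
    obtain a b where ab: "a \<in> W" "b \<in> W" "e = {a, b}"
      using gr e by (auto simp: finite_graph_def)
    have "a \<noteq> b" using noloop e ab by auto
    obtain xs where xs: "xs \<noteq> []" "distinct xs" "hd xs = a" "last xs = b"
        "successively (\<lambda>a b. {a, b} \<in> D0) xs"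
      using grown_tree_simple_path[OF D0(3), of a b] ab WW by blast
    \<comment> \<open>Length 1 is excluded because \<open>e\<close> is no loop, length 2 because the
      path would be the missing edge \<open>e\<close> itself.\<close>
    have len: "3 \<le> length xs"
    proof (rule ccontr)
      assume "\<not> 3 \<le> length xs"
      then consider "length xs = 0" | "length xs = 1" | "length xs = 2" by linarith
      then show False
      proof cases
        case 3
        then obtain u v where "xs = [u, v]" by (auto simp: length_Suc_conv numeral_2_eq_2)
        then show False using xs(3-5) e0 ab(3) by simp
      next
        case 2
        then obtain u where "xs = [u]" by (auto simp: length_Suc_conv)
        then show False using xs(3,4) \<open>a \<noteq> b\<close> by simp
      qed (use xs in simp)
    qed
    have "{xs ! i, xs ! (Suc i mod length xs)} \<in> D" if i: "i < length xs" for i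
    proof (cases "Suc i < length xs")
      case True
      then have "{xs ! i, xs ! Suc i} \<in> D0" using xs(5) by (simp add: successively_conv_nth)
      then show ?thesis using D0(2) True by auto
    next
      case False
      then have "Suc i = length xs" using i by simp
      moreover from this have "xs ! i = b" using xs(1,4) by (metis diff_Suc_1 last_conv_nth)
      moreover have "xs ! 0 = a" using xs by (simp add: hd_conv_nth)
      ultimately show ?thesis using e ab(3) by (metis mod_self insert_commute)
    qed
    then have "graph_cycle D xs" using xs len by (auto simp: graph_cycle_def)
    then show False using acyc by blast
  qed
  then have "D0 = D" using D0(2) by blast
  then show ?thesis using D0(3) WW by simp
qed

section \<open>The four-point condition (zero hyperbolicity in the sense of Gromov) and gluing of
  intervals\<close>

definition four_point :: "'a set \<Rightarrow> ('a \<Rightarrow> 'a \<Rightarrow> real) \<Rightarrow> bool" where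
  "four_point M d \<longleftrightarrow> (\<forall>p\<in>M. \<forall>q\<in>M. \<forall>r\<in>M. \<forall>s\<in>M. d p q + d r s \<le> max (d p r + d q s) (d p s + d q r))"

lemma path_dist_le:
  assumes "linear_path V E len p r q"
  shows "path_dist V E len p q \<le> r"
proof -
  have "bdd_below {r. linear_path V E len p r q}"
    using linear_path_in[of V E len p _ q] by (intro bdd_belowI[of _ 0]) auto
  then show ?thesis
    using assms linear_path_in[OF assms] by (auto simp: path_dist_def intro: cInf_lower)
qed

lemma path_dist_edge_le:
  assumes "e \<in> E" "s \<in> {0..len e}" "s' \<in> {0..len e}"
  shows "path_dist V E len (edge_point len e s) (edge_point len e s') \<le> \<bar>s - s'\<bar>"
  using linear_path_edge[of e E s len s' V] assms by (intro path_dist_le) auto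

lemma path_dist_less:
  assumes "finite_graph V E" "connected_graph V E" "\<And>e. e \<in> E \<Longrightarrow> 0 < len e"
    and "p \<in> complex_points V E len" "q \<in> complex_points V E len" "path_dist V E len p q < l"
  shows "\<exists>r<l. linear_path V E len p r q"
proof -
  have "bdd_below {r. linear_path V E len p r q}"
    using linear_path_in[of V E len p _ q] by (intro bdd_belowI[of _ 0]) auto
  then show ?thesis
    using assms linear_path_exists[OF assms(1-5)] by (auto simp: path_dist_def cInf_less_iff)
qed

text \<open>Lower bounds on distances come from test functions: what changes with speed at most one
  along each edge cannot grow by more than the length of a path.\<close>

lemma path_dist_ge:
  assumes "finite_graph V E" "connected_graph V E" "\<And>e. e \<in> E \<Longrightarrow> 0 < len e"
    and "p \<in> complex_points V E len" "q \<in> complex_points V E len"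
    and "\<And>e s s'. e \<in> E \<Longrightarrow> s \<in> {0..len e} \<Longrightarrow> s' \<in> {0..len e} \<Longrightarrow>
      \<phi> (edge_point len e s') - \<phi> (edge_point len e s) \<le> \<bar>s - s'\<bar>"
  shows "\<phi> q - \<phi> p \<le> path_dist V E len p q"
proof -
  have "\<phi> q - \<phi> p \<le> Inf {r. linear_path V E len p r q}"
    using linear_path_exists[OF assms(1-5)] linear_path_lower_bound[of V E len p _ q \<phi>] assms(6)
    by (intro cInf_greatest) auto
  then show ?thesis using assms by (simp add: path_dist_def)
qed

lemma linear_path_mono:
  assumes "linear_path V E len p r q" "V \<subseteq> V'" "E \<subseteq> E'"
  shows "linear_path V' E' len p r q"
  using assms(1)
proof (induction rule: linear_path.induct)
  case (refl p)
  have "complex_points V E len \<subseteq> complex_points V' E' len"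
    using assms by (auto simp: complex_points_def)
  then show ?case using refl by (auto intro: linear_path.refl)
next
  case (step e s s' r q)
  then show ?case using assms by (auto intro: linear_path.step)
qed

text \<open>
  Attaching an edge at a single vertex \<open>a\<close>: each new point is described by the gluing point \<open>a\<close> and
  its height above it, each old one by itself and height 0.
\<close>

lemma path_dist_attach_leaf:
  assumes gr: "grown_tree W D" "a \<in> W" "b \<notin> W"
    and pos: "\<And>e. e \<in> insert {a, b} D \<Longrightarrow> 0 < len e"
  defines "A \<equiv> complex_points W D len"
    and "X \<equiv> complex_points (insert b W) (insert {a, b} D) len"
  shows "\<exists>\<pi> ht. (\<forall>p\<in>X. \<pi> p \<in> A \<and> 0 \<le> ht p \<and> ht p \<le> len {a, b} \<and> (ht p = 0 \<or> \<pi> p = Vertex a)) \<and>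
    (\<forall>p\<in>X. \<forall>q\<in>X. path_dist (insert b W) (insert {a, b} D) len p q =
       path_dist W D len (\<pi> p) (\<pi> q) + \<bar>ht p - ht q\<bar>)"
proof -
  let ?e = "{a, b}"
  let ?W = "insert b W" and ?D = "insert ?e D"
  let ?d = "path_dist W D len" and ?d' = "path_dist ?W ?D len"
  have fg: "finite_graph W D" "connected_graph W D"
    and fg': "finite_graph ?W ?D" "connected_graph ?W ?D"
    using gr grown_tree.leaf[OF gr] by (auto intro: grown_tree_finite_graph grown_tree_connected)
  interpret d: Metric_space A ?d
    unfolding A_def using fg pos by (intro Metric_space_path_dist) auto
  interpret d': Metric_space X ?d'
    unfolding X_def using fg' pos by (intro Metric_space_path_dist) auto
  have eD: "?e \<notin> D"
    using gr finite_graph_edge_subset[OF fg(1)] by blast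
  have "a \<noteq> b" using gr by auto
  have l: "0 < len ?e" using pos by simp
  have th: "?e = {edge_tail ?e, edge_head ?e}"
    using edge_tail_head[OF fg'(1), of ?e] by simp
  then have th': "edge_tail ?e = a \<and> edge_head ?e = b \<or> edge_tail ?e = b \<and> edge_head ?e = a"
    by (auto simp: doubleton_eq_iff)
  \<comment> \<open>The orientation of the new edge is arbitrary; \<open>pos s\<close> is the arc
    length measured from the gluing vertex \<open>a\<close>.\<close>
  define pos where "pos s = (if edge_tail ?e = a then s else len ?e - s)" for s
  define \<pi> where "\<pi> z = (if z \<in> A then z else Vertex a)" for z
  define ht where "ht z = (if z \<in> A then 0 else case z of Vertex _ \<Rightarrow> len ?e | Interior _ s \<Rightarrow> pos s)" for z
  have aA: "Vertex a \<in> A" using gr by (auto simp: A_def complex_points_def)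
  have bA: "Vertex b \<notin> A"
    using gr edge_tail_head[OF fg(1)] by (auto simp: A_def complex_points_def edge_point_def)
  have iA: "Interior ?e s \<notin> A" for s
    using eD by (auto simp: A_def complex_points_def edge_point_def)
  have AX: "A \<subseteq> X" by (auto simp: A_def X_def complex_points_def)
  have ep: "\<pi> (edge_point len ?e s) = Vertex a" "ht (edge_point len ?e s) = pos s"
    if "s \<in> {0..len ?e}" for s
    using aA bA iA[of s] th' that l \<open>a \<noteq> b\<close>
    by (auto simp: \<pi>_def ht_def edge_point_def pos_def)
  have X: "z \<in> A \<or> (\<exists>s\<in>{0..len ?e}. z = edge_point len ?e s)" if "z \<in> X" for z
  proof -
    have "Vertex b = edge_point len ?e 0 \<or> Vertex b = edge_point len ?e (len ?e)"
      using th' l by (auto simp: edge_point_def)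
    then have "\<exists>s\<in>{0..len ?e}. Vertex b = edge_point len ?e s"
      using l by (meson atLeastAtMost_iff less_eq_real_def order_refl)
    then show ?thesis
      using that by (auto simp: X_def A_def complex_points_def)
  qed
  have pr: "\<pi> p \<in> A \<and> 0 \<le> ht p \<and> ht p \<le> len ?e \<and> (ht p = 0 \<or> \<pi> p = Vertex a)" if "p \<in> X" for p
    using X[OF that]
  proof
    assume "p \<in> A"
    then show ?thesis using l by (simp add: \<pi>_def ht_def)
  next
    assume "\<exists>s\<in>{0..len ?e}. p = edge_point len ?e s"
    then show ?thesis using ep aA by (auto simp: pos_def)
  qed
  have le1: "?d' p q \<le> ?d p q" if "p \<in> A" "q \<in> A" for p q
  proof (rule dense_ge)
    fix r assume r: "?d p q < r"
    have "\<exists>r'<r. linear_path W D len p r' q"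
      using that r assms(4) by (intro path_dist_less[OF fg]) (auto simp: A_def)
    then obtain r' where r': "r' < r" "linear_path W D len p r' q" by blast
    have "?d' p q \<le> r'"
      by (rule path_dist_le[OF linear_path_mono[OF r'(2)]]) auto
    then show "?d' p q \<le> r" using r' by simp
  qed
  have le2: "?d' p (\<pi> p) \<le> ht p" if p: "p \<in> X" for p
    using X[OF that]
  proof
    assume "p \<in> A"
    then show ?thesis using p by (simp add: \<pi>_def ht_def)
  next
    assume "\<exists>s\<in>{0..len ?e}. p = edge_point len ?e s"
    then obtain s where s: "s \<in> {0..len ?e}" "p = edge_point len ?e s" by blast
    define s0 where "s0 = (if edge_tail ?e = a then 0 else len ?e)"
    have "Vertex a = edge_point len ?e s0"
      using th' l by (auto simp: edge_point_def s0_def)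
    moreover have "?d' (edge_point len ?e s) (edge_point len ?e s0) \<le> \<bar>s - s0\<bar>"
      using s l by (intro path_dist_edge_le) (auto simp: s0_def)
    ultimately show ?thesis
      using s ep by (auto simp: s0_def pos_def split: if_splits)
  qed
  have le: "?d' p q \<le> ?d (\<pi> p) (\<pi> q) + \<bar>ht p - ht q\<bar>" if pq: "p \<in> X" "q \<in> X" for p q
  \<comment> \<open>If one point is old, its height is 0, and the route through
    \<open>\<pi> p\<close> and \<open>\<pi> q\<close> has the claimed length. Two new points are
    joined inside the new edge.\<close>
  proof (cases "p \<in> A \<or> q \<in> A")
    case True
    then have "\<bar>ht p - ht q\<bar> = ht p + ht q"
      using pr[OF pq(1)] pr[OF pq(2)] by (auto simp: ht_def)
    moreover have "?d' p q \<le> ?d' p (\<pi> p) + (?d' (\<pi> p) (\<pi> q) + ?d' (\<pi> q) q)"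
    proof -
      have "\<pi> p \<in> X" "\<pi> q \<in> X" using pr pq AX by blast+
      then show ?thesis
        using d'.triangle[of p "\<pi> p" q] d'.triangle[of "\<pi> p" "\<pi> q" q] pq by simp
    qed
    ultimately show ?thesis
      using le2[OF pq(1)] le2[OF pq(2)] le1[of "\<pi> p" "\<pi> q"] pr[OF pq(1)] pr[OF pq(2)]
      by (simp add: d'.commute)
  next
    case False
    then obtain s s' where s: "s \<in> {0..len ?e}" "p = edge_point len ?e s"
        "s' \<in> {0..len ?e}" "q = edge_point len ?e s'"
      using X[OF pq(1)] X[OF pq(2)] by blast
    then have "?d' p q \<le> \<bar>s - s'\<bar>"
      by (auto intro: path_dist_edge_le)
    then show ?thesis
      using s ep aA by (auto simp: pos_def abs_if split: if_splits)
  qed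
  have ge: "?d (\<pi> p) (\<pi> q) + \<bar>ht p - ht q\<bar> \<le> ?d' p q" if pq: "p \<in> X" "q \<in> X" for p q
  proof -
    \<comment> \<open>The claimed distance from \<open>p\<close> serves as the test function. On the
      new edge only the height varies, on an old edge only the projection.\<close>
    define \<phi> where "\<phi> z = ?d (\<pi> p) (\<pi> z) + \<bar>ht p - ht z\<bar>" for z
    have "\<phi> q - \<phi> p \<le> ?d' p q"
    proof (rule path_dist_ge[OF fg'])
      fix e s s' assume e: "e \<in> ?D" "s \<in> {0..len e}" "s' \<in> {0..len e}"
      show "\<phi> (edge_point len e s') - \<phi> (edge_point len e s) \<le> \<bar>s - s'\<bar>"
      proof (cases "e = ?e")
        case True
        then show ?thesis
          using e ep by (auto simp: \<phi>_def pos_def abs_if split: if_splits)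
      next
        case False
        then have "e \<in> D" using e by auto
        then have in_A: "edge_point len e s \<in> A" "edge_point len e s' \<in> A"
          unfolding A_def using e by (auto intro: edge_point_in)
        moreover have "?d (edge_point len e s) (edge_point len e s') \<le> \<bar>s - s'\<bar>"
          using \<open>e \<in> D\<close> e by (intro path_dist_edge_le) auto
        moreover have "?d (\<pi> p) (edge_point len e s') \<le>
            ?d (\<pi> p) (edge_point len e s) + ?d (edge_point len e s) (edge_point len e s')"
          using in_A pr[OF pq(1)] by (intro d.triangle) auto
        ultimately show ?thesis by (simp add: \<phi>_def \<pi>_def ht_def)
      qed
    qed (use assms(4) pq in \<open>auto simp: X_def\<close>)
    moreover have "\<phi> p = 0"
      using pr[OF pq(1)] by (simp add: \<phi>_def)
    ultimately show ?thesis by (simp add: \<phi>_def)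
  qed
  show ?thesis
    using pr le ge by (intro exI[of _ \<pi>] exI[of _ ht]) (auto intro: antisym)
qed

text \<open>Each of the four points has height 0 or projects to \<open>a\<close>. In each of the
  sixteen cases the claim follows from the condition for the projections and triangle inequalities
  through \<open>a\<close>.\<close>

lemma four_point_attach:
  assumes fp: "four_point A d" and "Metric_space A d" and "a \<in> A"
    and pr: "\<And>p. p \<in> X \<Longrightarrow> \<pi> p \<in> A \<and> 0 \<le> ht p \<and> (ht p = 0 \<or> \<pi> p = a)"
    and d': "\<And>p q. p \<in> X \<Longrightarrow> q \<in> X \<Longrightarrow> d' p q = d (\<pi> p) (\<pi> q) + \<bar>ht p - ht q\<bar>"
  shows "four_point X d'"
  unfolding four_point_def
proof (intro ballI)
  interpret Metric_space A d by fact
  fix p q r s assume X: "p \<in> X" "q \<in> X" "r \<in> X" "s \<in> X"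
  have tri: "d (\<pi> x) (\<pi> y) \<le> d (\<pi> x) a + d (\<pi> y) a" if "x \<in> X" "y \<in> X" for x y
    using triangle[of "\<pi> x" a "\<pi> y"] pr[OF that(1)] pr[OF that(2)] assms(3) by (simp add: commute)
  have aa: "d a a = 0" and c: "\<And>x. d a (\<pi> x) = d (\<pi> x) a"
    using assms(3) by (auto simp: commute)
  have f: "d (\<pi> p) (\<pi> q) + d (\<pi> r) (\<pi> s) \<le> max (d (\<pi> p) (\<pi> r) + d (\<pi> q) (\<pi> s)) (d (\<pi> p) (\<pi> s) + d (\<pi> q) (\<pi> r))"
    using fp X pr unfolding four_point_def by blast
  have nn: "0 \<le> d x y" for x y by simp
  note P = pr[OF X(1)] pr[OF X(2)] pr[OF X(3)] pr[OF X(4)]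
  note t = tri[OF X(1,2)] tri[OF X(3,4)] tri[OF X(1,3)] tri[OF X(2,4)] tri[OF X(1,4)] tri[OF X(2,3)]
  note n = nn[of "\<pi> p" a] nn[of "\<pi> q" a] nn[of "\<pi> r" a] nn[of "\<pi> s" a]
  show "d' p q + d' r s \<le> max (d' p r + d' q s) (d' p s + d' q r)"
    unfolding d'[OF X(1,2)] d'[OF X(3,4)] d'[OF X(1,3)] d'[OF X(2,4)] d'[OF X(1,4)] d'[OF X(2,3)]
    using P
    apply (elim conjE disjE)
                   apply (use t f in \<open>simp_all add: aa c\<close>)
    done
qed

lemma grown_tree_four_point_bounded:
  assumes "grown_tree W D" "\<And>e. e \<in> D \<Longrightarrow> 0 < len e"
  shows "four_point (complex_points W D len) (path_dist W D len) \<and>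
    (\<exists>B. \<forall>p\<in>complex_points W D len. \<forall>q\<in>complex_points W D len. path_dist W D len p q \<le> B)"
  using assms
proof (induction rule: grown_tree.induct)
  case (single r)
  have "complex_points {r} {} len = {Vertex r}" by (auto simp: complex_points_def)
  then show ?case by (auto simp: four_point_def)
next
  case (leaf W D a b)
  let ?A = "complex_points W D len" and ?d = "path_dist W D len"
  let ?X = "complex_points (insert b W) (insert {a, b} D) len"
  have IH: "four_point ?A ?d" "\<exists>B. \<forall>p\<in>?A. \<forall>q\<in>?A. ?d p q \<le> B"
    using leaf by auto
  have M: "Metric_space ?A ?d"
    using leaf by (intro Metric_space_path_dist grown_tree_finite_graph grown_tree_connected) auto
  have a: "Vertex a \<in> ?A" using leaf by (auto simp: complex_points_def)
  obtain \<pi> ht where pr: "\<forall>p\<in>?X. \<pi> p \<in> ?A \<and> 0 \<le> ht p \<and> ht p \<le> len {a, b} \<and> (ht p = 0 \<or> \<pi> p = Vertex a)"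
    and d: "\<forall>p\<in>?X. \<forall>q\<in>?X. path_dist (insert b W) (insert {a, b} D) len p q =
       ?d (\<pi> p) (\<pi> q) + \<bar>ht p - ht q\<bar>"
    using path_dist_attach_leaf[of W D a b len] leaf.hyps leaf.prems by metis
  obtain B where B: "\<forall>p\<in>?A. \<forall>q\<in>?A. ?d p q \<le> B" using IH by blast
  have "?d (\<pi> p) (\<pi> q) + \<bar>ht p - ht q\<bar> \<le> B + len {a, b}" if "p \<in> ?X" "q \<in> ?X" for p q
  proof -
    have "?d (\<pi> p) (\<pi> q) \<le> B" using B pr that by blast
    moreover have "\<bar>ht p - ht q\<bar> \<le> len {a, b}"
      using bspec[OF pr that(1)] bspec[OF pr that(2)] by linarith
    ultimately show ?thesis by simp
  qed
  then have "\<forall>p\<in>?X. \<forall>q\<in>?X. path_dist (insert b W) (insert {a, b} D) len p q \<le> B + len {a, b}"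
    using d by simp
  moreover have "four_point ?X (path_dist (insert b W) (insert {a, b} D) len)"
    by (rule four_point_attach[OF IH(1) M a, of ?X \<pi> ht]) (use pr d in auto)
  ultimately show ?case by blast
qed

section \<open>Curves in the tree and a countable dense set\<close>

lemma (in Metric_space) lipschitz_glue:
  fixes F :: "real \<Rightarrow> 'a"
  assumes F: "\<And>s. s \<in> {a..c} \<Longrightarrow> F s \<in> M"
    and ab: "\<And>s s'. s \<in> {a..b} \<Longrightarrow> s' \<in> {a..b} \<Longrightarrow> d (F s) (F s') \<le> L * \<bar>s - s'\<bar>"
    and bc: "\<And>s s'. s \<in> {b..c} \<Longrightarrow> s' \<in> {b..c} \<Longrightarrow> d (F s) (F s') \<le> L * \<bar>s - s'\<bar>"
    and s: "s \<in> {a..c}" "s' \<in> {a..c}"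
  shows "d (F s) (F s') \<le> L * \<bar>s - s'\<bar>"
proof -
  have *: "d (F s) (F s') \<le> L * \<bar>s - s'\<bar>" if "s \<le> s'" "s \<in> {a..c}" "s' \<in> {a..c}" for s s'
  proof (cases "s' \<le> b \<or> b \<le> s")
    case True
    then show ?thesis using that ab[of s s'] bc[of s s'] by auto
  next
    case False
    then have "d (F s) (F s') \<le> d (F s) (F b) + d (F b) (F s')"
      using that by (intro triangle F) auto
    also have "\<dots> \<le> L * \<bar>s - b\<bar> + L * \<bar>b - s'\<bar>"
      using False that by (intro add_mono ab bc) auto
    also have "\<dots> = L * \<bar>s - s'\<bar>"
      using False that by (simp add: distrib_left[symmetric])
    finally show ?thesis .
  qed
  show ?thesis
  proof (cases "s \<le> s'")
    case False
    then show ?thesis using *[of s' s] s by (simp add: commute abs_minus_commute)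
  qed (use * s in auto)
qed

text \<open>Competitors for the AMLE are built from parametrised curves, so a path that only has a
  length is turned into a unit speed curve. The factor \<open>1 *\<close> matches the constant of
  \<open>lipschitz_glue\<close>.\<close>

lemma linear_path_curve:
  assumes M: "finite_graph V E" "connected_graph V E" "\<And>e. e \<in> E \<Longrightarrow> 0 < len e"
    and "linear_path V E len p r q"
  shows "\<exists>\<gamma>. \<gamma> 0 = p \<and> \<gamma> r = q \<and> (\<forall>s\<in>{0..r}. \<gamma> s \<in> complex_points V E len) \<and>
    (\<forall>s\<in>{0..r}. \<forall>s'\<in>{0..r}. path_dist V E len (\<gamma> s) (\<gamma> s') \<le> 1 * \<bar>s - s'\<bar>)"
  using assms(4)
proof (induction rule: linear_path.induct)
  interpret Metric_space "complex_points V E len" "path_dist V E len"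
    using M by (rule Metric_space_path_dist)
  {
    case (refl p)
    then show ?case by (intro exI[of _ "\<lambda>_. p"]) auto
  next
    case (step e s s' r q)
    obtain \<gamma> where \<gamma>: "\<gamma> 0 = edge_point len e s'" "\<gamma> r = q"
        "\<And>s. s \<in> {0..r} \<Longrightarrow> \<gamma> s \<in> complex_points V E len"
        "\<And>s s'. s \<in> {0..r} \<Longrightarrow> s' \<in> {0..r} \<Longrightarrow> path_dist V E len (\<gamma> s) (\<gamma> s') \<le> 1 * \<bar>s - s'\<bar>"
      using step.IH by blast
    define l where "l = \<bar>s - s'\<bar>"
    \<comment> \<open>The first segment is run through in its own direction until time
      \<open>l\<close>, then \<open>\<gamma>\<close> follows with delay \<open>l\<close>; both
      formulas agree at time \<open>l\<close>.\<close>
    define \<delta> where "\<delta> x = (if x \<le> l then edge_point len e (if s \<le> s' then s + x else s - x) else \<gamma> (x - l))" for x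
    have r: "0 \<le> r" using linear_path_in[OF step.hyps(4)] by simp
    have \<delta>l: "\<delta> x = \<gamma> (x - l)" if "l \<le> x" for x
      using that \<gamma>(1) by (cases "x = l") (auto simp: \<delta>_def l_def)
    have \<delta>_in: "\<delta> x \<in> complex_points V E len" if "x \<in> {0..l + r}" for x
      using that step.hyps \<gamma>(3)[of "x - l"]
      by (auto simp: \<delta>_def l_def split: if_splits intro!: edge_point_in)
    have "path_dist V E len (\<delta> x) (\<delta> y) \<le> 1 * \<bar>x - y\<bar>" if "x \<in> {0..l + r}" "y \<in> {0..l + r}" for x y
    proof (rule lipschitz_glue[OF _ _ _ that, of \<delta> l])
      fix x y assume *: "x \<in> {0..l}" "y \<in> {0..l}"
      let ?t = "\<lambda>x. if s \<le> s' then s + x else s - x"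
      have "path_dist V E len (edge_point len e (?t x)) (edge_point len e (?t y)) \<le> \<bar>?t x - ?t y\<bar>"
        using * step.hyps by (intro path_dist_edge_le) (auto simp: l_def split: if_splits)
      then show "path_dist V E len (\<delta> x) (\<delta> y) \<le> 1 * \<bar>x - y\<bar>"
        using * by (auto simp: \<delta>_def split: if_splits)
    next
      fix x y assume "x \<in> {l..l + r}" "y \<in> {l..l + r}"
      then show "path_dist V E len (\<delta> x) (\<delta> y) \<le> 1 * \<bar>x - y\<bar>"
        using \<gamma>(4)[of "x - l" "y - l"] by (simp add: \<delta>l)
    qed (rule \<delta>_in)
    moreover have "\<delta> 0 = edge_point len e s" by (simp add: \<delta>_def l_def)
    moreover have "\<delta> (l + r) = q" using \<delta>l[of "l + r"] r \<gamma>(2) by simp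
    ultimately show ?case
      using \<delta>_in unfolding l_def by (intro exI[of _ \<delta>]) blast
  }
qed

lemma metric_tree_four_point:
  assumes "metric_tree T"
  shows "four_point (mspace T) (mdist T)"
proof -
  obtain W D len where T: "finite_tree W D" "\<forall>e\<in>D. 0 < len e" "T = metric_graph W D len"
    using assms unfolding metric_tree_def by blast
  then have *: "finite_graph W D" "connected_graph W D" "\<And>e. e \<in> D \<Longrightarrow> 0 < len e"
    by (auto simp: finite_tree_def)
  show ?thesis
    using grown_tree_four_point_bounded[of W D len] finite_tree_grown[OF T(1)] *(3)
    by (simp add: T(3) mspace_metric_graph[OF *] mdist_metric_graph[OF *])
qed

lemma metric_tree_bounded:
  assumes "metric_tree T"
  shows "\<exists>B. \<forall>p\<in>mspace T. \<forall>q\<in>mspace T. mdist T p q \<le> B"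
proof -
  obtain W D len where T: "finite_tree W D" "\<forall>e\<in>D. 0 < len e" "T = metric_graph W D len"
    using assms unfolding metric_tree_def by blast
  then have *: "finite_graph W D" "connected_graph W D" "\<And>e. e \<in> D \<Longrightarrow> 0 < len e"
    by (auto simp: finite_tree_def)
  show ?thesis
    using grown_tree_four_point_bounded[of W D len] finite_tree_grown[OF T(1)] *(3)
    by (simp add: T(3) mspace_metric_graph[OF *] mdist_metric_graph[OF *])
qed

text \<open>The strict bound \<open>l\<close> replaces a geodesic: a path shorter than
  \<open>l\<close> exists by the definition of the infimum, whether or not the infimum is
  attained.\<close>

lemma metric_tree_curve:
  assumes "metric_tree T" "p \<in> mspace T" "q \<in> mspace T" "mdist T p q < l"
  shows "\<exists>\<gamma>. \<gamma> 0 = p \<and> \<gamma> 1 = q \<and> (\<forall>s\<in>{0..1}. \<gamma> s \<in> mspace T) \<and>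
    (\<forall>s\<in>{0..1}. \<forall>s'\<in>{0..1}. mdist T (\<gamma> s) (\<gamma> s') \<le> l * \<bar>s - s'\<bar>)"
proof -
  obtain W D len where T: "finite_tree W D" "\<forall>e\<in>D. 0 < len e" "T = metric_graph W D len"
    using assms unfolding metric_tree_def by blast
  then have *: "finite_graph W D" "connected_graph W D" "\<And>e. e \<in> D \<Longrightarrow> 0 < len e"
    by (auto simp: finite_tree_def)
  have T': "mspace T = complex_points W D len" "mdist T = path_dist W D len"
    by (simp_all add: T(3) mspace_metric_graph mdist_metric_graph *)
  have "\<exists>r<l. linear_path W D len p r q"
    using * assms(2-4) unfolding T' by (intro path_dist_less) auto
  then obtain r where r: "r < l" "linear_path W D len p r q" by blast
  have "0 \<le> r" using linear_path_in[OF r(2)] by simp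
  obtain \<gamma> where \<gamma>: "\<gamma> 0 = p" "\<gamma> r = q" "\<And>s. s \<in> {0..r} \<Longrightarrow> \<gamma> s \<in> mspace T"
      "\<And>s s'. s \<in> {0..r} \<Longrightarrow> s' \<in> {0..r} \<Longrightarrow> mdist T (\<gamma> s) (\<gamma> s') \<le> 1 * \<bar>s - s'\<bar>"
    using linear_path_curve[OF *(1,2) _ r(2)] *(3) unfolding T' by blast
  have in_r: "r * s \<in> {0..r}" if "s \<in> {0..1}" for s
    using that \<open>0 \<le> r\<close> by (auto intro: mult_left_le)
  have "mdist T (\<gamma> (r * s)) (\<gamma> (r * s')) \<le> l * \<bar>s - s'\<bar>" if "s \<in> {0..1}" "s' \<in> {0..1}" for s s'
  proof -
    have "mdist T (\<gamma> (r * s)) (\<gamma> (r * s')) \<le> 1 * \<bar>r * s - r * s'\<bar>"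
      using in_r that by (intro \<gamma>(4))
    also have "\<dots> = r * \<bar>s - s'\<bar>"
      using \<open>0 \<le> r\<close> by (simp add: right_diff_distrib[symmetric] abs_mult)
    also have "\<dots> \<le> l * \<bar>s - s'\<bar>" using r(1) by (intro mult_right_mono) auto
    finally show ?thesis .
  qed
  then show ?thesis
    using \<gamma>(1-3) in_r by (intro exI[of _ "\<lambda>s. \<gamma> (r * s)"]) auto
qed

text \<open>Separability makes \<open>mdist T\<close> measurable for the product of two Borel
  sigma-algebras, as carried out in \<open>measurable_dist\<close>.\<close>

lemma metric_tree_separable:
  assumes "metric_tree T"
  shows "\<exists>Z. countable Z \<and> Z \<subseteq> mspace T \<and> (\<forall>p\<in>mspace T. \<forall>\<epsilon>>0. \<exists>z\<in>Z. mdist T p z < \<epsilon>)"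
proof -
  obtain W D len where T: "finite_tree W D" "\<forall>e\<in>D. 0 < len e" "T = metric_graph W D len"
    using assms unfolding metric_tree_def by blast
  then have *: "finite_graph W D" "connected_graph W D" "\<And>e. e \<in> D \<Longrightarrow> 0 < len e"
    by (auto simp: finite_tree_def)
  have T': "mspace T = complex_points W D len" "mdist T = path_dist W D len"
    by (simp_all add: T(3) mspace_metric_graph mdist_metric_graph *)
  interpret Metric_space "complex_points W D len" "path_dist W D len"
    using * by (rule Metric_space_path_dist)
  have "finite W" using *(1) by (simp add: finite_graph_def)
  moreover have "D \<subseteq> Pow W" using *(1) finite_graph_edge_subset by blast
  ultimately have fin: "finite W" "finite D" by (auto intro: finite_subset)
  define Z where "Z = Vertex ` W \<union> (\<Union>e\<in>D. edge_point len e ` (\<rat> \<inter> {0..len e}))"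
  have "countable Z"
    unfolding Z_def using fin
    by (intro countable_Un countable_image countable_UN countable_Int1)
      (auto simp: countable_rat intro: countable_finite)
  moreover have "Z \<subseteq> mspace T"
    unfolding Z_def T' complex_points_def by blast
  moreover have "\<exists>z\<in>Z. mdist T p z < \<epsilon>" if p: "p \<in> mspace T" and "\<epsilon> > 0" for p \<epsilon>
  proof -
    consider v where "v \<in> W" "p = Vertex v"
      | e s where "e \<in> D" "s \<in> {0..len e}" "p = edge_point len e s"
      using p unfolding T' complex_points_def by blast
    then show ?thesis
    proof cases
      case 1
      then show ?thesis using p \<open>\<epsilon> > 0\<close> by (intro bexI[of _ p]) (auto simp: Z_def T')
    next
      case 2
      have "max 0 (s - \<epsilon>) < s \<or> s = 0" using 2 \<open>\<epsilon> > 0\<close> by auto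
      then obtain t where t: "t \<in> \<rat>" "t \<in> {0..s}" "s - t < \<epsilon>"
      proof
        assume "max 0 (s - \<epsilon>) < s"
        then obtain t where "t \<in> \<rat>" "max 0 (s - \<epsilon>) < t" "t < s" using Rats_dense_in_real by blast
        then show ?thesis by (intro that[of t]) auto
      next
        assume "s = 0"
        then show ?thesis using \<open>\<epsilon> > 0\<close> by (intro that[of 0]) auto
      qed
      have "path_dist W D len (edge_point len e s) (edge_point len e t) \<le> \<bar>s - t\<bar>"
        using 2 t by (intro path_dist_edge_le) auto
      moreover have "edge_point len e t \<in> Z"
        unfolding Z_def using 2 t by (intro UnI2 UN_I[of e] imageI) auto
      ultimately show ?thesis using 2 t by (intro bexI[of _ "edge_point len e t"]) (auto simp: T')
    qed
  qed
  ultimately show ?thesis by blast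
qed

section \<open>The local structure of an AMLE on a graph\<close>

locale tree_AMLE =
  fixes V :: "'v set" and E :: "'v set set" and Y :: "'v set"
    and T :: "'w cpoint metric" and f :: "'v \<Rightarrow> 'w cpoint" and g :: "'v cpoint \<Rightarrow> 'w cpoint"
  assumes finite_graph: "finite_graph V E" and connected_graph: "connected_graph V E"
    and boundary: "Y \<subseteq> V" "Y \<noteq> {}"
    and tree: "metric_tree T"
    and AMLE: "AMLE (metric_graph V E (\<lambda>_. 1)) T (Vertex ` Y) (f \<circ> the_vertex) g"
begin

abbreviation "X \<equiv> complex_points V E (\<lambda>_. 1)"
abbreviation "dG \<equiv> path_dist V E (\<lambda>_. 1)"
abbreviation "P \<equiv> edge_point (\<lambda>_. 1)"
abbreviation "d \<equiv> mdist T"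

definition "u v = g (Vertex v)"

sublocale G: Metric_space X dG
  using finite_graph connected_graph by (intro Metric_space_path_dist) auto

sublocale T: Metric_space "mspace T" d
  by (rule Metric_space_mspace_mdist)

lemma mspace_G [simp]: "mspace (metric_graph V E (\<lambda>_. 1)) = X"
  and mdist_G [simp]: "mdist (metric_graph V E (\<lambda>_. 1)) = dG"
  using finite_graph connected_graph by (simp_all add: mspace_metric_graph mdist_metric_graph)

lemma mtopology_G: "mtopology_of (metric_graph V E (\<lambda>_. 1)) = G.mtopology"
  by (simp add: mtopology_of_def)

lemma four_point:
  assumes "p \<in> mspace T" "q \<in> mspace T" "r \<in> mspace T" "s \<in> mspace T"
  shows "d p q + d r s \<le> max (d p r + d q s) (d p s + d q r)"
  using metric_tree_four_point[OF tree] assms unfolding four_point_def by blast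

lemma P_in: "e \<in> E \<Longrightarrow> s \<in> {0..1} \<Longrightarrow> P e s \<in> X"
  by (rule edge_point_in) auto

lemma Vertex_in: "v \<in> V \<Longrightarrow> Vertex v \<in> X"
  by (auto simp: complex_points_def)

lemma dG_P_le: "e \<in> E \<Longrightarrow> s \<in> {0..1} \<Longrightarrow> s' \<in> {0..1} \<Longrightarrow> dG (P e s) (P e s') \<le> \<bar>s - s'\<bar>"
  by (rule path_dist_edge_le) auto

lemma dG_ge:
  assumes "p \<in> X" "q \<in> X"
    and "\<And>e s s'. e \<in> E \<Longrightarrow> s \<in> {0..1} \<Longrightarrow> s' \<in> {0..1} \<Longrightarrow> \<phi> (P e s') - \<phi> (P e s) \<le> \<bar>s - s'\<bar>"
  shows "\<phi> q - \<phi> p \<le> dG p q"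
  using finite_graph connected_graph assms by (intro path_dist_ge) auto

lemma g_in: "z \<in> X \<Longrightarrow> g z \<in> mspace T"
  using AMLE by (auto simp: AMLE_def Lipschitz_continuous_map_def)

lemma u_in: "v \<in> V \<Longrightarrow> u v \<in> mspace T"
  by (simp add: u_def g_in Vertex_in)

lemma u_boundary: "y \<in> Y \<Longrightarrow> u y = f y"
  using AMLE by (simp add: AMLE_def u_def)

lemma g_Lipschitz: "\<exists>B>0. \<forall>p\<in>X. \<forall>q\<in>X. d (g p) (g q) \<le> B * dG p q"
  using AMLE by (auto simp: AMLE_def Lipschitz_continuous_map_pos)

section \<open>Competitors and open sets for testing the minimality\<close>

lemma Lipschitz_from_edges:
  assumes h: "\<And>z. z \<in> X \<Longrightarrow> h z \<in> mspace T" and "0 < C"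
    and seg: "\<And>e s s'. e \<in> E \<Longrightarrow> s \<in> {0..1} \<Longrightarrow> s' \<in> {0..1} \<Longrightarrow> d (h (P e s)) (h (P e s')) \<le> C * \<bar>s - s'\<bar>"
  shows "Lipschitz_continuous_map (metric_graph V E (\<lambda>_. 1)) T h"
proof -
  have path: "d (h p) (h q) \<le> C * r" if "linear_path V E (\<lambda>_. 1) p r q" for p q r
    using that
  proof (induction rule: linear_path.induct)
    case (refl p)
    then show ?case using h by simp
  next
    case (step e s s' r q)
    have "q \<in> X" using linear_path_in[OF step.hyps(4)] by simp
    then have "d (h (P e s)) (h q) \<le> d (h (P e s)) (h (P e s')) + d (h (P e s')) (h q)"
      using step.hyps by (intro T.triangle h P_in) auto
    also have "\<dots> \<le> C * \<bar>s - s'\<bar> + C * r"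
      using step seg[of e s s'] by simp
    finally show ?case by (simp add: distrib_left)
  qed
  have "d (h p) (h q) \<le> C * dG p q" if pq: "p \<in> X" "q \<in> X" for p q
  proof -
    have "d (h p) (h q) / C \<le> dG p q"
    proof (rule dense_ge)
      fix l assume "dG p q < l"
      then have "\<exists>r<l. linear_path V E (\<lambda>_. 1) p r q"
        using finite_graph connected_graph pq by (intro path_dist_less) auto
      then obtain r where r: "r < l" "d (h p) (h q) \<le> C * r" using path by blast
      then have "d (h p) (h q) \<le> C * l" using \<open>0 < C\<close> by (smt (verit) mult_left_mono)
      then show "d (h p) (h q) / C \<le> l" using \<open>0 < C\<close> by (simp add: field_simps)
    qed
    then show ?thesis using \<open>0 < C\<close> by (simp add: field_simps)
  qed
  then show ?thesis
    using h by (auto simp: Lipschitz_continuous_map_def)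
qed

text \<open>The test sets, an open edge and the open star of radius 1/4 at a vertex, are described
  as positivity sets of functions with speed at most one along edges.\<close>

lemma open_positive:
  assumes "\<And>e s s'. e \<in> E \<Longrightarrow> s \<in> {0..1} \<Longrightarrow> s' \<in> {0..1} \<Longrightarrow> \<phi> (P e s') - \<phi> (P e s) \<le> \<bar>s - s'\<bar>"
  shows "openin (mtopology_of (metric_graph V E (\<lambda>_. 1))) {z \<in> X. 0 < \<phi> z}"
  unfolding mtopology_G G.openin_mtopology
proof (intro conjI allI impI)
  fix z assume z: "z \<in> {z \<in> X. 0 < \<phi> z}"
  have "0 < \<phi> w" if "w \<in> X" "dG z w < \<phi> z" for w
    using dG_ge[of w z \<phi>, OF _ _ assms] that z G.commute[of z w] by auto
  then show "\<exists>r>0. G.mball z r \<subseteq> {z \<in> X. 0 < \<phi> z}"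
    using z by (intro exI[of _ "\<phi> z"]) auto
qed auto

text \<open>This is the minimality in usable form, with real inequalities in place of suprema in
  \<open>ennreal\<close>. Only pairs inside \<open>U\<close> are compared, so the bounds it yields
  hold on open sets first.\<close>

lemma AMLE_bound:
  assumes U: "openin (mtopology_of (metric_graph V E (\<lambda>_. 1))) U" "U \<subseteq> X - Vertex ` Y"
    and h: "Lipschitz_continuous_map (metric_graph V E (\<lambda>_. 1)) T h" "\<And>z. z \<in> X - U \<Longrightarrow> h z = g z"
    and L: "0 \<le> L" "\<And>p q. p \<in> U \<Longrightarrow> q \<in> U \<Longrightarrow> d (h p) (h q) \<le> L * dG p q"
    and pq: "p \<in> U" "q \<in> U"
  shows "d (g p) (g q) \<le> L * dG p q"
proof (cases "p = q")
  case True
  then show ?thesis using pq U g_in by auto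
next
  case False
  have pos: "0 < dG p q" if "p \<in> U" "q \<in> U" "p \<noteq> q" for p q
    using that U by (auto intro: G.mdist_pos_less)
  let ?S = "{(x, y). x \<in> U \<and> y \<in> U \<and> x \<noteq> y}"
  have "ennreal (d (g p) (g q) / dG p q) \<le> Lip (metric_graph V E (\<lambda>_. 1)) T U g"
    unfolding Lip_def using pq False
    by (intro SUP_upper2[of "(p, q)"]) auto
  also have "\<dots> \<le> Lip (metric_graph V E (\<lambda>_. 1)) T U h"
    using AMLE U h unfolding AMLE_def by simp
  also have "\<dots> \<le> ennreal L"
    unfolding Lip_def
  proof (rule SUP_least, clarify)
    fix a b assume ab: "a \<in> U" "b \<in> U" "a \<noteq> b"
    then show "ennreal (d (h a) (h b) / mdist (metric_graph V E (\<lambda>_. 1)) a b) \<le> ennreal L"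
      using L(2)[of a b] pos[of a b] by (intro ennreal_leI) (simp add: field_simps)
  qed
  finally show ?thesis
    using L(1) pos[OF pq False] by (simp add: ennreal_le_iff field_simps)
qed

section \<open>The AMLE on a single edge\<close>

lemma edge_replace:
  assumes e: "e \<in> E" and \<gamma>0: "\<gamma> 0 = g (P e 0)" and \<gamma>1: "\<gamma> 1 = g (P e 1)"
    and \<gamma>: "\<And>s. s \<in> {0..1} \<Longrightarrow> \<gamma> s \<in> mspace T"
    and C: "\<And>s s'. s \<in> {0..1} \<Longrightarrow> s' \<in> {0..1} \<Longrightarrow> d (\<gamma> s) (\<gamma> s') \<le> C * \<bar>s - s'\<bar>"
    and L: "0 \<le> L" "\<And>s s'. s \<in> {0<..<1} \<Longrightarrow> s' \<in> {0<..<1} \<Longrightarrow> d (\<gamma> s) (\<gamma> s') \<le> L * dG (P e s) (P e s')"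
    and s: "s \<in> {0<..<1}" "s' \<in> {0<..<1}"
  shows "d (g (P e s)) (g (P e s')) \<le> L * \<bar>s - s'\<bar>"
proof -
  \<comment> \<open>The competitor follows \<open>\<gamma>\<close> on \<open>e\<close> and equals
    \<open>g\<close> elsewhere. Two constants are kept apart: \<open>C\<close> only serves to make
    \<open>h\<close> Lipschitz, while \<open>L\<close> bounds it in terms of \<open>dG\<close>,
    which on a self loop can be shorter than arc length.\<close>
  define h where "h z = (case z of Vertex _ \<Rightarrow> g z | Interior e' t \<Rightarrow> if e' = e then \<gamma> t else g z)" for z
  have hP: "h (P e' t) = (if e' = e then \<gamma> t else g (P e' t))" for e' t
    using \<gamma>0 \<gamma>1 by (auto simp: h_def edge_point_def)
  \<comment> \<open>This is the arc length to the nearer end on \<open>e\<close> and 0 elsewhere, so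
    it is positive exactly on the open edge.\<close>
  define \<phi> where "\<phi> z = (case z of Vertex _ \<Rightarrow> 0 | Interior e' t \<Rightarrow> if e' = e then min t (1 - t) else 0)"
    for z :: "'v cpoint"
  have \<phi>P: "\<phi> (P e' t) = (if e' = e then min t (1 - t) else 0)" for e' t
    by (auto simp: \<phi>_def edge_point_def)
  let ?U = "{z \<in> X. 0 < \<phi> z}"
  have U: "?U = P e ` {0<..<1}"
  proof (intro set_eqI iffI)
    fix z assume "z \<in> ?U"
    then show "z \<in> P e ` {0<..<1}"
      by (auto simp: \<phi>_def edge_point_def image_iff split: cpoint.splits if_splits)
  next
    fix z assume "z \<in> P e ` {0<..<1}"
    then show "z \<in> ?U" using P_in[OF e] \<phi>P[of e] by auto
  qed
  obtain B where B: "0 < B" "\<And>p q. p \<in> X \<Longrightarrow> q \<in> X \<Longrightarrow> d (g p) (g q) \<le> B * dG p q"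
    using g_Lipschitz by blast
  have Xz: "z \<in> Vertex ` V \<or> (\<exists>e'\<in>E. \<exists>t\<in>{0..1}. z = P e' t)" if "z \<in> X" for z
    using that unfolding complex_points_def by blast
  have h_in: "h z \<in> mspace T" if "z \<in> X" for z
    using Xz[OF that]
  proof
    assume "z \<in> Vertex ` V"
    then show ?thesis using that g_in by (auto simp: h_def)
  next
    assume "\<exists>e'\<in>E. \<exists>t\<in>{0..1}. z = P e' t"
    then show ?thesis using hP \<gamma> g_in[OF that] by auto
  qed
  have "0 < max B C" using B by simp
  have hL: "Lipschitz_continuous_map (metric_graph V E (\<lambda>_. 1)) T h"
  proof (rule Lipschitz_from_edges[OF h_in \<open>0 < max B C\<close>])
    fix e' t t' assume t: "e' \<in> E" "t \<in> {0..1::real}" "t' \<in> {0..1::real}"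
    show "d (h (P e' t)) (h (P e' t')) \<le> max B C * \<bar>t - t'\<bar>"
    proof (cases "e' = e")
      case True
      then have "d (h (P e' t)) (h (P e' t')) \<le> C * \<bar>t - t'\<bar>"
        using C[of t t'] t by (simp add: hP)
      also have "\<dots> \<le> max B C * \<bar>t - t'\<bar>" by (intro mult_right_mono) auto
      finally show ?thesis .
    next
      case False
      then have "d (h (P e' t)) (h (P e' t')) \<le> B * dG (P e' t) (P e' t')"
        using B(2)[of "P e' t" "P e' t'"] t P_in by (simp add: hP)
      also have "\<dots> \<le> max B C * \<bar>t - t'\<bar>"
        using dG_P_le[OF t] B(1) by (intro mult_mono) auto
      finally show ?thesis .
    qed
  qed
  have "d (g (P e s)) (g (P e s')) \<le> L * dG (P e s) (P e s')"
  proof (rule AMLE_bound[of ?U h])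
    show "openin (mtopology_of (metric_graph V E (\<lambda>_. 1))) ?U"
      by (rule open_positive) (auto simp: \<phi>P)
    show "?U \<subseteq> X - Vertex ` Y" by (auto simp: \<phi>_def)
    show "h z = g z" if "z \<in> X - ?U" for z
    proof (cases z)
      case (Interior e' t)
      have "t \<in> {0<..<1}"
        using that Interior by (auto simp: complex_points_def edge_point_def split: if_splits)
      then show ?thesis using that Interior by (auto simp: h_def \<phi>_def)
    qed (simp add: h_def)
    show "d (h p) (h q) \<le> L * dG p q" if "p \<in> ?U" "q \<in> ?U" for p q
      using that L(2) unfolding U by (auto simp: hP)
    show "P e s \<in> ?U" "P e s' \<in> ?U" unfolding U using s by auto
  qed (use hL L in auto)
  also have "\<dots> \<le> L * \<bar>s - s'\<bar>"
    using dG_P_le[OF e, of s s'] s L(1) by (intro mult_left_mono) auto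
  finally show ?thesis .
qed

text \<open>The indicator of the head, extended linearly over every edge, has speed at most one and
  equals arc length on \<open>e\<close>. On a self loop the claim fails, since there may be a
  shorter way around.\<close>

lemma edge_distance_ge:
  assumes e: "e \<in> E" "edge_tail e \<noteq> edge_head e" and s: "s \<in> {0..1}" "s' \<in> {0..1}"
  shows "\<bar>s - s'\<bar> \<le> dG (P e s) (P e s')"
proof -
  define v :: "'v \<Rightarrow> real" where "v w = (if w = edge_head e then 1 else 0)" for w
  define \<phi> where "\<phi> z = (case z of Vertex w \<Rightarrow> v w
    | Interior e' t \<Rightarrow> v (edge_tail e') + t * (v (edge_head e') - v (edge_tail e')))" for z
  have \<phi>P: "\<phi> (P e' t) = v (edge_tail e') + t * (v (edge_head e') - v (edge_tail e'))" for e' t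
    by (auto simp: \<phi>_def edge_point_def)
  have 1: "\<phi> (P e' t') - \<phi> (P e' t) \<le> \<bar>t - t'\<bar>" for e' t t'
    by (auto simp: \<phi>P v_def)
  have "\<phi> (P e s) = s" "\<phi> (P e s') = s'" using e by (auto simp: \<phi>P v_def)
  moreover have "\<phi> (P e s') - \<phi> (P e s) \<le> dG (P e s) (P e s')"
    "\<phi> (P e s) - \<phi> (P e s') \<le> dG (P e s') (P e s)"
    using e s 1 by (intro dG_ge P_in; simp)+
  ultimately show ?thesis by (simp add: G.commute abs_le_iff)
qed

text \<open>A self loop admits a constant competitor, so \<open>g\<close> is constant on its
  interior. On any other edge the competitors are curves with Lipschitz constant \<open>l\<close>
  above the distance of the end values, and \<open>l\<close> tends to that distance.\<close>

lemma edge_Lipschitz_open: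
  assumes e: "e \<in> E" and s: "s \<in> {0<..<1}" "s' \<in> {0<..<1}"
  shows "d (g (P e s)) (g (P e s')) \<le> d (g (P e 0)) (g (P e 1)) * \<bar>s - s'\<bar>"
proof -
  let ?K = "d (g (P e 0)) (g (P e 1))"
  have in_T: "g (P e 0) \<in> mspace T" "g (P e 1) \<in> mspace T"
    using e by (auto intro!: g_in P_in)
  show ?thesis
  proof (cases "edge_tail e = edge_head e")
    case True
    then have *: "P e 0 = P e 1" by (simp add: edge_point_def)
    have "d (g (P e s)) (g (P e s')) \<le> 0 * \<bar>s - s'\<bar>"
      by (rule edge_replace[OF e, of "\<lambda>_. g (P e 0)" 0]) (use s in_T * in auto)
    then show ?thesis by (simp add: mult_nonneg_nonneg order_trans)
  next
    case False
    show ?thesis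
    proof (cases "s = s'")
      case False
      then have pos: "0 < \<bar>s - s'\<bar>" by simp
      have "d (g (P e s)) (g (P e s')) / \<bar>s - s'\<bar> \<le> ?K"
      proof (rule dense_ge)
        fix l assume l: "?K < l"
        then obtain \<gamma> where \<gamma>: "\<gamma> 0 = g (P e 0)" "\<gamma> 1 = g (P e 1)"
          "\<And>s. s \<in> {0..1} \<Longrightarrow> \<gamma> s \<in> mspace T"
          "\<And>s s'. s \<in> {0..1} \<Longrightarrow> s' \<in> {0..1} \<Longrightarrow> d (\<gamma> s) (\<gamma> s') \<le> l * \<bar>s - s'\<bar>"
          using metric_tree_curve[OF tree in_T l] by blast
        have "0 \<le> l" using l T.nonneg by (meson less_eq_real_def order_trans)
        have "d (g (P e s)) (g (P e s')) \<le> l * \<bar>s - s'\<bar>"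
        proof (rule edge_replace[OF e \<gamma>(1,2,3,4) \<open>0 \<le> l\<close> _ s])
          fix t t' :: real assume t: "t \<in> {0<..<1}" "t' \<in> {0<..<1}"
          have "d (\<gamma> t) (\<gamma> t') \<le> l * \<bar>t - t'\<bar>" using t by (intro \<gamma>(4)) auto
          also have "\<dots> \<le> l * dG (P e t) (P e t')"
            using t \<open>0 \<le> l\<close> \<open>edge_tail e \<noteq> edge_head e\<close> e by (intro mult_left_mono edge_distance_ge) auto
          finally show "d (\<gamma> t) (\<gamma> t') \<le> l * dG (P e t) (P e t')" .
        qed
        then show "d (g (P e s)) (g (P e s')) / \<bar>s - s'\<bar> \<le> l"
          using pos by (simp add: field_simps)
      qed
      then show ?thesis using pos by (simp add: field_simps)
    qed (use T.mdist_zero[OF g_in[OF P_in[OF e, of s']]] s in auto)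
  qed
qed

lemma edge_Lipschitz:
  assumes e: "e \<in> E" and s: "s \<in> {0..1}" "s' \<in> {0..1}"
  shows "d (g (P e s)) (g (P e s')) \<le> d (g (P e 0)) (g (P e 1)) * \<bar>s - s'\<bar>"
proof (rule field_le_epsilon)
  let ?K = "d (g (P e 0)) (g (P e 1))"
  fix \<epsilon> :: real assume "0 < \<epsilon>"
  obtain B where B: "0 < B" "\<And>p q. p \<in> X \<Longrightarrow> q \<in> X \<Longrightarrow> d (g p) (g q) \<le> B * dG p q"
    using g_Lipschitz by blast
  \<comment> \<open>Contracting the parameters towards the midpoint by the factor
    \<open>1 - c\<close> puts them into the open edge; by the bound \<open>B\<close> this moves each
    value of \<open>g\<close> by at most \<open>\<epsilon> / 2\<close>.\<close>
  define c where "c = min (1/2) (\<epsilon> / (2 * B))"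
  have c: "0 < c" "c < 1" "c * B \<le> \<epsilon> / 2"
  proof -
    show "0 < c" "c < 1" using B(1) \<open>0 < \<epsilon>\<close> by (auto simp: c_def)
    have "c * B \<le> \<epsilon> / (2 * B) * B" using B(1) by (intro mult_right_mono) (auto simp: c_def)
    then show "c * B \<le> \<epsilon> / 2" using B(1) by simp
  qed
  define r where "r t = (1 - c) * t + c * (1 / 2)" for t :: real
  have r: "r t \<in> {0<..<1}" if "t \<in> {0..1}" for t
  proof -
    define k where "k = (1 - c) * t"
    have "0 \<le> k" "k \<le> 1 - c"
      unfolding k_def using that c by (auto intro: mult_left_le)
    then show ?thesis using c by (simp add: r_def k_def[symmetric])
  qed
  have near: "d (g (P e t)) (g (P e (r t))) \<le> \<epsilon> / 2" if "t \<in> {0..1}" for t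
  proof -
    have "d (g (P e t)) (g (P e (r t))) \<le> B * dG (P e t) (P e (r t))"
      using that r[OF that] e by (intro B P_in) auto
    also have "\<dots> \<le> B * \<bar>t - r t\<bar>"
      using that r[OF that] e B by (intro mult_left_mono dG_P_le) auto
    also have "t - r t = c * (t - 1 / 2)"
      by (simp add: r_def algebra_simps)
    also have "\<bar>\<dots>\<bar> = c * \<bar>t - 1 / 2\<bar>"
      using c by (simp add: abs_mult)
    also have "B * (c * \<bar>t - 1 / 2\<bar>) \<le> B * (c * 1)"
      using that c B by (intro mult_left_mono) auto
    finally show ?thesis using c by (simp add: mult.commute)
  qed
  have in_T: "g (P e t) \<in> mspace T" if "t \<in> {0..1}" for t
    using that e by (intro g_in P_in)
  note rs = r[OF s(1)] r[OF s(2)]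
  have "d (g (P e s)) (g (P e s')) \<le> d (g (P e s)) (g (P e (r s))) + d (g (P e (r s))) (g (P e s'))"
    using s rs by (intro T.triangle in_T) auto
  also have "d (g (P e (r s))) (g (P e s')) \<le> d (g (P e (r s))) (g (P e (r s'))) + d (g (P e (r s'))) (g (P e s'))"
    using s rs by (intro T.triangle in_T) auto
  also have "d (g (P e (r s))) (g (P e (r s'))) \<le> ?K * \<bar>r s - r s'\<bar>"
    using e rs by (rule edge_Lipschitz_open)
  also have "\<bar>r s - r s'\<bar> = (1 - c) * \<bar>s - s'\<bar>"
    using c by (simp add: r_def abs_mult right_diff_distrib[symmetric])
  also have "?K * ((1 - c) * \<bar>s - s'\<bar>) \<le> ?K * (1 * \<bar>s - s'\<bar>)"
    using c by (intro mult_left_mono mult_right_mono) auto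
  finally show "d (g (P e s)) (g (P e s')) \<le> ?K * \<bar>s - s'\<bar> + \<epsilon>"
    using near[OF s(1)] near[OF s(2)] T.commute[of "g (P e (r s'))"] by simp
qed

text \<open>The end values have distance \<open>?K\<close>, and each of the three pieces cut by
  \<open>s\<close> and \<open>s'\<close> has its end values at distance at most \<open>?K\<close>
  times its length. The lengths add up to 1, so by the triangle inequality no piece can fall
  short.\<close>

lemma edge_geodesic:
  assumes e: "e \<in> E" and s: "s \<in> {0..1}" "s' \<in> {0..1}"
  shows "d (g (P e s)) (g (P e s')) = d (g (P e 0)) (g (P e 1)) * \<bar>s - s'\<bar>"
proof -
  let ?K = "d (g (P e 0)) (g (P e 1))"
  have *: "d (g (P e s)) (g (P e s')) = ?K * \<bar>s - s'\<bar>" if "s \<le> s'" "s \<in> {0..1}" "s' \<in> {0..1}" for s s'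
  proof -
    have in_T: "g (P e t) \<in> mspace T" if "t \<in> {0..1}" for t
      using that e by (intro g_in P_in)
    have "?K \<le> d (g (P e 0)) (g (P e s)) + d (g (P e s)) (g (P e 1))"
      using that by (intro T.triangle in_T) auto
    moreover have "d (g (P e s)) (g (P e 1)) \<le> d (g (P e s)) (g (P e s')) + d (g (P e s')) (g (P e 1))"
      using that by (intro T.triangle in_T) auto
    moreover have "d (g (P e 0)) (g (P e s)) \<le> ?K * \<bar>0 - s\<bar>" "d (g (P e s')) (g (P e 1)) \<le> ?K * \<bar>s' - 1\<bar>"
        "d (g (P e s)) (g (P e s')) \<le> ?K * \<bar>s - s'\<bar>"
      using that e by (intro edge_Lipschitz; simp)+
    ultimately show ?thesis
      using that by (simp add: algebra_simps)
  qed
  show ?thesis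
  proof (cases "s \<le> s'")
    case False
    then show ?thesis using *[of s' s] s by (simp add: T.commute abs_minus_commute)
  qed (rule *[OF _ s])
qed

section \<open>The star of a vertex\<close>

text \<open>
  A pair \<open>(e, b)\<close> stands for the half of the edge \<open>e\<close> at its tail or head; \<open>half i s\<close> is the point at
  arc length \<open>s\<close> from that end.
\<close>

definition halves :: "'v \<Rightarrow> ('v set \<times> bool) set" where
  "halves x = {(e, b). e \<in> E \<and> (if b then edge_tail e else edge_head e) = x}"

definition other_end :: "'v set \<times> bool \<Rightarrow> 'v" where
  "other_end i = (if snd i then edge_head (fst i) else edge_tail (fst i))"

definition half :: "'v set \<times> bool \<Rightarrow> real \<Rightarrow> 'v cpoint" where
  "half i s = P (fst i) (if snd i then s else 1 - s)"

lemma finite_halves: "finite (halves x)"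
proof -
  have "E \<subseteq> Pow V" using finite_graph finite_graph_edge_subset by blast
  then have "finite E" using finite_graph by (auto simp: finite_graph_def intro: finite_subset)
  then show ?thesis
    by (intro finite_subset[of "halves x" "E \<times> UNIV"]) (auto simp: halves_def)
qed

lemma half_0: "i \<in> halves x \<Longrightarrow> half i 0 = Vertex x"
  and half_1: "half i 1 = Vertex (other_end i)"
  by (auto simp: halves_def half_def other_end_def edge_point_def split: if_splits)

lemma half_in: "i \<in> halves x \<Longrightarrow> s \<in> {0..1} \<Longrightarrow> half i s \<in> X"
  by (auto simp: halves_def half_def intro!: P_in)

lemma half_geodesic:
  assumes "i \<in> halves x" "s \<in> {0..1}" "s' \<in> {0..1}"
  shows "d (g (half i s)) (g (half i s')) = d (u x) (u (other_end i)) * \<bar>s - s'\<bar>"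
proof -
  have *: "g (P (fst i) 0) = u (edge_tail (fst i))" "g (P (fst i) 1) = u (edge_head (fst i))"
    by (auto simp: edge_point_def u_def)
  have "fst i \<in> E" using assms by (auto simp: halves_def)
  then show ?thesis
    using assms edge_geodesic[of "fst i" s s'] edge_geodesic[of "fst i" "1 - s" "1 - s'"] *
    by (auto simp: half_def other_end_def halves_def T.commute abs_minus_commute split: if_splits)
qed

lemma neighbour_iff_half:
  assumes "x \<in> V"
  shows "{x, w} \<in> E \<longleftrightarrow> (\<exists>i\<in>halves x. other_end i = w)"
proof
  assume e: "{x, w} \<in> E"
  have "{x, w} = {edge_tail {x, w}, edge_head {x, w}}"
    using edge_tail_head(1)[OF finite_graph e] .
  then have "edge_tail {x, w} = x \<and> edge_head {x, w} = w \<or> edge_tail {x, w} = w \<and> edge_head {x, w} = x"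
    by (auto simp: doubleton_eq_iff)
  then show "\<exists>i\<in>halves x. other_end i = w"
  proof
    assume "edge_tail {x, w} = x \<and> edge_head {x, w} = w"
    then show ?thesis using e by (intro bexI[of _ "({x, w}, True)"]) (auto simp: halves_def other_end_def)
  next
    assume "edge_tail {x, w} = w \<and> edge_head {x, w} = x"
    then show ?thesis using e by (intro bexI[of _ "({x, w}, False)"]) (auto simp: halves_def other_end_def)
  qed
next
  assume "\<exists>i\<in>halves x. other_end i = w"
  then show "{x, w} \<in> E"
    using edge_tail_head(1)[OF finite_graph]
    by (fastforce simp: halves_def other_end_def insert_commute split: if_splits)
qed

text \<open>The slope is 1 on the first quarter and the function vanishes beyond 1/2, so the tents
  at the two ends of one edge have disjoint supports.\<close>

definition tent :: "real \<Rightarrow> real" where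
  "tent s = max 0 (min s (1 / 2 - s))"

definition half_tent :: "'v set \<times> bool \<Rightarrow> 'v cpoint \<Rightarrow> real" where
  "half_tent i z = (case z of Vertex _ \<Rightarrow> 0
     | Interior e s \<Rightarrow> if e = fst i then tent (if snd i then s else 1 - s) else 0)"

text \<open>This serves the two halves of one edge, which both start at \<open>x\<close> when the
  edge is a self loop: the difference of their tents still has speed at most one.\<close>

lemma tent_diff:
  assumes "t \<in> {0..1}" "t' \<in> {0..1}"
  shows "\<bar>(tent t' - tent (1 - t')) - (tent t - tent (1 - t))\<bar> \<le> \<bar>t - t'\<bar>"
proof -
  define w where "w t = (if t \<le> 1/2 then min t (1/2 - t) else - min (1 - t) (t - 1/2))" for t :: real
  have w: "tent t - tent (1 - t) = w t" if "t \<in> {0..1}" for t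
    using that by (auto simp: tent_def w_def max_def min_def)
  have "\<bar>w t' - w t\<bar> \<le> \<bar>t - t'\<bar>"
    using assms unfolding w_def by (auto simp: min_def)
  then show ?thesis using w assms by simp
qed

lemma half_tent_P: "half_tent i (P e s) = (if e = fst i then tent (if snd i then s else 1 - s) else 0)"
  by (auto simp: half_tent_def edge_point_def tent_def)

lemma half_tent_half:
  assumes "s \<in> {0..1/4}"
  shows "half_tent i (half j s) = (if i = j then s else 0)"
  using assms by (cases i; cases j) (auto simp: half_def half_tent_P tent_def)

text \<open>Up to radius 1/4 the star of \<open>x\<close> is a bouquet of intervals, as the tents
  show. On a self loop, points at distance \<open>s\<close> and \<open>s'\<close> from the two ends
  are also joined by an arc of length \<open>1 - s - s'\<close>, which is not shorter because
  \<open>s + s' \<le> 1/2\<close>.\<close>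

lemma dG_half_ge:
  assumes i: "i \<in> halves x" "j \<in> halves x" and s: "s \<in> {0..1/4}" "s' \<in> {0..1/4}"
  shows "(if i = j then \<bar>s - s'\<bar> else s + s') \<le> dG (half i s) (half j s')"
proof -
  have in_X: "half i s \<in> X" "half j s' \<in> X"
    using i s by (auto intro!: half_in)
  have 1: "half_tent i (P e t') - half_tent i (P e t) \<le> \<bar>t - t'\<bar>" for i e t t'
    by (auto simp: half_tent_P tent_def)
  have 2: "(half_tent j (P e t') - half_tent i (P e t')) - (half_tent j (P e t) - half_tent i (P e t)) \<le> \<bar>t - t'\<bar>"
    if "i \<noteq> j" "t \<in> {0..1}" "t' \<in> {0..1}" for i j e t t'
  proof (cases "fst i = fst j")
    case True
    then have "snd i = (\<not> snd j)" using that(1) by (auto simp: prod_eq_iff)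
    then show ?thesis
      using True tent_diff[OF that(2,3)] by (auto simp: half_tent_P)
  next
    case False
    have "half_tent j (P e s) = 0 \<or> half_tent i (P e s) = 0" for s
      using False by (auto simp: half_tent_P)
    then show ?thesis
      using False 1[of j e t' t] 1[of i e t t'] by (auto simp: half_tent_P)
  qed
  show ?thesis
  proof (cases "i = j")
    case True
    then show ?thesis
      using dG_ge[OF in_X, of "half_tent i"] dG_ge[OF in_X(2,1), of "half_tent i"] 1
        half_tent_half[of _ i] s
      by (auto simp: G.commute abs_le_iff)
  next
    case False
    then show ?thesis
      using dG_ge[OF in_X, of "\<lambda>z. half_tent j z - half_tent i z"] 2 half_tent_half s by auto
  qed
qed

text \<open>The competitor moves the value at \<open>x\<close> to \<open>p0\<close> and joins it to
  the unchanged values at radius 1/4. If it has Lipschitz constant \<open>L\<close> on the star,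
  then so has \<open>g\<close>; since \<open>g\<close> has constant speed along a half edge, the
  bound near \<open>x\<close> reaches the other end. The factor \<open>L / 4\<close> reflects that a
  quarter of an edge is run through in unit time.\<close>

lemma AMLE_star:
  assumes x: "x \<in> V - Y" and \<gamma>0: "\<And>i. i \<in> halves x \<Longrightarrow> \<gamma> i 0 = p0"
    and \<gamma>1: "\<And>i. i \<in> halves x \<Longrightarrow> \<gamma> i 1 = g (half i (1/4))"
    and \<gamma>: "\<And>i s. i \<in> halves x \<Longrightarrow> s \<in> {0..1} \<Longrightarrow> \<gamma> i s \<in> mspace T"
    and L: "\<And>i s s'. i \<in> halves x \<Longrightarrow> s \<in> {0..1} \<Longrightarrow> s' \<in> {0..1} \<Longrightarrow>
      d (\<gamma> i s) (\<gamma> i s') \<le> L / 4 * \<bar>s - s'\<bar>"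
    and "0 \<le> L" and i: "i \<in> halves x"
  shows "d (u x) (u (other_end i)) \<le> L"
proof -
  define h where "h z = (case z of Vertex v \<Rightarrow> if v = x then p0 else g z
    | Interior e s \<Rightarrow> if edge_tail e = x \<and> s < 1/4 then \<gamma> (e, True) (4 * s)
        else if edge_head e = x \<and> 1 - s < 1/4 then \<gamma> (e, False) (4 * (1 - s)) else g z)" for z
  have hP: "h (P e s) = (if edge_tail e = x \<and> s < 1/4 then \<gamma> (e, True) (4 * s)
        else if edge_head e = x \<and> 1 - s < 1/4 then \<gamma> (e, False) (4 * (1 - s)) else g (P e s))"
    if "e \<in> E" for e s
    using that \<gamma>0 by (auto simp: h_def edge_point_def halves_def)
  have h_half: "h (half j s) = \<gamma> j (4 * s)" if "j \<in> halves x" "s \<in> {0..1/4}" for j s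
  proof (cases "s < 1/4")
    case True
    then show ?thesis using that by (cases j) (auto simp: half_def hP halves_def split: if_splits)
  next
    case False
    then have "s = 1/4" using that by simp
    then show ?thesis
      using that(1) \<gamma>1[OF that(1)] unfolding \<open>s = 1/4\<close>
      by (cases j) (auto simp: half_def hP halves_def split: if_splits)
  qed
  \<comment> \<open>This is the positive part of 1/4 minus the distance to \<open>x\<close>, so it
    cuts out the open star.\<close>
  define \<phi> where "\<phi> z = (case z of Vertex v \<Rightarrow> if v = x then 1/4 else 0
    | Interior e s \<Rightarrow> max (if edge_tail e = x then 1/4 - s else 0)
        (max 0 (if edge_head e = x then 1/4 - (1 - s) else 0)))" for z
  have \<phi>P: "\<phi> (P e s) = max (if edge_tail e = x then 1/4 - s else 0)
        (max 0 (if edge_head e = x then 1/4 - (1 - s) else 0))" if "s \<in> {0..1}" for e s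
    using that by (auto simp: \<phi>_def edge_point_def)
  let ?U = "{z \<in> X. 0 < \<phi> z}"
  have Xz: "z \<in> Vertex ` V \<or> (\<exists>e\<in>E. \<exists>t\<in>{0..1}. z = P e t)" if "z \<in> X" for z
    using that unfolding complex_points_def by blast
  have UE: "\<exists>j\<in>halves x. \<exists>s\<in>{0..1/4}. z = half j s" if "z \<in> ?U" for z
  proof -
    have "z \<in> X" "0 < \<phi> z" using that by auto
    from Xz[OF this(1)] show ?thesis
    proof
      assume "z \<in> Vertex ` V"
      then have "z = Vertex x" using \<open>0 < \<phi> z\<close> by (auto simp: \<phi>_def split: if_splits)
      then show ?thesis using half_0[OF i] i by (intro bexI[of _ i] bexI[of _ 0]) auto
    next
      assume "\<exists>e\<in>E. \<exists>t\<in>{0..1}. z = P e t"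
      then obtain e t where et: "e \<in> E" "t \<in> {0..1}" "z = P e t" by blast
      have "edge_tail e = x \<and> t \<in> {0..1/4} \<or> edge_head e = x \<and> 1 - t \<in> {0..1/4}"
        using \<open>0 < \<phi> z\<close> et by (auto simp: \<phi>P split: if_splits)
      then show ?thesis
      proof
        assume "edge_tail e = x \<and> t \<in> {0..1/4}"
        then show ?thesis using et
          by (intro bexI[of _ "(e, True)"] bexI[of _ t]) (auto simp: half_def halves_def)
      next
        assume "edge_head e = x \<and> 1 - t \<in> {0..1/4}"
        then show ?thesis using et
          by (intro bexI[of _ "(e, False)"] bexI[of _ "1 - t"]) (auto simp: half_def halves_def)
      qed
    qed
  qed
  obtain B where B: "0 < B" "\<And>p q. p \<in> X \<Longrightarrow> q \<in> X \<Longrightarrow> d (g p) (g q) \<le> B * dG p q"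
    using g_Lipschitz by blast
  have p0: "p0 \<in> mspace T" using \<gamma>[OF i, of 0] \<gamma>0[OF i] by simp
  have hP_in: "h (P e s) \<in> mspace T" if "e \<in> E" "s \<in> {0..1}" for e s
    using that g_in[OF P_in[OF that]] \<gamma>[of "(e, True)" "4 * s"] \<gamma>[of "(e, False)" "4 * (1 - s)"]
    by (auto simp: hP halves_def)
  have h_in: "h z \<in> mspace T" if "z \<in> X" for z
    using Xz[OF that]
  proof
    assume "z \<in> Vertex ` V"
    then show ?thesis using that g_in p0 by (auto simp: h_def)
  next
    assume "\<exists>e\<in>E. \<exists>t\<in>{0..1}. z = P e t"
    then show ?thesis using hP_in by auto
  qed
  let ?C = "max B L"
  have "0 < ?C" using B by simp
  have hL: "Lipschitz_continuous_map (metric_graph V E (\<lambda>_. 1)) T h"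
  proof (rule Lipschitz_from_edges[OF h_in \<open>0 < ?C\<close>])
    fix e s s' assume e: "e \<in> E" and s: "s \<in> {0..1::real}" "s' \<in> {0..1::real}"
    have g: "d (g (P e t)) (g (P e t')) \<le> ?C * \<bar>t - t'\<bar>" if "t \<in> {0..1}" "t' \<in> {0..1}" for t t'
    proof -
      have "d (g (P e t)) (g (P e t')) \<le> B * dG (P e t) (P e t')"
        using that e by (intro B(2) P_in)
      also have "\<dots> \<le> ?C * \<bar>t - t'\<bar>"
        using dG_P_le[OF e that] B(1) by (intro mult_mono) auto
      finally show ?thesis .
    qed
    have \<gamma>C: "d (\<gamma> j (4 * t)) (\<gamma> j (4 * t')) \<le> ?C * \<bar>t - t'\<bar>"
      if "j \<in> halves x" "t \<in> {0..1/4}" "t' \<in> {0..1/4}" for j t t'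
    proof -
      have "d (\<gamma> j (4 * t)) (\<gamma> j (4 * t')) \<le> L / 4 * \<bar>4 * t - 4 * t'\<bar>"
        using that by (intro L) auto
      also have "\<bar>4 * t - 4 * t'\<bar> = 4 * \<bar>t - t'\<bar>" by (simp add: abs_if)
      also have "L / 4 * (4 * \<bar>t - t'\<bar>) = L * \<bar>t - t'\<bar>" by simp
      also have "\<dots> \<le> ?C * \<bar>t - t'\<bar>" by (intro mult_right_mono) auto
      finally show ?thesis .
    qed
    \<comment> \<open>The bound along an edge is assembled from three pieces, cut at 1/4 and 3/4.
      Only the outer ones can be changed by the competitor.\<close>
    have A1: "d (h (P e t)) (h (P e t')) \<le> ?C * \<bar>t - t'\<bar>" if "t \<in> {0..1/4}" "t' \<in> {0..1/4}" for t t'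
    proof (cases "edge_tail e = x")
      case True
      then have "(e, True) \<in> halves x" using e by (simp add: halves_def)
      then show ?thesis
        using \<gamma>C[of "(e, True)" t t'] h_half[of "(e, True)"] that by (simp add: half_def)
    qed (use g that in \<open>auto simp: hP[OF e]\<close>)
    have A3: "d (h (P e t)) (h (P e t')) \<le> ?C * \<bar>t - t'\<bar>" if "t \<in> {3/4..1}" "t' \<in> {3/4..1}" for t t'
    proof (cases "edge_head e = x")
      case True
      then have "(e, False) \<in> halves x" using e by (simp add: halves_def)
      then show ?thesis
        using \<gamma>C[of "(e, False)" "1 - t" "1 - t'"] h_half[of "(e, False)" "1 - t"]
          h_half[of "(e, False)" "1 - t'"] that by (simp add: half_def abs_minus_commute)
    qed (use g that in \<open>auto simp: hP[OF e]\<close>)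
    have A2: "d (h (P e t)) (h (P e t')) \<le> ?C * \<bar>t - t'\<bar>" if "t \<in> {1/4..3/4}" "t' \<in> {1/4..3/4}" for t t'
      using g[of t t'] that by (auto simp: hP[OF e])
    have A12: "d (h (P e t)) (h (P e t')) \<le> ?C * \<bar>t - t'\<bar>" if "t \<in> {0..3/4}" "t' \<in> {0..3/4}" for t t'
      by (rule T.lipschitz_glue[where F="\<lambda>t. h (P e t)" and b="1/4", OF _ _ _ that])
        ((use hP_in e in auto)[1], erule (1) A1, erule (1) A2)
    show "d (h (P e s)) (h (P e s')) \<le> ?C * \<bar>s - s'\<bar>"
      by (rule T.lipschitz_glue[where F="\<lambda>t. h (P e t)" and b="3/4", OF _ _ _ s])
        ((use hP_in e in auto)[1], erule (1) A12, erule (1) A3)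
  qed
  have bound: "d (g p) (g q) \<le> L * dG p q" if "p \<in> ?U" "q \<in> ?U" for p q
  proof (rule AMLE_bound[OF _ _ hL _ \<open>0 \<le> L\<close> _ that])
    show "openin (mtopology_of (metric_graph V E (\<lambda>_. 1))) ?U"
      by (rule open_positive) (auto simp: \<phi>P)
    show "?U \<subseteq> X - Vertex ` Y" using x by (auto simp: \<phi>_def split: if_splits)
    show "h z = g z" if "z \<in> X - ?U" for z
    proof (cases z)
      case (Vertex v)
      then show ?thesis using that by (auto simp: h_def \<phi>_def)
    next
      case (Interior e s)
      have "\<not> 0 < \<phi> z" using that by simp
      then have "\<not> (edge_tail e = x \<and> s < 1/4)" "\<not> (edge_head e = x \<and> 1 - s < 1/4)"
        unfolding Interior \<phi>_def by auto
      then show ?thesis unfolding Interior h_def by (simp only: cpoint.case if_False)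
    qed
    fix p q assume U: "p \<in> ?U" "q \<in> ?U"
    obtain j s where j: "j \<in> halves x" "s \<in> {0..1/4}" "p = half j s"
      using UE[OF U(1)] by blast
    obtain k s' where k: "k \<in> halves x" "s' \<in> {0..1/4}" "q = half k s'"
      using UE[OF U(2)] by blast
    have dp: "d (h p) p0 \<le> L * s" "d p0 (h q) \<le> L * s'"
      using L[OF j(1), of "4 * s" 0] L[OF k(1), of 0 "4 * s'"] j k h_half \<gamma>0 by auto
    \<comment> \<open>On different half edges the estimate runs through \<open>p0\<close>, and
      \<open>s + s'\<close> is also a lower bound for \<open>dG p q\<close>.\<close>
    have "d (h p) (h q) \<le> L * (if j = k then \<bar>s - s'\<bar> else s + s')"
    proof (cases "j = k")
      case True
      have "d (\<gamma> j (4 * s)) (\<gamma> j (4 * s')) \<le> L / 4 * \<bar>4 * s - 4 * s'\<bar>"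
        using j k by (intro L) auto
      also have "\<bar>4 * s - 4 * s'\<bar> = 4 * \<bar>s - s'\<bar>" by (simp add: abs_if)
      also have "L / 4 * (4 * \<bar>s - s'\<bar>) = L * \<bar>s - s'\<bar>" by simp
      finally show ?thesis
        using True j k h_half by simp
    next
      case False
      have "d (h p) (h q) \<le> d (h p) p0 + d p0 (h q)"
        using j k p0 by (intro T.triangle h_in) (auto intro!: half_in)
      then show ?thesis using False dp by (simp add: distrib_left)
    qed
    also have "\<dots> \<le> L * dG p q"
      using dG_half_ge[OF j(1) k(1) j(2) k(2)] j k \<open>0 \<le> L\<close> by (intro mult_left_mono) auto
    finally show "d (h p) (h q) \<le> L * dG p q" .
  qed
  \<comment> \<open>Any radius below 1/4 would serve in place of 1/8: comparing \<open>x\<close>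
    with one point inside the star recovers the full speed of \<open>g\<close> on the half
    edge.\<close>
  have in_U: "half i s \<in> ?U" if "s \<in> {0..1/8}" for s
    using that i half_in[OF i, of s] by (auto simp: half_def \<phi>P halves_def split: if_splits)
  have e: "fst i \<in> E" using i by (auto simp: halves_def)
  have "d (u x) (u (other_end i)) * \<bar>0 - 1/8\<bar> = d (g (half i 0)) (g (half i (1/8)))"
    using i by (intro half_geodesic[symmetric]) auto
  also have "\<dots> \<le> L * dG (half i 0) (half i (1/8))"
    by (intro bound in_U) auto
  also have "\<dots> \<le> L * (1/8)"
    using dG_P_le[OF e, of "if snd i then 0 else 1" "if snd i then 1/8 else 1 - 1/8"] \<open>0 \<le> L\<close>
    by (intro mult_left_mono) (auto simp: half_def split: if_splits)
  finally show ?thesis by simp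
qed

text \<open>
  If no neighbour lay opposite to \<open>other_end i\<close>, all steepest half edges would leave \<open>u x\<close> in a common
  direction, and pushing the value at \<open>x\<close> slightly in this direction would make every slope
  smaller than the maximal one.
\<close>

lemma opposite_half:
  assumes x: "x \<in> V - Y" and i: "i \<in> halves x"
    and max: "\<And>j. j \<in> halves x \<Longrightarrow> d (u x) (u (other_end j)) \<le> d (u x) (u (other_end i))"
  shows "\<exists>j\<in>halves x. d (u x) (u (other_end j)) = d (u x) (u (other_end i)) \<and>
    d (u (other_end i)) (u (other_end j)) = 2 * d (u x) (u (other_end i))"
proof (rule ccontr)
  define R where "R = d (u x) (u (other_end i))"
  define K where "K j = d (u x) (u (other_end j))" for j
  define D where "D j = d (u (other_end i)) (u (other_end j))" for j
  assume "\<not> ?thesis"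
  then have opp: "\<And>j. j \<in> halves x \<Longrightarrow> K j = R \<Longrightarrow> D j \<noteq> 2 * R"
    by (auto simp: R_def K_def D_def)
  have ends: "other_end j \<in> V" if "j \<in> halves x" for j
    using edge_tail_head[OF finite_graph] that by (auto simp: halves_def other_end_def)
  have ux: "u x \<in> mspace T" using x u_in by auto
  have uj: "u (other_end j) \<in> mspace T" if "j \<in> halves x" for j
    using that u_in ends by auto
  have KR: "K j \<le> R" if "j \<in> halves x" for j using max[OF that] by (simp add: K_def R_def)
  have DR: "D j < 2 * R" if "j \<in> halves x" "K j = R" for j
  proof -
    have "D j \<le> d (u (other_end i)) (u x) + d (u x) (u (other_end j))"
      unfolding D_def using that i ux uj by (intro T.triangle) auto
    then show ?thesis using opp[OF that] that by (simp add: R_def K_def T.commute)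
  qed
  \<comment> \<open>If \<open>R\<close> were 0, \<open>i\<close> would be its own opposite.\<close>
  have "0 < R"
  proof (rule ccontr)
    assume "\<not> 0 < R"
    then have "R = 0" using T.nonneg[of "u x" "u (other_end i)"] by (simp add: R_def)
    moreover have "D i = 0" using uj[OF i] by (simp add: D_def)
    ultimately show False using opp[OF i] by (simp add: K_def R_def)
  qed
  \<comment> \<open>In the tree, two steepest half edges share an initial segment of length
    \<open>R - D j / 2\<close>, the Gromov product of their ends at \<open>u x\<close>, and a step
    of length \<open>\<delta> * R\<close> along \<open>i\<close> stays on it. For a less steep half
    edge the step is at most half of its slack \<open>(R - K j) / 4\<close> at radius 1/4.\<close>
  define \<Delta> where "\<Delta> j = (if K j = R then (R - D j / 2) / R else (R - K j) / (8 * R))" for j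
  define \<delta> where "\<delta> = Min (insert (1/4) (\<Delta> ` halves x))"
  have fin: "finite (insert (1/4) (\<Delta> ` halves x))" using finite_halves by simp
  have "0 < \<Delta> j" if "j \<in> halves x" for j
    using KR[OF that] DR[OF that] \<open>0 < R\<close> by (auto simp: \<Delta>_def)
  then have "0 < \<delta>" using fin by (auto simp: \<delta>_def)
  have "\<delta> \<le> 1/4" unfolding \<delta>_def by (rule Min_le[OF fin]) simp
  have \<delta>: "\<delta> \<le> \<Delta> j" if "j \<in> halves x" for j
    unfolding \<delta>_def using that by (intro Min_le[OF fin]) simp
  define p0 where "p0 = g (half i \<delta>)"
  have p0: "p0 \<in> mspace T"
    using \<open>0 < \<delta>\<close> \<open>\<delta> \<le> 1/4\<close> i by (auto simp: p0_def intro!: g_in half_in)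
  have q_in: "g (half j (1/4)) \<in> mspace T" if "j \<in> halves x" for j
    using that by (auto intro!: g_in half_in)
  have g0: "g (half j 0) = u x" if "j \<in> halves x" for j using half_0[OF that] by (simp add: u_def)
  have g1: "g (half j 1) = u (other_end j)" for j by (simp add: half_1 u_def)
  have closer: "d p0 (g (half j (1/4))) < R / 4" if j: "j \<in> halves x" for j
  proof -
    let ?q = "g (half j (1/4))"
    have pm: "d p0 (u x) = \<delta> * R"
      using half_geodesic[OF i, of \<delta> 0] g0[OF i] \<open>0 < \<delta>\<close> \<open>\<delta> \<le> 1/4\<close> by (simp add: p0_def R_def)
    have mq: "d ?q (u x) = K j / 4"
      using half_geodesic[OF j, of "1/4" 0] g0[OF j] by (simp add: K_def)
    show ?thesis
    proof (cases "K j = R")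
      case False
      then have "K j < R" using KR[OF j] by simp
      have "\<delta> \<le> (R - K j) / (8 * R)" using \<delta>[OF j] False by (simp add: \<Delta>_def)
      then have "\<delta> * R \<le> (R - K j) / 8" using \<open>0 < R\<close> by (simp add: field_simps)
      moreover have "d p0 ?q \<le> d p0 (u x) + d (u x) ?q"
        using p0 ux q_in[OF j] by (rule T.triangle)
      ultimately show ?thesis using pm mq \<open>K j < R\<close> T.commute[of ?q "u x"] by simp
    next
      case True
      have "\<delta> \<le> (R - D j / 2) / R" using \<delta>[OF j] True by (simp add: \<Delta>_def)
      then have lR: "2 * (\<delta> * R) \<le> 2 * R - D j" using \<open>0 < R\<close> by (simp add: field_simps)
      have pa: "d p0 (u (other_end i)) = R - \<delta> * R"
        using half_geodesic[OF i, of \<delta> 1] g1[of i] \<open>0 < \<delta>\<close> \<open>\<delta> \<le> 1/4\<close>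
        by (simp add: p0_def R_def algebra_simps)
      have qb: "d ?q (u (other_end j)) = 3 * R / 4"
        using half_geodesic[OF j, of "1/4" 1] g1[of j] True by (simp add: K_def)
      \<comment> \<open>The four-point condition is applied twice: here it places \<open>p0\<close>
        within \<open>R - \<delta> * R\<close> of the end of \<open>j\<close>, and then it carries
        this over to the point at radius 1/4.\<close>
      have "d p0 (u (other_end j)) + d (u (other_end i)) (u x) \<le>
          max (d p0 (u (other_end i)) + d (u (other_end j)) (u x)) (d p0 (u x) + d (u (other_end j)) (u (other_end i)))"
        using p0 uj i j ux by (intro four_point) auto
      then have pb: "d p0 (u (other_end j)) \<le> R - \<delta> * R"
        using pa pm lR True by (simp add: T.commute K_def D_def R_def)
      have "d p0 ?q + d (u (other_end j)) (u x) \<le>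
          max (d p0 (u (other_end j)) + d ?q (u x)) (d p0 (u x) + d ?q (u (other_end j)))"
        using p0 uj i j ux q_in by (intro four_point) auto
      moreover have "d (u (other_end j)) (u x) = R" using True by (simp add: K_def T.commute)
      moreover have "\<delta> * R \<le> 1/4 * R" "0 < \<delta> * R"
        using \<open>\<delta> \<le> 1/4\<close> \<open>0 < R\<close> \<open>0 < \<delta>\<close> by (auto intro: mult_right_mono)
      ultimately show ?thesis using pb mq qb pm True by (simp add: max_def split: if_splits)
    qed
  qed
  define m where "m = Max ((\<lambda>j. d p0 (g (half j (1/4)))) ` halves x)"
  have m: "d p0 (g (half j (1/4))) \<le> m" if "j \<in> halves x" for j
    unfolding m_def using finite_halves that by (intro Max_ge) auto
  have "m < R / 4"
    unfolding m_def using finite_halves i closer by (subst Max_less_iff) auto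
  have "0 \<le> m" using m[OF i] T.nonneg order_trans by blast
  \<comment> \<open>\<open>L\<close> is the mean of \<open>4 * m\<close> and \<open>R\<close>. Being
    above \<open>4 * m\<close>, it admits curves from \<open>p0\<close> to the points at radius 1/4;
    being below \<open>R\<close>, it contradicts the slope along \<open>i\<close>.\<close>
  define L where "L = 2 * m + R / 2"
  have L: "0 \<le> L" "L < R" "m < L / 4"
    using \<open>m < R / 4\<close> \<open>0 \<le> m\<close> \<open>0 < R\<close> by (auto simp: L_def)
  have "\<exists>\<gamma>. \<gamma> 0 = p0 \<and> \<gamma> 1 = g (half j (1/4)) \<and> (\<forall>s\<in>{0..1}. \<gamma> s \<in> mspace T) \<and>
      (\<forall>s\<in>{0..1}. \<forall>s'\<in>{0..1}. d (\<gamma> s) (\<gamma> s') \<le> L / 4 * \<bar>s - s'\<bar>)" if "j \<in> halves x" for j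
    using m[OF that] L(3) by (intro metric_tree_curve[OF tree p0 q_in[OF that]]) auto
  then obtain \<gamma> where "\<forall>j\<in>halves x. \<gamma> j 0 = p0 \<and> \<gamma> j 1 = g (half j (1/4)) \<and> (\<forall>s\<in>{0..1}. \<gamma> j s \<in> mspace T) \<and>
      (\<forall>s\<in>{0..1}. \<forall>s'\<in>{0..1}. d (\<gamma> j s) (\<gamma> j s') \<le> L / 4 * \<bar>s - s'\<bar>)"
    by metis
  then have "d (u x) (u (other_end i)) \<le> L"
    by (intro AMLE_star[OF x, of \<gamma> p0 L i]) (use L i in auto)
  then show False using L(2) by (simp add: R_def)
qed

end

section \<open>Potentials on the graph\<close>

text \<open>With \<open>\<rho>\<close> the distance to \<open>B\<close>, the potential is the square
  of \<open>N + 1 - \<rho>\<close>. The move \<open>m x\<close> lowers \<open>\<rho>\<close> by one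
  and a reply raises it by at most one, so the identity
  \<open>(k + 1)^2 + (k - 1)^2 = 2 * k^2 + 2\<close> gives the drift against every reply.\<close>

lemma graph_potential:
  assumes fin: "finite V" and con: "connected_graph V E"
    and B: "B \<subseteq> V" "B \<noteq> {}"
  shows "\<exists>\<psi> \<Psi> m. (\<forall>x\<in>V. 0 \<le> \<psi> x \<and> \<psi> x \<le> (\<Psi> :: real)) \<and>
    (\<forall>x\<in>V - B. {x, m x} \<in> E \<and> (\<forall>w. {x, w} \<in> E \<longrightarrow> 2 * \<psi> x + 2 \<le> \<psi> (m x) + \<psi> w))"
proof -
  define R where "R = {(a, b). {a, b} \<in> E}"
  define reach where "reach x n \<longleftrightarrow> (\<exists>b\<in>B. (x, b) \<in> R ^^ n)" for x n
  define \<rho> where "\<rho> x = (LEAST n. reach x n)" for x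
  have ex: "reach x (\<rho> x)" if "x \<in> V" for x
  proof -
    obtain b where b: "b \<in> B" using B by blast
    then have "(x, b) \<in> R\<^sup>*"
      using con that B unfolding connected_graph_def R_def by blast
    then obtain n where "(x, b) \<in> R ^^ n" using rtrancl_imp_relpow by blast
    then have "reach x n" using b by (auto simp: reach_def)
    then show ?thesis unfolding \<rho>_def by (rule LeastI)
  qed
  have le: "\<rho> x \<le> n" if "reach x n" for x n
    unfolding \<rho>_def using that by (rule Least_le)
  have adj: "\<rho> w \<le> Suc (\<rho> x)" if xw: "{x, w} \<in> E" "x \<in> V" for x w
  proof -
    obtain b where "b \<in> B" "(x, b) \<in> R ^^ \<rho> x" using ex[OF xw(2)] by (auto simp: reach_def)
    moreover have "(w, x) \<in> R" using xw by (simp add: R_def insert_commute)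
    ultimately have "reach w (Suc (\<rho> x))" unfolding reach_def by (metis relpow_Suc_I2)
    then show ?thesis by (rule le)
  qed
  have step: "\<exists>w. {x, w} \<in> E \<and> Suc (\<rho> w) \<le> \<rho> x" if x: "x \<in> V - B" for x
  proof -
    obtain b where b: "b \<in> B" "(x, b) \<in> R ^^ \<rho> x" using ex[of x] x by (auto simp: reach_def)
    obtain n where n: "\<rho> x = Suc n"
      using b x by (cases "\<rho> x") auto
    then obtain w where w: "(x, w) \<in> R" "(w, b) \<in> R ^^ n"
      using b(2) by (metis relpow_Suc_D2)
    then have "\<rho> w \<le> n" using b by (intro le) (auto simp: reach_def)
    then show ?thesis using w n by (auto simp: R_def)
  qed
  then obtain m where m: "\<And>x. x \<in> V - B \<Longrightarrow> {x, m x} \<in> E \<and> Suc (\<rho> (m x)) \<le> \<rho> x"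
    by metis
  define N where "N = Max (insert 0 (\<rho> ` V))"
  have N: "\<rho> x \<le> N" if "x \<in> V" for x
    unfolding N_def using fin that by (intro Max_ge) auto
  \<comment> \<open>The summand 1 ensures \<open>1 \<le> k\<close> below, so that
    \<open>k - 1\<close> is nonnegative and squaring is monotone.\<close>
  define \<psi> where "\<psi> x = (real N + 1 - real (\<rho> x))\<^sup>2" for x
  have "0 \<le> \<psi> x \<and> \<psi> x \<le> (real N + 1)\<^sup>2" if "x \<in> V" for x
    using N[OF that] by (auto simp: \<psi>_def intro!: power_mono)
  moreover have "2 * \<psi> x + 2 \<le> \<psi> (m x) + \<psi> w" if x: "x \<in> V - B" and w: "{x, w} \<in> E" for x w
  proof -
    define k where "k = real N + 1 - real (\<rho> x)"
    have "1 \<le> k" using N[of x] x by (simp add: k_def)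
    have "k + 1 \<le> real N + 1 - real (\<rho> (m x))" using m[OF x] by (simp add: k_def)
    then have 1: "(k + 1)\<^sup>2 \<le> \<psi> (m x)" unfolding \<psi>_def using \<open>1 \<le> k\<close> by (intro power_mono) auto
    have "k - 1 \<le> real N + 1 - real (\<rho> w)" using adj[OF w] x by (simp add: k_def)
    then have 2: "(k - 1)\<^sup>2 \<le> \<psi> w" unfolding \<psi>_def using \<open>1 \<le> k\<close> by (intro power_mono) auto
    have "\<psi> x = k\<^sup>2" by (simp add: \<psi>_def k_def)
    then show ?thesis using 1 2 by (simp add: power2_eq_square algebra_simps)
  qed
  ultimately show ?thesis using m by blast
qed

text \<open>
  Squared distance to a base point is strictly convex along \<open>p, m, w\<close> up to the defect \<open>s\<close> of
  \<open>m\<close> being the midpoint of \<open>p\<close> and \<open>w\<close>.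
\<close>

lemma four_point_square:
  fixes a R s \<beta>p \<beta>w :: real
  assumes fp: "a + pw \<le> max (R + \<beta>w) (mw + \<beta>p)" and pw: "2 * R - s \<le> pw" and mw: "mw \<le> R"
    and "0 \<le> s" "0 \<le> a" "0 \<le> R" "0 \<le> \<beta>p" "0 \<le> \<beta>w" and tri: "a - R \<le> \<beta>p" "a - mw \<le> \<beta>w"
    and D: "a + R \<le> D"
  shows "R\<^sup>2 - 2 * D * s \<le> \<beta>p\<^sup>2 + \<beta>w\<^sup>2 - 2 * a\<^sup>2"
proof -
  have *: "R\<^sup>2 - 2 * D * s \<le> b\<^sup>2 + c\<^sup>2 - 2 * a\<^sup>2"
    if b: "a + R - s \<le> b" "0 \<le> b" and c: "a - R \<le> c" "0 \<le> c" for b c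
  proof -
    have s2: "2 * (a + R) * s \<le> 2 * D * s" using D \<open>0 \<le> s\<close> by (intro mult_right_mono) auto
    have 1: "(a + R)\<^sup>2 - 2 * (a + R) * s \<le> b\<^sup>2"
    proof (cases "a + R - s \<ge> 0")
      case True
      then have "(a + R - s)\<^sup>2 \<le> b\<^sup>2" using b by (intro power_mono)
      moreover have "(a + R - s)\<^sup>2 = (a + R)\<^sup>2 - 2 * (a + R) * s + s\<^sup>2"
        by (simp add: power2_eq_square algebra_simps)
      ultimately show ?thesis using zero_le_power2[of s] by linarith
    next
      case False
      then have "(a + R) * (a + R) \<le> (a + R) * (2 * s)"
        using \<open>0 \<le> a\<close> \<open>0 \<le> R\<close> \<open>0 \<le> s\<close> by (intro mult_left_mono) auto
      then have "(a + R)\<^sup>2 \<le> 2 * (a + R) * s" by (simp add: power2_eq_square algebra_simps)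
      then show ?thesis using zero_le_power2[of b] by linarith
    qed
    \<comment> \<open>If the base point is nearer than \<open>R\<close>, the bound
      \<open>a - R \<le> c\<close> is empty. One \<open>R\<^sup>2\<close> still remains then,
      against two in the other case.\<close>
    have 2: "R\<^sup>2 + 2 * a\<^sup>2 \<le> (a + R)\<^sup>2 + c\<^sup>2"
    proof (cases "R \<le> a")
      case True
      then have "(a - R)\<^sup>2 \<le> c\<^sup>2" using c by (intro power_mono) auto
      moreover have "(a - R)\<^sup>2 + (a + R)\<^sup>2 = 2 * R\<^sup>2 + 2 * a\<^sup>2"
        by (simp add: power2_eq_square algebra_simps)
      ultimately show ?thesis using zero_le_power2[of R] by linarith
    next
      case False
      then have "a * a \<le> 2 * R * a" using \<open>0 \<le> a\<close> by (intro mult_right_mono) auto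
      then have "a\<^sup>2 \<le> 2 * R * a" by (simp add: power2_eq_square)
      moreover have "(a + R)\<^sup>2 = a\<^sup>2 + 2 * R * a + R\<^sup>2"
        by (simp add: power2_eq_square algebra_simps)
      ultimately show ?thesis using zero_le_power2[of c] by linarith
    qed
    show ?thesis using s2 1 2 by linarith
  qed
  \<comment> \<open>One of the two neighbours leads away from the base point, up to the defect; the
    other one is controlled by the triangle inequality.\<close>
  have "a + R - s \<le> \<beta>w \<or> a + R - s \<le> \<beta>p"
    using fp pw mw by (auto simp: max_def split: if_splits)
  then show ?thesis
  proof
    assume "a + R - s \<le> \<beta>w"
    then show ?thesis using *[of \<beta>w \<beta>p] assms by simp
  next
    assume "a + R - s \<le> \<beta>p"
    then show ?thesis using *[of \<beta>p \<beta>w] assms by simp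
  qed
qed

section \<open>Slopes and the drift potential\<close>

context tree_AMLE
begin

lemma edge_in_V: "{x, w} \<in> E \<Longrightarrow> w \<in> V"
  using finite_graph_edge_subset[OF finite_graph] by blast

lemma vertex_potential:
  assumes "B \<subseteq> V" "B \<noteq> {}"
  shows "\<exists>\<psi> \<Psi> m. (\<forall>x\<in>V. 0 \<le> \<psi> x \<and> \<psi> x \<le> (\<Psi> :: real)) \<and>
    (\<forall>x\<in>V - B. {x, m x} \<in> E \<and> (\<forall>w. {x, w} \<in> E \<longrightarrow> 2 * \<psi> x + 2 \<le> \<psi> (m x) + \<psi> w))"
  using finite_graph connected_graph assms
  by (intro graph_potential) (auto simp: finite_graph_def)

definition slope :: "'v \<Rightarrow> real" where
  "slope x = Max ((\<lambda>w. d (u x) (u w)) ` {w. {x, w} \<in> E})"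

lemma finite_neighbours: "finite {w. {x, w} \<in> E}"
  using finite_graph edge_in_V by (auto simp: finite_graph_def intro: finite_subset)

lemma slope_ge: "{x, w} \<in> E \<Longrightarrow> d (u x) (u w) \<le> slope x"
  unfolding slope_def using finite_neighbours by (intro Max_ge) auto

lemma opposite_neighbours:
  assumes x: "x \<in> V - Y" and "{w. {x, w} \<in> E} \<noteq> {}"
  shows "\<exists>y z. {x, y} \<in> E \<and> {x, z} \<in> E \<and> d (u x) (u y) = slope x \<and> d (u x) (u z) = slope x \<and>
    d (u y) (u z) = 2 * slope x"
proof -
  have "slope x \<in> (\<lambda>w. d (u x) (u w)) ` {w. {x, w} \<in> E}"
    unfolding slope_def using finite_neighbours assms(2) by (intro Max_in) auto
  then obtain y where y: "{x, y} \<in> E" "d (u x) (u y) = slope x" by auto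
  have nb: "{x, w} \<in> E \<longleftrightarrow> (\<exists>i\<in>halves x. other_end i = w)" for w
    using x by (intro neighbour_iff_half) auto
  obtain i where i: "i \<in> halves x" "other_end i = y" using y nb by blast
  have "d (u x) (u (other_end j)) \<le> d (u x) (u (other_end i))" if "j \<in> halves x" for j
    using slope_ge[of x "other_end j"] nb that i y by auto
  from opposite_half[OF x i(1) this]
  obtain j where "j \<in> halves x" "d (u x) (u (other_end j)) = slope x"
      "d (u y) (u (other_end j)) = 2 * slope x"
    using i y by auto
  then show ?thesis using y nb by blast
qed

lemma tree_bound: "\<exists>D>0. \<forall>p\<in>mspace T. \<forall>q\<in>mspace T. d p q \<le> D"
proof -
  obtain B where B: "\<forall>p\<in>mspace T. \<forall>q\<in>mspace T. d p q \<le> B"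
    using metric_tree_bounded[OF tree] by blast
  then have "\<forall>p\<in>mspace T. \<forall>q\<in>mspace T. d p q \<le> max 1 B" by fastforce
  then show ?thesis by (intro exI[of _ "max 1 B"]) auto
qed

text \<open>
  At a vertex of positive slope the potential rises because of the squared distance of \<open>u\<close> to a base
  point, at a vertex of slope zero because of the term that rewards approaching \<open>Y\<close> or the vertices of
  positive slope. The coefficients \<open>\<eta>\<close> and \<open>\<eta>'\<close> make the second effect negligible where
  the first one is available.
\<close>

lemma drift_potential:
  assumes "V - Y \<noteq> {}" "0 < \<epsilon>"
  shows "\<exists>G c y z. 0 < c \<and> (\<forall>x\<in>V. 0 \<le> G x \<and> G x \<le> (\<epsilon> :: real)) \<and>
    (\<forall>x\<in>V - Y. {x, y x} \<in> E \<and> {x, z x} \<in> E \<and> d (u x) (u (y x)) = slope x \<and> d (u x) (u (z x)) = slope x \<and>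
      d (u (y x)) (u (z x)) = 2 * slope x \<and>
      (\<forall>w a s. {x, w} \<in> E \<longrightarrow> a \<in> {y x, z x} \<longrightarrow> 0 \<le> s \<longrightarrow> 2 * slope x - s \<le> d (u a) (u w) \<longrightarrow>
        2 * G x + 2 * c - s \<le> G a + G w))"
proof -
  have finV: "finite V" using finite_graph by (simp add: finite_graph_def)
  obtain D where D: "0 < D" "\<And>p q. p \<in> mspace T \<Longrightarrow> q \<in> mspace T \<Longrightarrow> d p q \<le> D"
    using tree_bound by blast
  define S where "S = {x \<in> V - Y. 0 < slope x}"
  have finS: "finite S" using finV by (simp add: S_def)
  have BV: "Y \<union> S \<subseteq> V" "Y \<union> S \<noteq> {}" using boundary by (auto simp: S_def)
  from vertex_potential[OF BV] obtain \<psi> \<Psi> m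
    where \<psi>': "\<forall>x\<in>V. 0 \<le> \<psi> x \<and> \<psi> x \<le> (\<Psi> :: real)"
    and m': "\<forall>x\<in>V - (Y \<union> S). {x, m x} \<in> E \<and> (\<forall>w. {x, w} \<in> E \<longrightarrow> 2 * \<psi> x + 2 \<le> \<psi> (m x) + \<psi> w)"
    by (elim exE conjE)
  note \<psi> = bspec[OF \<psi>']
  have m: "{x, m x} \<in> E" if "x \<in> V - (Y \<union> S)" for x using m' that by blast
  have m2: "2 * \<psi> x + 2 \<le> \<psi> (m x) + \<psi> w" if "x \<in> V - (Y \<union> S)" "{x, w} \<in> E" for x w
    using m' that by blast
  from vertex_potential[OF boundary] obtain mY where mY: "\<And>x. x \<in> V - Y \<Longrightarrow> {x, mY x} \<in> E"
    by blast
  have slope0: "slope x = 0" if "x \<in> V - (Y \<union> S)" for x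
  proof -
    have "0 \<le> slope x" using slope_ge[of x "mY x"] mY[of x] that T.nonneg order_trans by blast
    moreover have "\<not> 0 < slope x" using that by (auto simp: S_def)
    ultimately show ?thesis by simp
  qed
  define r where "r = Min (insert 1 (slope ` S))"
  have r: "0 < r" "\<And>x. x \<in> S \<Longrightarrow> r \<le> slope x"
    unfolding r_def using finS by (auto simp: S_def)
  obtain x1 where "x1 \<in> V" using assms by auto
  then have "0 \<le> \<Psi>" using \<psi>[of x1] by linarith
  obtain b where b: "b \<in> mspace T" using u_in[OF \<open>x1 \<in> V\<close>] by blast
  define h where "h x = (d (u x) b)\<^sup>2" for x
  have h: "0 \<le> h x" "h x \<le> D\<^sup>2" if "x \<in> V" for x
    using D(2)[OF u_in[OF that] b] by (auto simp: h_def intro!: power_mono)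
  \<comment> \<open>The first bound makes the loss \<open>4 * D * \<eta> * s\<close> caused by a
    defect \<open>s\<close> at most \<open>s\<close>; the second keeps this part of the potential
    below \<open>\<epsilon> / 2\<close>.\<close>
  define \<eta> where "\<eta> = min (1 / (4 * D)) (\<epsilon> / (2 * D\<^sup>2))"
  have \<eta>: "0 < \<eta>" "4 * D * \<eta> \<le> 1" "\<eta> * D\<^sup>2 \<le> \<epsilon> / 2"
  proof -
    show "0 < \<eta>" using D assms by (simp add: \<eta>_def)
    have "4 * D * \<eta> \<le> 4 * D * (1 / (4 * D))" using D by (intro mult_left_mono) (auto simp: \<eta>_def)
    then show "4 * D * \<eta> \<le> 1" using D by simp
    have "\<eta> * D\<^sup>2 \<le> \<epsilon> / (2 * D\<^sup>2) * D\<^sup>2" by (intro mult_right_mono) (auto simp: \<eta>_def)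
    then show "\<eta> * D\<^sup>2 \<le> \<epsilon> / 2" using D by simp
  qed
  \<comment> \<open>At positive slope \<open>\<psi>\<close> may change unfavourably; this weight
    makes \<open>2 * \<eta>' * \<psi> x\<close> at most half of the rise
    \<open>\<eta> * r\<^sup>2\<close>. At slope zero \<open>\<eta>'\<close> itself is the
    drift.\<close>
  define \<eta>' where "\<eta>' = min (\<eta> * r\<^sup>2) \<epsilon> / (4 * (\<Psi> + 1))"
  have \<eta>': "0 < \<eta>'" "4 * \<eta>' * \<Psi> \<le> \<eta> * r\<^sup>2" "4 * \<eta>' * \<Psi> \<le> \<epsilon>"
  proof -
    have pos: "0 < min (\<eta> * r\<^sup>2) \<epsilon>" using \<eta> r assms by simp
    then show "0 < \<eta>'" using \<open>0 \<le> \<Psi>\<close> by (simp add: \<eta>'_def)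
    then have "4 * \<eta>' * \<Psi> \<le> 4 * \<eta>' * (\<Psi> + 1)" by simp
    also have "\<dots> = \<eta>' * (4 * (\<Psi> + 1))" by simp
    also have "\<dots> = min (\<eta> * r\<^sup>2) \<epsilon>"
      unfolding \<eta>'_def using \<open>0 \<le> \<Psi>\<close> by (simp del: distrib_left_numeral)
    finally show "4 * \<eta>' * \<Psi> \<le> \<eta> * r\<^sup>2" "4 * \<eta>' * \<Psi> \<le> \<epsilon>" by auto
  qed
  define G where "G x = \<eta> * h x + \<eta>' * \<psi> x" for x
  define c where "c = min \<eta>' (\<eta> * r\<^sup>2 / 4)"
  have "0 < c" using \<eta> \<eta>' r by (simp add: c_def)
  have G: "0 \<le> G x \<and> G x \<le> \<epsilon>" if "x \<in> V" for x
  proof -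
    have "0 \<le> \<eta> * h x" "0 \<le> \<eta>' * \<psi> x" using h[OF that] \<psi>[OF that] \<eta> \<eta>' by auto
    moreover have "\<eta> * h x \<le> \<eta> * D\<^sup>2" "\<eta>' * \<psi> x \<le> \<eta>' * \<Psi>"
      using h[OF that] \<psi>[OF that] \<eta> \<eta>' by (auto intro: mult_left_mono)
    ultimately show ?thesis using \<eta>(3) \<eta>'(3) assms(2) unfolding G_def by linarith
  qed
  have main: "2 * G x + 2 * c - s \<le> G a + G w"
    if x: "x \<in> S" and a: "{x, a} \<in> E" "d (u x) (u a) = slope x" and w: "{x, w} \<in> E"
      and s: "0 \<le> s" "2 * slope x - s \<le> d (u a) (u w)" for x a w s
  proof -
    have V: "x \<in> V" "a \<in> V" "w \<in> V" using x a w edge_in_V by (auto simp: S_def)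
    note in_T = u_in[OF V(1)] u_in[OF V(2)] u_in[OF V(3)]
    let ?R = "slope x"
    have "0 < ?R" using x by (simp add: S_def)
    have tri: "d (u x) b \<le> d (u x) (u a) + d (u a) b" "d (u x) b \<le> d (u x) (u w) + d (u w) b"
      using in_T b by (auto intro: T.triangle)
    have "?R\<^sup>2 - 2 * (2 * D) * s \<le> (d (u a) b)\<^sup>2 + (d (u w) b)\<^sup>2 - 2 * (d (u x) b)\<^sup>2"
    proof (rule four_point_square[where pw = "d (u a) (u w)" and mw = "d (u x) (u w)"])
      show "d (u x) b + d (u a) (u w) \<le> max (?R + d (u w) b) (d (u x) (u w) + d (u a) b)"
        using four_point[of "u x" b "u a" "u w"] in_T b a by (simp add: T.commute)
      show "d (u x) (u w) \<le> ?R" using slope_ge[OF w] .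
      have "d (u x) b \<le> D" "d (u x) (u a) \<le> D" using D in_T b by auto
      then show "d (u x) b + ?R \<le> 2 * D" using a by simp
    qed (use s tri \<open>0 < ?R\<close> a in auto)
    then have "?R\<^sup>2 - 4 * D * s \<le> h a + h w - 2 * h x" by (simp add: h_def)
    then have "\<eta> * (?R\<^sup>2 - 4 * D * s) \<le> \<eta> * (h a + h w - 2 * h x)" using \<eta> by (intro mult_left_mono) auto
    then have "\<eta> * ?R\<^sup>2 - (4 * D * \<eta>) * s \<le> \<eta> * h a + \<eta> * h w - 2 * (\<eta> * h x)"
      by (simp add: algebra_simps)
    moreover have "(4 * D * \<eta>) * s \<le> 1 * s" using \<eta> s by (intro mult_right_mono) auto
    moreover have "\<eta> * r\<^sup>2 \<le> \<eta> * ?R\<^sup>2" using \<eta> r x by (intro mult_left_mono power_mono) (auto simp: less_imp_le)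
    ultimately have 1: "2 * (\<eta> * h x) + \<eta> * r\<^sup>2 - s \<le> \<eta> * h a + \<eta> * h w" by linarith
    have "\<eta>' * \<psi> x \<le> \<eta>' * \<Psi>" using \<psi> V \<eta>' by (auto intro: mult_left_mono)
    moreover have "2 * c \<le> \<eta> * r\<^sup>2 / 2" by (simp add: c_def)
    ultimately have 2: "2 * (\<eta>' * \<psi> x) + 2 * c \<le> \<eta> * r\<^sup>2" using \<eta>'(2) by linarith
    have "0 \<le> \<eta>' * \<psi> a" "0 \<le> \<eta>' * \<psi> w" using \<psi> V \<eta>' by auto
    then have "\<eta> * h a + \<eta> * h w \<le> G a + G w" unfolding G_def by linarith
    moreover have "2 * G x = 2 * (\<eta> * h x) + 2 * (\<eta>' * \<psi> x)" by (simp add: G_def)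
    ultimately show ?thesis using 1 2 by linarith
  qed
  \<comment> \<open>At slope zero all neighbours have the value \<open>u x\<close>, so the squared
    distance is constant and only \<open>\<psi>\<close> moves. Both opposite neighbours can then be
    taken to be \<open>m x\<close>.\<close>
  have flat: "2 * G x + 2 * c - s \<le> G (m x) + G w"
    if x: "x \<in> V - (Y \<union> S)" and w: "{x, w} \<in> E" and "0 \<le> s" for x w s
  proof -
    have same: "u v = u x" if "{x, v} \<in> E" for v
    proof -
      have "d (u x) (u v) \<le> 0" using slope_ge[OF that] slope0[OF x] by simp
      then show ?thesis
        using T.mdist_pos_less[of "u x" "u v"] u_in[OF edge_in_V[OF that]] u_in[of x] x by fastforce
    qed
    have hh: "h (m x) = h x" "h w = h x" using same[OF m[OF x]] same[OF w] by (auto simp: h_def)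
    have "\<eta>' * (2 * \<psi> x + 2) \<le> \<eta>' * (\<psi> (m x) + \<psi> w)"
      using m2[OF x w] \<eta>' by (intro mult_left_mono) auto
    moreover have "2 * c \<le> 2 * \<eta>'" by (simp add: c_def)
    ultimately show ?thesis using \<open>0 \<le> s\<close> by (simp add: G_def hh algebra_simps)
  qed
  have "\<exists>y z. {x, y} \<in> E \<and> {x, z} \<in> E \<and> d (u x) (u y) = slope x \<and> d (u x) (u z) = slope x \<and>
      d (u y) (u z) = 2 * slope x \<and>
      (\<forall>w a s. {x, w} \<in> E \<longrightarrow> a \<in> {y, z} \<longrightarrow> 0 \<le> s \<longrightarrow> 2 * slope x - s \<le> d (u a) (u w) \<longrightarrow>
        2 * G x + 2 * c - s \<le> G a + G w)" if x: "x \<in> V - Y" for x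
  proof (cases "x \<in> S")
    case True
    have "{w. {x, w} \<in> E} \<noteq> {}" using mY[OF x] by auto
    then obtain y z where yz: "{x, y} \<in> E" "{x, z} \<in> E" "d (u x) (u y) = slope x" "d (u x) (u z) = slope x"
        "d (u y) (u z) = 2 * slope x"
      using opposite_neighbours[OF x] by blast
    have "2 * G x + 2 * c - s \<le> G a + G w"
      if "{x, w} \<in> E" "a \<in> {y, z}" "0 \<le> s" "2 * slope x - s \<le> d (u a) (u w)" for w a s
      by (rule main[OF True _ _ that(1,3,4)]) (use yz that(2) in auto)
    then show ?thesis
      using yz by (intro exI[of _ y] exI[of _ z] conjI allI impI)
  next
    case False
    then have x': "x \<in> V - (Y \<union> S)" using x by auto
    have "d (u x) (u (m x)) = slope x"
      using slope_ge[OF m[OF x']] slope0[OF x'] T.nonneg[of "u x" "u (m x)"] by linarith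
    moreover have "d (u (m x)) (u (m x)) = 2 * slope x"
      using slope0[OF x'] u_in[OF edge_in_V[OF m[OF x']]] by simp
    ultimately show ?thesis
      using m[OF x'] flat[OF x'] by (intro exI[of _ "m x"] conjI allI impI) simp_all
  qed
  then obtain y z where "\<forall>x\<in>V - Y. {x, y x} \<in> E \<and> {x, z x} \<in> E \<and> d (u x) (u (y x)) = slope x \<and>
      d (u x) (u (z x)) = slope x \<and> d (u (y x)) (u (z x)) = 2 * slope x \<and>
      (\<forall>w a s. {x, w} \<in> E \<longrightarrow> a \<in> {y x, z x} \<longrightarrow> 0 \<le> s \<longrightarrow> 2 * slope x - s \<le> d (u a) (u w) \<longrightarrow>
        2 * G x + 2 * c - s \<le> G a + G w)"
    by metis
  then show ?thesis using \<open>0 < c\<close> G by blast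
qed

end

section \<open>The law of a play\<close>

context politics
begin

lemma space_metric_borel [simp]: "space (metric_borel X) = mspace X"
  and sets_metric_borel_open: "openin (mtopology_of X) U \<Longrightarrow> U \<in> sets (metric_borel X)"
proof -
  have *: "{U. openin (mtopology_of X) U} \<subseteq> Pow (mspace X)"
    using openin_subset[of "mtopology_of X"] by auto
  show "space (metric_borel X) = mspace X"
    unfolding metric_borel_def by (rule space_measure_of[OF *])
  show "U \<in> sets (metric_borel X)" if "openin (mtopology_of X) U"
    unfolding metric_borel_def sets_measure_of[OF *] using that by (intro sigma_sets.Basic) simp
qed

text \<open>Both moves are considered although the toss lets only one be played: given the targets,
  the fair coin makes the expectation the mean of the two branches. The nested almost-everywhere
  conditions suit random strategies, whose moves are legal only almost surely.\<close>

lemma round_law_ge: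
  assumes s: "\<sigma> \<in> strategiesI" "\<tau> \<in> strategiesII" and h: "h \<in> space (history_space n)"
    and F: "F \<in> borel_measurable round_space"
    and le: "AE q in opposeI \<sigma> n h. AE t in targetII \<tau> n h q.
      AE a in moveI \<sigma> n h q t. AE b in moveII \<tau> n h q t. 2 * c \<le> F (q, t, True, a) + F (q, t, False, b)"
  shows "(c :: ennreal) \<le> (\<integral>\<^sup>+r. F r \<partial>round_law \<sigma> \<tau> n h)"
proof -
  let ?T = "metric_borel T" and ?B = "count_space (UNIV :: bool set)" and ?V = "count_space V"
  define Q where "Q = opposeI \<sigma> n h"
  define N where "N q = targetII \<tau> n h q" for q
  define A where "A q t = moveI \<sigma> n h q t" for q t
  define B where "B q t = moveII \<tau> n h q t" for q t
  have Q: "Q \<in> space (prob_algebra ?T)"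
  proof -
    have "opposeI \<sigma> n \<in> history_space n \<rightarrow>\<^sub>M prob_algebra ?T"
      using s(1) by (simp add: strategiesI_def)
    from measurable_space[OF this h] show ?thesis by (simp add: Q_def)
  qed
  have N: "N \<in> ?T \<rightarrow>\<^sub>M prob_algebra ?T"
  proof -
    have "(\<lambda>(h, q). targetII \<tau> n h q) \<in> history_space n \<Otimes>\<^sub>M ?T \<rightarrow>\<^sub>M prob_algebra ?T"
      using s(2) by (simp add: strategiesII_def)
    from measurable_compose[OF measurable_Pair1'[OF h] this] show ?thesis
      by (simp add: N_def[abs_def])
  qed
  have moves: "(\<lambda>(q, t). A q t) \<in> ?T \<Otimes>\<^sub>M ?T \<rightarrow>\<^sub>M prob_algebra ?V"
    "(\<lambda>(q, t). B q t) \<in> ?T \<Otimes>\<^sub>M ?T \<rightarrow>\<^sub>M prob_algebra ?V"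
  proof -
    have *: "(\<lambda>(h, q, t). moveI \<sigma> n h q t) \<in> history_space n \<Otimes>\<^sub>M ?T \<Otimes>\<^sub>M ?T \<rightarrow>\<^sub>M prob_algebra ?V"
      "(\<lambda>(h, q, t). moveII \<tau> n h q t) \<in> history_space n \<Otimes>\<^sub>M ?T \<Otimes>\<^sub>M ?T \<rightarrow>\<^sub>M prob_algebra ?V"
      using s by (auto simp: strategiesI_def strategiesII_def legal_moves_def)
    show "(\<lambda>(q, t). A q t) \<in> ?T \<Otimes>\<^sub>M ?T \<rightarrow>\<^sub>M prob_algebra ?V"
      "(\<lambda>(q, t). B q t) \<in> ?T \<Otimes>\<^sub>M ?T \<rightarrow>\<^sub>M prob_algebra ?V"
      using measurable_compose[OF measurable_Pair1'[OF h] *(1)] measurable_compose[OF measurable_Pair1'[OF h] *(2)]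
      by (simp_all add: A_def B_def split_def)
  qed
  have move: "(\<lambda>((q, t), c). if c then A q t else B q t) \<in> (?T \<Otimes>\<^sub>M ?T) \<Otimes>\<^sub>M ?B \<rightarrow>\<^sub>M prob_algebra ?V"
  proof -
    have branch: "(\<lambda>(x, c). if c then A' x else B' x) \<in> M \<Otimes>\<^sub>M ?B \<rightarrow>\<^sub>M prob_algebra ?V"
      if [measurable]: "A' \<in> M \<rightarrow>\<^sub>M prob_algebra ?V" "B' \<in> M \<rightarrow>\<^sub>M prob_algebra ?V"
      for A' B' and M :: "('t \<times> 't) measure"
      by measurable
    show ?thesis
      using branch[OF moves] unfolding split_def .
  qed
  have ret: "(\<lambda>(((q, t), c), x). return round_space (q, t, c, x)) \<in> ((?T \<Otimes>\<^sub>M ?T) \<Otimes>\<^sub>M ?B) \<Otimes>\<^sub>M ?V \<rightarrow>\<^sub>M prob_algebra round_space"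
    unfolding round_space_def split_def
    by (rule measurable_compose[OF _ measurable_return_prob_space]) measurable
  have coin: "measure_pmf (bernoulli_pmf (1 / 2)) \<in> space (prob_algebra ?B)"
    by (simp add: space_prob_algebra measure_pmf.prob_space_axioms)
  \<comment> \<open>\<open>K4\<close>, \<open>K3\<close> and \<open>K2\<close> are the laws of the
    completed round given the choices up to the toss, up to the new target and up to the opposition
    target.\<close>
  define K4 where "K4 q t c = (if c then A q t else B q t) \<bind> (\<lambda>x. return round_space (q, t, c, x))" for q t c
  have K4: "(\<lambda>((q, t), c). K4 q t c) \<in> (?T \<Otimes>\<^sub>M ?T) \<Otimes>\<^sub>M ?B \<rightarrow>\<^sub>M prob_algebra round_space"
    unfolding K4_def split_def
    by (rule measurable_bind_prob_space2[OF move[unfolded split_def]]) (use ret in \<open>simp add: split_def\<close>)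
  define K3 where "K3 q t = measure_pmf (bernoulli_pmf (1 / 2)) \<bind> K4 q t" for q t
  have K3: "(\<lambda>(q, t). K3 q t) \<in> ?T \<Otimes>\<^sub>M ?T \<rightarrow>\<^sub>M prob_algebra round_space"
    unfolding K3_def split_def
    by (rule measurable_bind_prob_space2[OF measurable_const[OF coin]]) (use K4 in \<open>simp add: split_def\<close>)
  define K2 where "K2 q = N q \<bind> K3 q" for q
  have K2: "K2 \<in> ?T \<rightarrow>\<^sub>M prob_algebra round_space"
    unfolding K2_def[abs_def]
    by (rule measurable_bind_prob_space2[OF N]) (use K3 in \<open>simp add: split_def\<close>)
  have law: "round_law \<sigma> \<tau> n h = Q \<bind> K2"
    unfolding round_law_def K2_def[abs_def] K3_def[abs_def] K4_def[abs_def] Q_def N_def A_def B_def ..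
  have sets_Q: "sets Q = sets ?T" and pQ: "prob_space Q" using Q by (auto simp: space_prob_algebra)
  have N': "sets (N q) = sets ?T" "prob_space (N q)" if "q \<in> mspace T" for q
    using measurable_space[OF N, of q] that by (auto simp: space_prob_algebra)
  have AB': "sets (A q t) = sets ?V" "prob_space (A q t)" "sets (B q t) = sets ?V" "prob_space (B q t)"
    if "q \<in> mspace T" "t \<in> mspace T" for q t
    using measurable_space[OF moves(1), of "(q, t)"] measurable_space[OF moves(2), of "(q, t)"] that
    by (auto simp: space_prob_algebra space_pair_measure)
  have K3q: "K3 q \<in> N q \<rightarrow>\<^sub>M subprob_algebra round_space" if "q \<in> mspace T" for q
    using measurable_prob_algebraD[OF measurable_compose[OF measurable_Pair1'[of q ?T ?T] K3]] that N'(1)[OF that]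
    by (simp cong: measurable_cong_sets)
  have K4q: "K4 q t \<in> ?B \<rightarrow>\<^sub>M subprob_algebra round_space" if "q \<in> mspace T" "t \<in> mspace T" for q t
    using measurable_prob_algebraD[OF measurable_compose[OF measurable_Pair1'[of "(q, t)" "?T \<Otimes>\<^sub>M ?T" ?B] K4]] that
    by (simp add: space_pair_measure)
  have pair: "(\<lambda>x. (q, t, c, x)) \<in> ?V \<rightarrow>\<^sub>M round_space" if "q \<in> mspace T" "t \<in> mspace T" for q t c
    unfolding round_space_def using that by (intro measurable_Pair measurable_const measurable_ident) simp_all
  have retq: "(\<lambda>x. return round_space (q, t, c, x)) \<in> ?V \<rightarrow>\<^sub>M subprob_algebra round_space"
    if "q \<in> mspace T" "t \<in> mspace T" for q t c
    by (rule measurable_compose[OF pair[OF that] return_measurable])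
  have K4_int: "(\<integral>\<^sup>+r. F r \<partial>K4 q t c) = (\<integral>\<^sup>+x. F (q, t, c, x) \<partial>(if c then A q t else B q t))"
    if qt: "q \<in> mspace T" "t \<in> mspace T" for q t c
  proof -
    let ?M = "if c then A q t else B q t"
    have sM: "sets ?M = sets ?V" using AB'[OF qt] by simp
    then have spM: "space ?M = V" using sets_eq_imp_space_eq[OF sM] by simp
    have "(\<lambda>x. return round_space (q, t, c, x)) \<in> ?M \<rightarrow>\<^sub>M subprob_algebra round_space"
      using retq[OF qt] by (subst measurable_cong_sets[OF sM HOL.refl])
    then have "(\<integral>\<^sup>+r. F r \<partial>K4 q t c) = (\<integral>\<^sup>+x. (\<integral>\<^sup>+r. F r \<partial>return round_space (q, t, c, x)) \<partial>?M)"
      unfolding K4_def by (rule nn_integral_bind[OF F])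
    also have "\<dots> = (\<integral>\<^sup>+x. F (q, t, c, x) \<partial>?M)"
      using measurable_space[OF pair[OF qt]] F spM by (intro nn_integral_cong nn_integral_return) auto
    finally show ?thesis .
  qed
  have inner: "c \<le> (\<integral>\<^sup>+r. F r \<partial>K3 q t)"
    if qt: "q \<in> mspace T" "t \<in> mspace T"
      and le: "AE a in A q t. AE b in B q t. 2 * c \<le> F (q, t, True, a) + F (q, t, False, b)" for q t
  proof -
    interpret A: prob_space "A q t" using AB'[OF qt] by simp
    interpret B: prob_space "B q t" using AB'[OF qt] by simp
    have FM: "(\<lambda>x. F (q, t, e, x)) \<in> borel_measurable (A q t)" "(\<lambda>x. F (q, t, e, x)) \<in> borel_measurable (B q t)" for e
      using measurable_compose[OF pair[OF qt] F]
      by (simp_all only: measurable_cong_sets[OF AB'(1)[OF qt] HOL.refl] measurable_cong_sets[OF AB'(3)[OF qt] HOL.refl])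
    let ?b = "\<integral>\<^sup>+b. F (q, t, False, b) \<partial>B q t"
    have 1: "AE a in A q t. 2 * c \<le> F (q, t, True, a) + ?b"
      using le
    proof eventually_elim
      case (elim a)
      have "2 * c = (\<integral>\<^sup>+b. 2 * c \<partial>B q t)" by (simp add: B.emeasure_space_1)
      also have "\<dots> \<le> (\<integral>\<^sup>+b. F (q, t, True, a) + F (q, t, False, b) \<partial>B q t)"
        by (rule nn_integral_mono_AE[OF elim])
      also have "\<dots> = F (q, t, True, a) + ?b"
        using FM(2) by (simp add: nn_integral_add B.emeasure_space_1)
      finally show ?case .
    qed
    have "2 * c = (\<integral>\<^sup>+a. 2 * c \<partial>A q t)" by (simp add: A.emeasure_space_1)
    also have "\<dots> \<le> (\<integral>\<^sup>+a. F (q, t, True, a) + ?b \<partial>A q t)"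
      by (rule nn_integral_mono_AE[OF 1])
    also have "\<dots> = (\<integral>\<^sup>+a. F (q, t, True, a) \<partial>A q t) + ?b"
      using FM(1) by (simp add: nn_integral_add A.emeasure_space_1)
    finally have 2: "2 * c \<le> (\<integral>\<^sup>+a. F (q, t, True, a) \<partial>A q t) + ?b" .
    have half: "ennreal 2 * ennreal (1 / 2) = 1" by (subst ennreal_mult[symmetric]) auto
    have "c = (2 * c) * ennreal (1 / 2)"
      using half by (metis ennreal_numeral mult.commute mult.left_commute mult_1 zero_le_numeral)
    also have "\<dots> \<le> ((\<integral>\<^sup>+a. F (q, t, True, a) \<partial>A q t) + ?b) * ennreal (1 / 2)"
      using 2 by (rule mult_right_mono) simp
    also have "\<dots> = (\<integral>\<^sup>+e. (\<integral>\<^sup>+r. F r \<partial>K4 q t e) \<partial>measure_pmf (bernoulli_pmf (1 / 2)))"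
      by (simp add: K4_int[OF qt] distrib_right)
    also have "\<dots> = (\<integral>\<^sup>+r. F r \<partial>K3 q t)"
      unfolding K3_def using K4q[OF qt] by (intro nn_integral_bind[OF F, symmetric]) simp
    finally show ?thesis .
  qed
  have K3_le: "AE q in Q. c \<le> (\<integral>\<^sup>+r. F r \<partial>K2 q)"
    using le AE_space unfolding Q_def[symmetric]
  proof eventually_elim
    case (elim q)
    then have q: "q \<in> mspace T" using sets_eq_imp_space_eq[OF sets_Q] by simp
    interpret N: prob_space "N q" using N'[OF q] by simp
    have "AE t in N q. c \<le> (\<integral>\<^sup>+r. F r \<partial>K3 q t)"
      using elim(1)[folded N_def A_def B_def] AE_space
    proof eventually_elim
      case (elim t)
      then have "t \<in> mspace T" using sets_eq_imp_space_eq[OF N'(1)[OF q]] by simp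
      then show ?case using elim(1) by (rule inner[OF q])
    qed
    then have "(\<integral>\<^sup>+t. c \<partial>N q) \<le> (\<integral>\<^sup>+t. (\<integral>\<^sup>+r. F r \<partial>K3 q t) \<partial>N q)" by (rule nn_integral_mono_AE)
    also have "\<dots> = (\<integral>\<^sup>+r. F r \<partial>K2 q)"
      unfolding K2_def by (rule nn_integral_bind[OF F K3q[OF q], symmetric])
    finally show ?case by (simp add: N.emeasure_space_1)
  qed
  interpret Q: prob_space Q by fact
  have K2': "K2 \<in> Q \<rightarrow>\<^sub>M subprob_algebra round_space"
    using measurable_prob_algebraD[OF K2] by (subst measurable_cong_sets[OF sets_Q HOL.refl])
  have "(\<integral>\<^sup>+q. c \<partial>Q) \<le> (\<integral>\<^sup>+q. (\<integral>\<^sup>+r. F r \<partial>K2 q) \<partial>Q)" by (rule nn_integral_mono_AE[OF K3_le])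
  also have "\<dots> = (\<integral>\<^sup>+r. F r \<partial>(Q \<bind> K2))"
    by (rule nn_integral_bind[OF F K2', symmetric])
  finally show ?thesis by (simp add: law Q.emeasure_space_1)
qed

text \<open>The law restricted to \<open>n\<close> rounds is the composition \<open>C\<close> of the
  first \<open>n\<close> kernels, and one more round composes it with one more kernel, so the last
  round can be integrated out first. The only history of zero rounds is
  \<open>\<lambda>_. undefined\<close>.\<close>

lemma prob_space_play_law:
  assumes s: "\<sigma> \<in> strategiesI" "\<tau> \<in> strategiesII"
  shows "prob_space (play_law \<sigma> \<tau>)"
    and sets_play_law: "sets (play_law \<sigma> \<tau>) = sets (Pi\<^sub>M UNIV (\<lambda>_. round_space))"
    and nn_integral_play_law: "F \<in> borel_measurable (history_space (Suc n)) \<Longrightarrow>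
      (\<integral>\<^sup>+\<omega>. F (restrict \<omega> {0..<Suc n}) \<partial>play_law \<sigma> \<tau>) =
      (\<integral>\<^sup>+\<omega>. (\<integral>\<^sup>+r. F ((restrict \<omega> {0..<n})(n := r)) \<partial>round_law \<sigma> \<tau> n (restrict \<omega> {0..<n})) \<partial>play_law \<sigma> \<tau>)"
proof -
  interpret IT: Ionescu_Tulcea "round_law \<sigma> \<tau>" "\<lambda>_. round_space"
    by (rule Ionescu_Tulcea_round_law[OF s])
  let ?P = "\<lambda>n :: nat. Pi\<^sub>M {0..<n} (\<lambda>_. round_space)"
  let ?C = "\<lambda>n. IT.C 0 n (\<lambda>_. undefined)"
  have law: "play_law \<sigma> \<tau> = IT.PF.lim" by (simp add: play_law_def)
  have un: "(\<lambda>_. undefined) \<in> space (?P 0)" by (auto simp: space_PiM)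
  have marg: "distr IT.PF.lim (?P n) (\<lambda>\<omega>. restrict \<omega> {0..<n}) = ?C n" for n
  proof -
    have "IT.up_to {0..<n} = n"
    proof (rule antisym)
      show "IT.up_to {0..<n} \<le> n" by (subst IT.up_to_iff) auto
      show "n \<le> IT.up_to {0..<n}" using IT.up_to_less[of "{0..<n}" "n - 1"] by (cases n) auto
    qed
    then have "IT.CI {0..<n} = distr (?C n) (?P n) (\<lambda>f. restrict f {0..<n})" by (simp add: IT.CI_def)
    also have "\<dots> = ?C n" using IT.distr_C[of n n "\<lambda>_. undefined" 0] un by simp
    finally show ?thesis by (simp add: IT.distr_lim)
  qed
  have res: "(\<lambda>\<omega>. restrict \<omega> {0..<n}) \<in> IT.PF.lim \<rightarrow>\<^sub>M ?P n" for n
    by (subst measurable_cong_sets[OF IT.PF.sets_lim HOL.refl]) (rule measurable_restrict_subset, simp)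
  interpret C0: prob_space "?C 0" using un by (intro IT.prob_space_C) simp
  show "prob_space (play_law \<sigma> \<tau>)"
    unfolding law by (rule prob_space_distrD[OF res[of 0]]) (simp only: marg C0.prob_space_axioms)
  show "sets (play_law \<sigma> \<tau>) = sets (Pi\<^sub>M UNIV (\<lambda>_. round_space))" unfolding law by simp
  assume F: "F \<in> borel_measurable (history_space (Suc n))"
  then have F': "F \<in> borel_measurable (?P (Suc n))" by (simp add: history_space_def)
  let ?H = "\<lambda>h. \<integral>\<^sup>+r. F (h(n := r)) \<partial>round_law \<sigma> \<tau> n h"
  have eP: "(\<integral>\<^sup>+x. F x \<partial>IT.eP n h) = ?H h" if "h \<in> space (?P n)" for h
    by (rule IT.nn_integral_eP[OF that F'])
  have H: "?H \<in> borel_measurable (?P n)"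
  proof -
    have "(\<lambda>h. \<integral>\<^sup>+x. F x \<partial>IT.eP n h) \<in> borel_measurable (?P n)"
      by (rule measurable_compose[OF IT.measurable_eP nn_integral_measurable_subprob_algebra[OF F']])
    then show ?thesis using eP by (simp cong: measurable_cong)
  qed
  have spC: "space (?C n) = space (?P n)" and stC: "sets (?C n) = sets (?P n)"
    using IT.space_C[of "\<lambda>_. undefined" 0 n] IT.sets_C[of "\<lambda>_. undefined" 0 n] un by simp_all
  have eP': "IT.eP n \<in> ?C n \<rightarrow>\<^sub>M subprob_algebra (?P (Suc n))"
    using IT.measurable_eP[of n] by (subst measurable_cong_sets[OF stC HOL.refl])
  have "(\<integral>\<^sup>+\<omega>. F (restrict \<omega> {0..<Suc n}) \<partial>IT.PF.lim) = (\<integral>\<^sup>+x. F x \<partial>?C (Suc n))"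
    unfolding marg[symmetric] using F' by (intro nn_integral_distr[OF res, symmetric]) simp
  also have "\<dots> = (\<integral>\<^sup>+x. F x \<partial>(?C n \<bind> IT.eP n))" by simp
  also have "\<dots> = (\<integral>\<^sup>+h. (\<integral>\<^sup>+x. F x \<partial>IT.eP n h) \<partial>?C n)"
    by (rule nn_integral_bind[OF F' eP'])
  also have "\<dots> = (\<integral>\<^sup>+h. ?H h \<partial>?C n)" using eP spC by (intro nn_integral_cong) simp
  also have "\<dots> = (\<integral>\<^sup>+\<omega>. ?H (restrict \<omega> {0..<n}) \<partial>IT.PF.lim)"
    unfolding marg[symmetric] using H by (intro nn_integral_distr[OF res]) simp
  finally show "(\<integral>\<^sup>+\<omega>. F (restrict \<omega> {0..<Suc n}) \<partial>play_law \<sigma> \<tau>) =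
      (\<integral>\<^sup>+\<omega>. ?H (restrict \<omega> {0..<n}) \<partial>play_law \<sigma> \<tau>)" unfolding law .
qed

end

lemma ennreal_plus_le: "ennreal (a + b) \<le> ennreal a + ennreal b"
proof (cases "0 \<le> a \<and> 0 \<le> b")
  case False
  then have "a + b \<le> b \<or> a + b \<le> a" by auto
  then have "ennreal (a + b) \<le> ennreal b \<or> ennreal (a + b) \<le> ennreal a" using ennreal_leI by blast
  then show ?thesis by (auto intro: order_trans add_increasing add_increasing2)
qed simp

text \<open>The sum telescopes until \<open>alive\<close> fails or \<open>N\<close> is reached. The
  index \<open>k\<close> stays unspecified because only bounds on \<open>a\<close> are applied to
  it; the induction nevertheless has to know that it is \<open>N\<close> as long as everything is
  alive.\<close>

lemma stopped_sum:
  fixes a :: "nat \<Rightarrow> real"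
  assumes "m \<le> N" and anti: "\<And>n. alive (Suc n) \<Longrightarrow> alive n"
  shows "\<exists>k\<ge>m. (\<Sum>n\<in>{m..<N}. of_bool (alive n) * (a (Suc n) - a n)) = a k - a m"
proof -
  have mono: "alive k" if "alive n" "k \<le> n" for k n
    using that(2,1) by (induction rule: inc_induct) (auto intro: anti)
  have "(\<exists>k\<ge>m. (\<Sum>n\<in>{m..<N}. of_bool (alive n) * (a (Suc n) - a n)) = a k - a m) \<and>
    ((\<forall>n\<in>{m..<N}. alive n) \<longrightarrow> (\<Sum>n\<in>{m..<N}. of_bool (alive n) * (a (Suc n) - a n)) = a N - a m)"
    using assms(1)
  proof (induction rule: dec_induct)
    case base
    then show ?case by auto
  next
    case (step N)
    show ?case
    proof (cases "alive N")
      case True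
      then have "\<forall>n\<in>{m..<N}. alive n" using mono by auto
      then have *: "(\<Sum>n\<in>{m..<Suc N}. of_bool (alive n) * (a (Suc n) - a n)) = a (Suc N) - a m"
        using step True by simp
      show ?thesis unfolding * using step(1) by (intro conjI exI[of _ "Suc N"]) simp_all
    next
      case False
      then show ?thesis using step by auto
    qed
  qed
  then show ?thesis by blast
qed

section \<open>Measurability of the state of the game\<close>

locale politics_AMLE = tree_AMLE V E Y T f g + politics V E Y T f x0 t0
  for V :: "'v set" and E Y and T :: "'w cpoint metric" and f g x0 t0 +
  assumes start: "x0 \<in> V - Y" "t0 \<in> mspace T"
begin

abbreviation "mb \<equiv> metric_borel T"

lemma finite_V: "finite V"
  using finite_graph by (simp add: finite_graph_def)

lemma measurable_dist_const: "a \<in> mspace T \<Longrightarrow> (\<lambda>p. d p a) \<in> borel_measurable mb"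
proof (subst borel_measurable_iff_less, intro allI)
  fix c assume a: "a \<in> mspace T"
  have "{w \<in> space mb. d w a < c} = T.mball a c"
    using a by (auto simp: T.commute)
  moreover have "openin (mtopology_of T) (T.mball a c)"
    using T.openin_mball by (simp add: mtopology_of_def)
  ultimately show "{w \<in> space mb. d w a < c} \<in> sets mb"
    by (simp add: sets_metric_borel_open)
qed

text \<open>The condition \<open>d p q < c\<close> holds iff \<open>d p z + d q z < c\<close> for
  some \<open>z\<close> in a countable dense set, which exhibits the sublevel sets as countable
  unions.\<close>

lemma measurable_dist: "(\<lambda>w. d (fst w) (snd w)) \<in> borel_measurable (mb \<Otimes>\<^sub>M mb)"
proof (subst borel_measurable_iff_less, intro allI)
  fix c
  obtain Z where Z: "countable Z" "Z \<subseteq> mspace T" "\<forall>p\<in>mspace T. \<forall>\<epsilon>>0. \<exists>z\<in>Z. d p z < \<epsilon>"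
    using metric_tree_separable[OF tree] by blast
  have "{w \<in> space (mb \<Otimes>\<^sub>M mb). d (fst w) (snd w) < c} =
      (\<Union>z\<in>Z. {w \<in> space (mb \<Otimes>\<^sub>M mb). d (fst w) z + d (snd w) z < c})"
  proof (intro set_eqI iffI)
    fix w assume "w \<in> {w \<in> space (mb \<Otimes>\<^sub>M mb). d (fst w) (snd w) < c}"
    then have w: "w \<in> space (mb \<Otimes>\<^sub>M mb)" "fst w \<in> mspace T" "snd w \<in> mspace T" "0 < (c - d (fst w) (snd w)) / 2"
      by (auto simp: space_pair_measure)
    then obtain z where z: "z \<in> Z" "d (fst w) z < (c - d (fst w) (snd w)) / 2" using Z(3) by blast
    have "d (snd w) z \<le> d (snd w) (fst w) + d (fst w) z"
      using w z Z by (intro T.triangle) auto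
    then have "d (fst w) z + d (snd w) z < c" using z by (simp add: T.commute field_simps)
    then show "w \<in> (\<Union>z\<in>Z. {w \<in> space (mb \<Otimes>\<^sub>M mb). d (fst w) z + d (snd w) z < c})"
      using w z by blast
  next
    fix w assume "w \<in> (\<Union>z\<in>Z. {w \<in> space (mb \<Otimes>\<^sub>M mb). d (fst w) z + d (snd w) z < c})"
    then obtain z where z: "z \<in> Z" "w \<in> space (mb \<Otimes>\<^sub>M mb)" "d (fst w) z + d (snd w) z < c" by blast
    then have "d (fst w) (snd w) \<le> d (fst w) z + d z (snd w)"
      using Z(2) by (intro T.triangle) (auto simp: space_pair_measure)
    then show "w \<in> {w \<in> space (mb \<Otimes>\<^sub>M mb). d (fst w) (snd w) < c}"
      using z by (simp add: T.commute)
  qed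
  also have "\<dots> \<in> sets (mb \<Otimes>\<^sub>M mb)"
  proof (intro sets.countable_UN'' Z(1))
    fix z assume "z \<in> Z"
    then have m: "(\<lambda>p. d p z) \<in> borel_measurable mb" using Z by (intro measurable_dist_const) auto
    have "(\<lambda>w. d (fst w) z + d (snd w) z) \<in> borel_measurable (mb \<Otimes>\<^sub>M mb)"
      by (intro borel_measurable_add measurable_compose[OF measurable_fst m] measurable_compose[OF measurable_snd m])
    then show "{w \<in> space (mb \<Otimes>\<^sub>M mb). d (fst w) z + d (snd w) z < c} \<in> sets (mb \<Otimes>\<^sub>M mb)"
      by (subst (asm) borel_measurable_iff_less) blast
  qed
  finally show "{w \<in> space (mb \<Otimes>\<^sub>M mb). d (fst w) (snd w) < c} \<in> sets (mb \<Otimes>\<^sub>M mb)" .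
qed

lemma measurable_dist2:
  assumes "F \<in> N \<rightarrow>\<^sub>M mb" "H \<in> N \<rightarrow>\<^sub>M mb"
  shows "(\<lambda>w. d (F w) (H w)) \<in> borel_measurable N"
  using measurable_compose[OF measurable_Pair[OF assms] measurable_dist] by simp

text \<open>The position takes finitely many values, so joint measurability reduces to one condition
  for each vertex.\<close>

lemma measurable_vertex_case:
  assumes "W \<in> N \<rightarrow>\<^sub>M count_space V" "\<And>x. x \<in> V \<Longrightarrow> F x \<in> N \<rightarrow>\<^sub>M K"
  shows "(\<lambda>w. F (W w) w) \<in> N \<rightarrow>\<^sub>M K"
  using assms(2,1) countable_finite[OF finite_V] by (rule measurable_compose_countable')

lemma round_components:
  "(\<lambda>r. fst r) \<in> round_space \<rightarrow>\<^sub>M mb"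
  "(\<lambda>r. fst (snd r)) \<in> round_space \<rightarrow>\<^sub>M mb"
  "(\<lambda>r. snd (snd (snd r))) \<in> round_space \<rightarrow>\<^sub>M count_space V"
  unfolding round_space_def by measurable

lemma position_measurable: "{0..<k} \<subseteq> I \<Longrightarrow> position k \<in> Pi\<^sub>M I (\<lambda>_. round_space) \<rightarrow>\<^sub>M count_space V"
proof (cases k)
  case 0
  then have "position k = (\<lambda>_. x0)" by auto
  then show ?thesis using start by simp
next
  case (Suc j)
  assume "{0..<k} \<subseteq> I"
  then have "j \<in> I" using Suc by auto
  have "position k = (\<lambda>h. snd (snd (snd (h j))))" using Suc by (auto split: prod.splits)
  then show ?thesis
    using measurable_compose[OF measurable_component_singleton[OF \<open>j \<in> I\<close>] round_components(3)] by simp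
qed

lemma target_measurable: "{0..<k} \<subseteq> I \<Longrightarrow> target k \<in> Pi\<^sub>M I (\<lambda>_. round_space) \<rightarrow>\<^sub>M mb"
proof (cases k)
  case 0
  then have "target k = (\<lambda>_. t0)" by auto
  then show ?thesis using start by simp
next
  case (Suc j)
  assume "{0..<k} \<subseteq> I"
  then have "j \<in> I" using Suc by auto
  have "target k = (\<lambda>h. fst (snd (h j)))" using Suc by (auto split: prod.splits)
  then show ?thesis
    using measurable_compose[OF measurable_component_singleton[OF \<open>j \<in> I\<close>] round_components(2)] by simp
qed

lemma state_in:
  assumes "h \<in> space (history_space n)"
  shows "position n h \<in> V" "target n h \<in> mspace T"
  using measurable_space[OF position_measurable[of n "{0..<n}"], of h]
    measurable_space[OF target_measurable[of n "{0..<n}"], of h] assms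
  by (auto simp: history_space_def)

text \<open>It depends on the first \<open>n\<close> rounds only and says that the round stored in
  entry \<open>n\<close> is still played. The range starts at 1 because the end of the game is
  tested after a round.\<close>

definition alive :: "nat \<Rightarrow> ('v, 'w cpoint) history \<Rightarrow> bool" where
  "alive n h \<longleftrightarrow> (\<forall>k\<in>{1..n}. position k h \<notin> Y)"

lemma alive_Suc: "alive (Suc n) h \<Longrightarrow> alive n h"
  by (simp add: alive_def)

lemma alive_position:
  assumes "alive n h" "h \<in> space (history_space n)"
  shows "position n h \<in> V - Y"
proof -
  have "position n h \<notin> Y"
  proof (cases "n = 0")
    case False
    then have "n \<in> {1..n}" by simp
    then show ?thesis using assms(1) unfolding alive_def by blast
  qed (use start in auto)
  then show ?thesis using state_in[OF assms(2)] by simp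
qed

lemma in_Y_measurable:
  "{0..<k} \<subseteq> I \<Longrightarrow> Measurable.pred (Pi\<^sub>M I (\<lambda>_. round_space)) (\<lambda>h. position k h \<in> Y)"
  by (rule measurable_compose[OF position_measurable]) auto

lemma alive_measurable:
  assumes "{0..<n} \<subseteq> I"
  shows "Measurable.pred (Pi\<^sub>M I (\<lambda>_. round_space)) (alive n)"
  unfolding alive_def[abs_def]
  by (intro pred_intros_finite pred_intros_logic in_Y_measurable) (use assms in auto)

lemma position_restrict: "{0..<k} \<subseteq> I \<Longrightarrow> position k (restrict h I) = position k h"
  and target_restrict: "{0..<k} \<subseteq> I \<Longrightarrow> target k (restrict h I) = target k h"
  by (cases k; auto)+

lemma alive_restrict:
  assumes "{0..<n} \<subseteq> I"
  shows "alive n (restrict h I) = alive n h"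
proof -
  have "position k (restrict h I) = position k h" if "k \<in> {1..n}" for k
    using assms that by (intro position_restrict) auto
  then show ?thesis unfolding alive_def by simp
qed

lemma position_upd: "k \<le> n \<Longrightarrow> position k (h(n := r)) = position k h"
  and target_upd: "k \<le> n \<Longrightarrow> target k (h(n := r)) = target k h"
  by (cases k; auto)+

lemma alive_upd: "alive n (h(n := r)) = alive n h"
  unfolding alive_def by (intro ball_cong) (auto simp: position_upd)

lemma functional_measurable:
  assumes \<phi>: "\<And>x. x \<in> V \<Longrightarrow> (\<lambda>w. \<phi> x (fst w) (snd w)) \<in> borel_measurable (mb \<Otimes>\<^sub>M round_space)"
    and I: "{0..<Suc n} \<subseteq> I"
  shows "(\<lambda>h. \<phi> (position n h) (target n h) (h n)) \<in> borel_measurable (Pi\<^sub>M I (\<lambda>_. round_space))"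
proof (rule measurable_vertex_case[OF position_measurable])
  fix x assume "x \<in> V"
  have "n \<in> I" and I': "{0..<n} \<subseteq> I" using I by auto
  from measurable_compose[OF measurable_Pair[OF target_measurable[OF I'] measurable_component_singleton[OF \<open>n \<in> I\<close>]] \<phi>[OF \<open>x \<in> V\<close>]]
  show "(\<lambda>h. \<phi> x (target n h) (h n)) \<in> borel_measurable (Pi\<^sub>M I (\<lambda>_. round_space))" by simp
qed (use I in auto)

text \<open>
  The change of the running payoff plus \<open>d (u x) t\<close> in a round that starts at position \<open>x\<close> with target \<open>t\<close>.
\<close>

definition gain :: "'v \<Rightarrow> 'w cpoint \<Rightarrow> ('v, 'w cpoint) round \<Rightarrow> real" where
  "gain x t r = d (fst r) t - d (fst r) (fst (snd r)) + d (u (snd (snd (snd r)))) (fst (snd r)) - d (u x) t"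

lemma gain_measurable:
  assumes "x \<in> V"
  shows "(\<lambda>w. gain x (fst w) (snd w)) \<in> borel_measurable (mb \<Otimes>\<^sub>M round_space)"
proof -
  let ?N = "mb \<Otimes>\<^sub>M round_space"
  have t: "fst \<in> ?N \<rightarrow>\<^sub>M mb" by (rule measurable_fst)
  note c = measurable_compose[OF measurable_snd round_components(1), of mb]
    measurable_compose[OF measurable_snd round_components(2), of mb]
    measurable_compose[OF measurable_snd round_components(3), of mb]
  have 1: "(\<lambda>w. d (u y) (F w)) \<in> borel_measurable ?N" if "y \<in> V" "F \<in> ?N \<rightarrow>\<^sub>M mb" for y F
    using measurable_dist2[OF measurable_const[of "u y"] that(2)] u_in[OF that(1)] by simp
  have 2: "(\<lambda>w. d (u (snd (snd (snd (snd w))))) (fst (snd (snd w)))) \<in> borel_measurable ?N"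
    using measurable_vertex_case[OF c(3), of "\<lambda>y w. d (u y) (fst (snd (snd w)))"] 1 c(2) by simp
  show ?thesis
    unfolding gain_def
    by (intro borel_measurable_diff borel_measurable_add measurable_dist2 c t 1 2 assms)
qed

lemma round_in:
  assumes "r \<in> space round_space"
  shows "fst r \<in> mspace T" "fst (snd r) \<in> mspace T" "snd (snd (snd r)) \<in> V"
  using assms by (auto simp: round_space_def space_pair_measure)

lemma gain_bound:
  assumes D: "\<And>p q. p \<in> mspace T \<Longrightarrow> q \<in> mspace T \<Longrightarrow> d p q \<le> D"
    and "x \<in> V" "t \<in> mspace T" "r \<in> space round_space"
  shows "\<bar>gain x t r\<bar> \<le> 2 * D"
proof -
  note r = round_in[OF assms(4)]
  have "\<bar>d (fst r) t - d (fst r) (fst (snd r))\<bar> \<le> D"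
    using D[OF r(1) assms(3)] D[OF r(1,2)] T.nonneg[of "fst r" t] T.nonneg[of "fst r" "fst (snd r)"] by linarith
  moreover have "\<bar>d (u (snd (snd (snd r)))) (fst (snd r)) - d (u x) t\<bar> \<le> D"
    using D[OF u_in[OF r(3)] r(2)] D[OF u_in[OF assms(2)] assms(3)]
      T.nonneg[of "u x" t] T.nonneg[of "u (snd (snd (snd r)))" "fst (snd r)"] by linarith
  ultimately show ?thesis unfolding gain_def by linarith
qed

lemma terminates_iff: "terminates h \<longleftrightarrow> (\<exists>n. \<not> alive n h)"
  unfolding terminates_def alive_def by force

text \<open>The gains telescope: \<open>u\<close> agrees with \<open>f\<close> on \<open>Y\<close>,
  so the final payment is the last value of \<open>d (u x) t\<close>. Cutting off by
  \<open>alive\<close> turns a sum of random length into a series.\<close>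

lemma payoff_eq:
  "payoff h = (if terminates h then d (u x0) t0 +
    (\<Sum>n. of_bool (alive n h) * gain (position n h) (target n h) (h n)) else 0)"
proof (cases "terminates h")
  case True
  define K where "K = last_round h"
  have K: "1 \<le> K" "position K h \<in> Y"
    using True LeastI_ex[of "\<lambda>k. 1 \<le> k \<and> position k h \<in> Y"]
    by (auto simp: K_def last_round_def terminates_def)
  have Kmin: "position k h \<notin> Y" if "1 \<le> k" "k < K" for k
    using not_less_Least[of k "\<lambda>k. 1 \<le> k \<and> position k h \<in> Y"] that
    by (auto simp: K_def last_round_def)
  have alive: "alive n h \<longleftrightarrow> n < K" for n
    using K Kmin unfolding alive_def by (metis atLeastAtMost_iff le_less_trans not_le)
  define m where "m k = d (u (position k h)) (target k h)" for k
  have gain: "gain (position n h) (target n h) (h n) =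
      (d (opposition n h) (target n h) - d (opposition n h) (target (Suc n) h)) + (m (Suc n) - m n)" for n
    by (auto simp: gain_def opposition_def m_def split: prod.splits)
  have "(\<Sum>n. of_bool (alive n h) * gain (position n h) (target n h) (h n)) =
      (\<Sum>n<K. of_bool (alive n h) * gain (position n h) (target n h) (h n))"
    by (rule suminf_finite) (auto simp: alive)
  also have "\<dots> = (\<Sum>n<K. gain (position n h) (target n h) (h n))"
    by (intro sum.cong) (auto simp: alive)
  also have "\<dots> = (\<Sum>n<K. d (opposition n h) (target n h) - d (opposition n h) (target (Suc n) h)) + (m K - m 0)"
    unfolding gain sum.distrib by (simp add: sum_lessThan_telescope)
  finally show ?thesis
    using True K u_boundary by (simp add: payoff_def K_def[symmetric] m_def)
qed (simp add: payoff_def)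

end

section \<open>Expectations for a fixed pair of strategies\<close>

locale politics_play = politics_AMLE V E Y T f g x0 t0
  for V :: "'v set" and E Y and T :: "'w cpoint metric" and f g x0 t0 +
  fixes \<sigma> :: "('v, 'w cpoint) strategyI" and \<tau> :: "('v, 'w cpoint) strategyII"
  assumes strategies: "\<sigma> \<in> strategiesI" "\<tau> \<in> strategiesII"
begin

abbreviation "law \<equiv> play_law \<sigma> \<tau>"

sublocale prob_space law
  using strategies by (rule prob_space_play_law)

lemma sets_law: "sets law = sets (Pi\<^sub>M UNIV (\<lambda>_. round_space))"
  using strategies by (rule sets_play_law)

lemma space_law: "space law = space (Pi\<^sub>M UNIV (\<lambda>_. round_space))"
  using sets_law by (rule sets_eq_imp_space_eq)

lemma measurable_law: "F \<in> Pi\<^sub>M UNIV (\<lambda>_. round_space) \<rightarrow>\<^sub>M N \<Longrightarrow> F \<in> law \<rightarrow>\<^sub>M N"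
  by (subst measurable_cong_sets[OF sets_law HOL.refl])

lemma restrict_law: "\<omega> \<in> space law \<Longrightarrow> restrict \<omega> {0..<n} \<in> space (history_space n)"
  by (auto simp: space_law history_space_def space_PiM)

lemma alive_event [measurable]: "Measurable.pred law (alive n)"
  by (rule measurable_law[OF alive_measurable]) simp

definition functional :: "('v \<Rightarrow> 'w cpoint \<Rightarrow> ('v, 'w cpoint) round \<Rightarrow> real) \<Rightarrow> nat \<Rightarrow>
    ('v, 'w cpoint) history \<Rightarrow> real" where
  "functional \<phi> n \<omega> = of_bool (alive n \<omega>) * \<phi> (position n \<omega>) (target n \<omega>) (\<omega> n)"

text \<open>The bound by the survival probability, and not merely by \<open>B\<close>, is what later
  makes the sum over all rounds converge.\<close>

lemma functional_integrable:
  assumes \<phi>: "\<And>x. x \<in> V \<Longrightarrow> (\<lambda>w. \<phi> x (fst w) (snd w)) \<in> borel_measurable (mb \<Otimes>\<^sub>M round_space)"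
    and B: "\<And>x t r. x \<in> V \<Longrightarrow> t \<in> mspace T \<Longrightarrow> r \<in> space round_space \<Longrightarrow> \<bar>\<phi> x t r\<bar> \<le> B"
  shows "functional \<phi> n \<in> borel_measurable law"
    and "\<And>\<omega>. \<omega> \<in> space law \<Longrightarrow> \<bar>functional \<phi> n \<omega>\<bar> \<le> B * of_bool (alive n \<omega>)"
    and "integrable law (functional \<phi> n)"
    and "(\<integral>\<omega>. \<bar>functional \<phi> n \<omega>\<bar> \<partial>law) \<le> B * prob {\<omega> \<in> space law. alive n \<omega>}"
proof -
  have [measurable]: "(\<lambda>\<omega>. \<phi> (position n \<omega>) (target n \<omega>) (\<omega> n)) \<in> borel_measurable law"
    by (rule measurable_law[OF functional_measurable[OF \<phi>]]) auto
  show [measurable]: "functional \<phi> n \<in> borel_measurable law"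
    unfolding functional_def[abs_def] by measurable
  show bound: "\<bar>functional \<phi> n \<omega>\<bar> \<le> B * of_bool (alive n \<omega>)" if "\<omega> \<in> space law" for \<omega>
  proof -
    have "position n \<omega> \<in> V" "target n \<omega> \<in> mspace T"
      using state_in[OF restrict_law[OF that, of n]] by (simp_all add: position_restrict target_restrict)
    moreover have "\<omega> n \<in> space round_space"
      using that by (auto simp: space_law space_PiM)
    ultimately show ?thesis using B by (simp add: functional_def)
  qed
  have int: "integrable law (\<lambda>\<omega>. B * of_bool (alive n \<omega>))"
    by (rule integrable_const_bound[where B = "\<bar>B\<bar>"]) (auto simp: abs_mult)
  show "integrable law (functional \<phi> n)"
  proof (rule Bochner_Integration.integrable_bound[OF int _ AE_I2])
    show "norm (functional \<phi> n \<omega>) \<le> norm (B * of_bool (alive n \<omega>))" if "\<omega> \<in> space law" for \<omega>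
      unfolding real_norm_def by (rule order_trans[OF bound[OF that] abs_ge_self])
  qed measurable
  then have "(\<integral>\<omega>. \<bar>functional \<phi> n \<omega>\<bar> \<partial>law) \<le> (\<integral>\<omega>. B * of_bool (alive n \<omega>) \<partial>law)"
    using int bound by (intro integral_mono) auto
  also have "\<dots> = (\<integral>\<omega>. B * indicator {\<omega> \<in> space law. alive n \<omega>} \<omega> \<partial>law)"
    by (intro Bochner_Integration.integral_cong) (auto simp: indicator_def)
  also have "\<dots> = B * prob {\<omega> \<in> space law. alive n \<omega>}" by simp
  finally show "(\<integral>\<omega>. \<bar>functional \<phi> n \<omega>\<bar> \<partial>law) \<le> B * prob {\<omega> \<in> space law. alive n \<omega>}" .
qed

text \<open>The one-round estimate concerns nonnegative integrals, so \<open>B\<close> is added to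
  \<open>\<phi>\<close> before integration and removed afterwards. Plays that have already ended
  contribute 0.\<close>

lemma drift:
  assumes \<phi>: "\<And>x. x \<in> V \<Longrightarrow> (\<lambda>w. \<phi> x (fst w) (snd w)) \<in> borel_measurable (mb \<Otimes>\<^sub>M round_space)"
    and B: "\<And>x t r. x \<in> V \<Longrightarrow> t \<in> mspace T \<Longrightarrow> r \<in> space round_space \<Longrightarrow> \<bar>\<phi> x t r\<bar> \<le> B"
    and "0 \<le> c" "0 \<le> B"
    and step: "\<And>h. h \<in> space (history_space n) \<Longrightarrow> alive n h \<Longrightarrow>
      AE q in opposeI \<sigma> n h. AE t in targetII \<tau> n h q. AE a in moveI \<sigma> n h q t. AE b in moveII \<tau> n h q t.
        2 * c \<le> \<phi> (position n h) (target n h) (q, t, True, a) + \<phi> (position n h) (target n h) (q, t, False, b)"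
  shows "c * prob {\<omega> \<in> space law. alive n \<omega>} \<le> (\<integral>\<omega>. functional \<phi> n \<omega> \<partial>law)"
proof -
  let ?al = "{\<omega> \<in> space law. alive n \<omega>}"
  note int = functional_integrable[of \<phi> B, OF \<phi> B]
  define F where "F h = ennreal (of_bool (alive n h) * (\<phi> (position n h) (target n h) (h n) + B))" for h
  have F: "F \<in> borel_measurable (history_space (Suc n))"
    unfolding F_def history_space_def
    by (intro measurable_compose[OF _ measurable_ennreal] borel_measurable_times borel_measurable_add
        functional_measurable[OF \<phi>] borel_measurable_const measurable_compose[OF alive_measurable]) auto
  have F_res: "F (restrict \<omega> {0..<Suc n}) = F \<omega>" for \<omega>
    by (simp add: F_def position_restrict target_restrict alive_restrict)
  have inner: "of_bool (alive n \<omega>) * ennreal (c + B) \<le>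
      (\<integral>\<^sup>+r. F ((restrict \<omega> {0..<n})(n := r)) \<partial>round_law \<sigma> \<tau> n (restrict \<omega> {0..<n}))"
    if \<omega>: "\<omega> \<in> space law" for \<omega>
  proof (cases "alive n \<omega>")
    case True
    define h where "h = restrict \<omega> {0..<n}"
    have h: "h \<in> space (history_space n)" "alive n h"
      using restrict_law[OF \<omega>, of n] True by (auto simp: h_def alive_restrict)
    have Fh: "F (h(n := r)) = ennreal (\<phi> (position n h) (target n h) r + B)" for r
      using h(2) by (simp add: F_def alive_upd position_upd target_upd)
    have "ennreal (c + B) \<le> (\<integral>\<^sup>+r. F (h(n := r)) \<partial>round_law \<sigma> \<tau> n h)"
      unfolding Fh
    proof (rule round_law_ge[OF strategies h(1)])
      have "(\<lambda>r. \<phi> (position n h) (target n h) r) \<in> borel_measurable round_space"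
        using measurable_compose[OF measurable_Pair1'[of "target n h" mb round_space] \<phi>] state_in[OF h(1)] by simp
      then show "(\<lambda>r. ennreal (\<phi> (position n h) (target n h) r + B)) \<in> borel_measurable round_space"
        by measurable
      let ?\<phi> = "\<lambda>q t e a. \<phi> (position n h) (target n h) (q, t, e, a)"
      have "2 * ennreal (c + B) \<le> ennreal (?\<phi> q t True a + B) + ennreal (?\<phi> q t False b + B)"
        if "2 * c \<le> ?\<phi> q t True a + ?\<phi> q t False b" for q t a b
      proof -
        have "2 * ennreal (c + B) = ennreal (2 * (c + B))"
          using assms(3,4) by (simp add: ennreal_mult)
        also have "\<dots> \<le> ennreal ((?\<phi> q t True a + B) + (?\<phi> q t False b + B))"
          using that by (intro ennreal_leI) simp
        also have "\<dots> \<le> ennreal (?\<phi> q t True a + B) + ennreal (?\<phi> q t False b + B)"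
          by (rule ennreal_plus_le)
        finally show ?thesis .
      qed
      then show "AE q in opposeI \<sigma> n h. AE t in targetII \<tau> n h q. AE a in moveI \<sigma> n h q t. AE b in moveII \<tau> n h q t.
          2 * ennreal (c + B) \<le> ennreal (?\<phi> q t True a + B) + ennreal (?\<phi> q t False b + B)"
        using step[OF h] by (elim eventually_mono) blast
    qed
    then show ?thesis using True by (simp add: h_def)
  qed simp
  have "(\<integral>\<^sup>+\<omega>. of_bool (alive n \<omega>) * ennreal (c + B) \<partial>law) \<le> (\<integral>\<^sup>+\<omega>. F \<omega> \<partial>law)"
  proof -
    have "(\<integral>\<^sup>+\<omega>. F \<omega> \<partial>law) = (\<integral>\<^sup>+\<omega>. F (restrict \<omega> {0..<Suc n}) \<partial>law)" by (simp add: F_res)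
    also have "\<dots> = (\<integral>\<^sup>+\<omega>. (\<integral>\<^sup>+r. F ((restrict \<omega> {0..<n})(n := r)) \<partial>round_law \<sigma> \<tau> n (restrict \<omega> {0..<n})) \<partial>law)"
      by (rule nn_integral_play_law[OF strategies F])
    finally show ?thesis using inner by (simp only:) (rule nn_integral_mono)
  qed
  also have "(\<integral>\<^sup>+\<omega>. F \<omega> \<partial>law) = (\<integral>\<^sup>+\<omega>. ennreal (functional \<phi> n \<omega> + B * indicator ?al \<omega>) \<partial>law)"
    by (intro nn_integral_cong) (auto simp: F_def functional_def distrib_left)
  also have "\<dots> = ennreal (\<integral>\<omega>. functional \<phi> n \<omega> + B * indicator ?al \<omega> \<partial>law)"
  proof (rule nn_integral_eq_integral)
    show "integrable law (\<lambda>\<omega>. functional \<phi> n \<omega> + B * indicator ?al \<omega>)"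
      using int(3) by (intro Bochner_Integration.integrable_add integrable_mult_right integrable_real_indicator) (auto simp: less_top[symmetric])
    show "AE \<omega> in law. 0 \<le> functional \<phi> n \<omega> + B * indicator ?al \<omega>"
      using int(2)[where n=n] by (intro AE_I2) (fastforce simp: indicator_def abs_le_iff)
  qed
  also have "(\<integral>\<omega>. functional \<phi> n \<omega> + B * indicator ?al \<omega> \<partial>law) = (\<integral>\<omega>. functional \<phi> n \<omega> \<partial>law) + B * prob ?al"
    using int(3) by (subst Bochner_Integration.integral_add) (auto simp: less_top[symmetric])
  also have "(\<integral>\<^sup>+\<omega>. of_bool (alive n \<omega>) * ennreal (c + B) \<partial>law) = ennreal ((c + B) * prob ?al)"
  proof -
    have "(\<integral>\<^sup>+\<omega>. of_bool (alive n \<omega>) * ennreal (c + B) \<partial>law) = (\<integral>\<^sup>+\<omega>. ennreal (c + B) * indicator ?al \<omega> \<partial>law)"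
      by (intro nn_integral_cong) (auto simp: indicator_def)
    also have "\<dots> = ennreal (c + B) * ennreal (prob ?al)"
      by (subst nn_integral_cmult_indicator) (auto simp: emeasure_eq_measure)
    finally show ?thesis using assms(3,4) by (simp add: ennreal_mult)
  qed
  finally have le: "ennreal ((c + B) * prob ?al) \<le> ennreal ((\<integral>\<omega>. functional \<phi> n \<omega> \<partial>law) + B * prob ?al)" .
  \<comment> \<open>Nonnegativity of the right side is needed to leave \<open>ennreal\<close>, where
    a negative number would be truncated to 0.\<close>
  have "- (B * prob ?al) \<le> (\<integral>\<omega>. functional \<phi> n \<omega> \<partial>law)"
    using int(4)[where n=n] integral_abs_bound[of law "functional \<phi> n"] by linarith
  then have "(c + B) * prob ?al \<le> (\<integral>\<omega>. functional \<phi> n \<omega> \<partial>law) + B * prob ?al"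
    using le by (subst (asm) ennreal_le_iff) auto
  then show ?thesis by (simp add: distrib_right)
qed

end

lemma (in politics_AMLE) vertex_functional_measurable:
  fixes a :: "'v \<Rightarrow> real"
  shows "(\<lambda>w. a (snd (snd (snd (snd w)))) - b) \<in> borel_measurable (mb \<Otimes>\<^sub>M round_space)"
proof -
  have "a \<in> borel_measurable (count_space V)" by simp
  from measurable_compose[OF measurable_compose[OF measurable_snd round_components(3), of mb] this]
  show ?thesis by (rule borel_measurable_diff[OF _ borel_measurable_const])
qed

context politics_play
begin

lemma position_Suc: "position (Suc n) \<omega> = snd (snd (snd (\<omega> n)))"
  by (auto split: prod.splits)

lemma position_in: "\<omega> \<in> space law \<Longrightarrow> position n \<omega> \<in> V"
  using state_in(1)[OF restrict_law, of \<omega> n] by (simp add: position_restrict)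

text \<open>
  The potential \<open>\<psi>\<close> makes the duration of the game integrable, so that the payoff is the limit of its
  truncations; the bounded potentials \<open>G n\<close> turn these into submartingales up to \<open>\<epsilon>\<close>.
\<close>

lemma payoff_bound:
  fixes G :: "nat \<Rightarrow> 'v \<Rightarrow> real" and \<kappa> :: real
  assumes adm: "\<And>n h. h \<in> space (history_space n) \<Longrightarrow>
      AE q in opposeI \<sigma> n h. AE t in targetII \<tau> n h q. AE a in moveI \<sigma> n h q t. AE b in moveII \<tau> n h q t.
        adm n (position n h) q t a b"
    and \<kappa>: "\<kappa> = 1 \<or> \<kappa> = -1"
    and \<psi>: "\<And>x. x \<in> V \<Longrightarrow> 0 \<le> \<psi> x \<and> \<psi> x \<le> (\<Psi> :: real)"
    and \<psi>_drift: "\<And>n x q t a b. n0 \<le> n \<Longrightarrow> x \<in> V - Y \<Longrightarrow> adm n x q t a b \<Longrightarrow> 2 * \<psi> x + 2 \<le> \<psi> a + \<psi> b"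
    and G: "\<And>n x. x \<in> V \<Longrightarrow> \<bar>G n x\<bar> \<le> B" "\<And>n x. x \<in> V \<Longrightarrow> G n x \<le> \<epsilon>" "0 \<le> G 0 x0"
    and G_drift: "\<And>n x t' q t a b. x \<in> V - Y \<Longrightarrow> t' \<in> mspace T \<Longrightarrow> adm n x q t a b \<Longrightarrow>
      2 * G n x \<le> \<kappa> * gain x t' (q, t, True, a) + \<kappa> * gain x t' (q, t, False, b) + G (Suc n) a + G (Suc n) b"
  shows "AE \<omega> in law. terminates \<omega>" and "integrable law payoff"
    and "- \<epsilon> \<le> \<kappa> * ((\<integral>\<omega>. payoff \<omega> \<partial>law) - d (u x0) t0)"
proof -
  let ?al = "\<lambda>n. {\<omega> \<in> space law. alive n \<omega>}"
  obtain D where D: "0 < D" "\<And>p q. p \<in> mspace T \<Longrightarrow> q \<in> mspace T \<Longrightarrow> d p q \<le> D"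
    using tree_bound by blast
  have V0: "x0 \<in> V" using start by simp
  have "0 \<le> \<Psi>" "0 \<le> B" using \<psi>[OF V0] G(1)[OF V0, of 0] by linarith+
  define P\<psi> where "P\<psi> x t r = \<psi> (snd (snd (snd r))) - \<psi> x" for x and t :: "'w cpoint" and r :: "('v, 'w cpoint) round"
  have m\<psi>: "(\<lambda>w. P\<psi> x (fst w) (snd w)) \<in> borel_measurable (mb \<Otimes>\<^sub>M round_space)" for x
    unfolding P\<psi>_def by (rule vertex_functional_measurable)
  have b\<psi>: "\<bar>P\<psi> x t r\<bar> \<le> \<Psi>" if "x \<in> V" "t \<in> mspace T" "r \<in> space round_space" for x t r
    using \<psi>[OF that(1)] \<psi>[OF round_in(3)[OF that(3)]] by (auto simp: P\<psi>_def abs_le_iff)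
  note I\<psi> = functional_integrable[of P\<psi> \<Psi>, OF m\<psi> b\<psi>]
  have prob_le: "prob (?al n) \<le> (\<integral>\<omega>. functional P\<psi> n \<omega> \<partial>law)" if "n0 \<le> n" for n
  proof -
    have "1 * prob (?al n) \<le> (\<integral>\<omega>. functional P\<psi> n \<omega> \<partial>law)"
    proof (rule drift[OF m\<psi> b\<psi> _ \<open>0 \<le> \<Psi>\<close>])
      fix h assume h: "h \<in> space (history_space n)" "alive n h"
      have "2 * 1 \<le> P\<psi> (position n h) (target n h) (q, t, True, a) + P\<psi> (position n h) (target n h) (q, t, False, b)"
        if "adm n (position n h) q t a b" for q t a b
        using \<psi>_drift[OF \<open>n0 \<le> n\<close> alive_position[OF h(2,1)] that] by (simp add: P\<psi>_def)
      then show "AE q in opposeI \<sigma> n h. AE t in targetII \<tau> n h q. AE a in moveI \<sigma> n h q t. AE b in moveII \<tau> n h q t.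
          2 * 1 \<le> P\<psi> (position n h) (target n h) (q, t, True, a) + P\<psi> (position n h) (target n h) (q, t, False, b)"
        using adm[OF h(1)] by (elim eventually_mono) blast
    qed simp_all
    then show ?thesis by simp
  qed
  \<comment> \<open>While the game lasts, each round from \<open>n0\<close> on raises
    \<open>\<psi>\<close> by at least one on average, and the total rise is at most
    \<open>\<Psi>\<close>. So the expected number of these rounds is at most
    \<open>\<Psi>\<close>.\<close>
  have sum_le: "(\<Sum>n\<in>{n0..<N}. prob (?al n)) \<le> \<Psi>" if N: "n0 \<le> N" for N
  proof -
    have "(\<Sum>n\<in>{n0..<N}. prob (?al n)) \<le> (\<Sum>n\<in>{n0..<N}. \<integral>\<omega>. functional P\<psi> n \<omega> \<partial>law)"
      using prob_le by (intro sum_mono) auto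
    also have "\<dots> = (\<integral>\<omega>. (\<Sum>n\<in>{n0..<N}. functional P\<psi> n \<omega>) \<partial>law)"
      using I\<psi>(3) by (intro Bochner_Integration.integral_sum[symmetric])
    also have "\<dots> \<le> (\<integral>\<omega>. \<Psi> \<partial>law)"
    proof (intro integral_mono)
      show "integrable law (\<lambda>\<omega>. \<Sum>n\<in>{n0..<N}. functional P\<psi> n \<omega>)"
        using I\<psi>(3) by (intro Bochner_Integration.integrable_sum)
      fix \<omega> assume \<omega>: "\<omega> \<in> space law"
      obtain k where "(\<Sum>n\<in>{n0..<N}. of_bool (alive n \<omega>) * (\<psi> (position (Suc n) \<omega>) - \<psi> (position n \<omega>))) =
          \<psi> (position k \<omega>) - \<psi> (position n0 \<omega>)"
        using stopped_sum[where alive = "\<lambda>n. alive n \<omega>" and a = "\<lambda>n. \<psi> (position n \<omega>)", OF N alive_Suc] by blast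
      moreover have "functional P\<psi> n \<omega> = of_bool (alive n \<omega>) * (\<psi> (position (Suc n) \<omega>) - \<psi> (position n \<omega>))" for n
        by (simp only: functional_def P\<psi>_def position_Suc)
      ultimately show "(\<Sum>n\<in>{n0..<N}. functional P\<psi> n \<omega>) \<le> \<Psi>"
        using \<psi>[OF position_in[OF \<omega>, of k]] \<psi>[OF position_in[OF \<omega>, of n0]] by simp
    qed simp
    finally show ?thesis by (simp add: prob_space)
  qed
  have "summable (\<lambda>n. prob (?al (n + n0)))"
  proof (rule summableI_nonneg_bounded[of _ \<Psi>])
    show "(\<Sum>n<N. prob (?al (n + n0))) \<le> \<Psi>" for N
      using sum_le[of "N + n0"] sum.shift_bounds_nat_ivl[of "\<lambda>n. prob (?al n)" 0 n0 N]
      by (simp add: atLeast0LessThan)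
  qed simp
  then have sumP: "summable (\<lambda>n. prob (?al n))" by (subst (asm) summable_iff_shift)
  have term_pred: "Measurable.pred law terminates"
    unfolding terminates_iff[abs_def] by measurable
  have "prob {\<omega> \<in> space law. \<not> terminates \<omega>} \<le> 0"
  proof (rule LIMSEQ_le_const[OF summable_LIMSEQ_zero[OF sumP]])
    have "prob {\<omega> \<in> space law. \<not> terminates \<omega>} \<le> prob (?al n)" for n
      by (intro finite_measure_mono) (auto simp: terminates_iff)
    then show "\<exists>N. \<forall>n\<ge>N. prob {\<omega> \<in> space law. \<not> terminates \<omega>} \<le> prob (?al n)" by blast
  qed
  then have "prob {\<omega> \<in> space law. \<not> terminates \<omega>} = 0" using measure_nonneg by (intro antisym) auto
  then show AEt: "AE \<omega> in law. terminates \<omega>"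
    using term_pred by (intro AE_I[of _ _ "{\<omega> \<in> space law. \<not> terminates \<omega>}"]) (auto simp: emeasure_eq_measure)
  note Ig = functional_integrable[of gain "2 * D", OF gain_measurable gain_bound[OF D(2)]]
  let ?S = "\<lambda>\<omega>. \<Sum>n. functional gain n \<omega>"
  have AEs: "AE \<omega> in law. summable (\<lambda>n. norm (functional gain n \<omega>))"
    using AEt
  proof eventually_elim
    case (elim \<omega>)
    then obtain m where m: "\<not> alive m \<omega>" by (auto simp: terminates_iff)
    have "\<not> alive n \<omega>" if "m \<le> n" for n
      using m that unfolding alive_def by auto
    then have "norm (functional gain n \<omega>) = 0" if "n \<notin> {..<m}" for n
      using that by (simp add: functional_def)
    then show ?case by (intro summable_finite[of "{..<m}"]) auto
  qed
  \<comment> \<open>Gains are bounded by \<open>2 * D\<close> while the game lasts, so the summable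
    survival probabilities dominate; this permits exchanging expectation and series.\<close>
  have sumn: "summable (\<lambda>n. \<integral>\<omega>. norm (functional gain n \<omega>) \<partial>law)"
  proof (rule summable_comparison_test'[of "\<lambda>n. 2 * D * prob (?al n)" 0])
    show "summable (\<lambda>n. 2 * D * prob (?al n))" using sumP by (rule summable_mult)
    show "norm (\<integral>\<omega>. norm (functional gain n \<omega>) \<partial>law) \<le> 2 * D * prob (?al n)" for n
      using Ig(4)[where n=n] by (simp add: integral_nonneg_AE)
  qed
  have intS: "integrable law ?S" by (rule integrable_suminf[OF Ig(3) AEs sumn])
  have sums: "(\<lambda>n. \<integral>\<omega>. functional gain n \<omega> \<partial>law) sums (\<integral>\<omega>. ?S \<omega> \<partial>law)"
    by (rule sums_integral[OF Ig(3) AEs sumn])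
  have payoff: "payoff = (\<lambda>\<omega>. if terminates \<omega> then d (u x0) t0 + ?S \<omega> else 0)"
    by (simp add: fun_eq_iff payoff_eq functional_def)
  have payoff_meas: "payoff \<in> borel_measurable law"
    unfolding payoff using Ig(1) term_pred by measurable
  have AEp: "AE \<omega> in law. payoff \<omega> = d (u x0) t0 + ?S \<omega>"
    using AEt by eventually_elim (simp add: payoff)
  have intP: "integrable law (\<lambda>\<omega>. d (u x0) t0 + ?S \<omega>)" using intS by simp
  show "integrable law payoff"
    using intP payoff_meas AEp by (subst integrable_cong_AE[of _ _ "\<lambda>\<omega>. d (u x0) t0 + ?S \<omega>"]) auto
  have "(\<integral>\<omega>. payoff \<omega> \<partial>law) = (\<integral>\<omega>. d (u x0) t0 + ?S \<omega> \<partial>law)"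
    using AEp payoff_meas intP by (intro integral_cong_AE) auto
  also have "\<dots> = d (u x0) t0 + (\<integral>\<omega>. ?S \<omega> \<partial>law)"
    using intS by (simp add: prob_space)
  finally have excess: "(\<integral>\<omega>. payoff \<omega> \<partial>law) - d (u x0) t0 = (\<integral>\<omega>. ?S \<omega> \<partial>law)" by simp
  define PG where "PG n x t r = G (Suc n) (snd (snd (snd r))) - G n x"
    for n x and t :: "'w cpoint" and r :: "('v, 'w cpoint) round"
  have mG: "(\<lambda>w. PG n x (fst w) (snd w)) \<in> borel_measurable (mb \<Otimes>\<^sub>M round_space)" for n x
    unfolding PG_def by (rule vertex_functional_measurable)
  have bG: "\<bar>PG n x t r\<bar> \<le> 2 * B" if "x \<in> V" "t \<in> mspace T" "r \<in> space round_space" for n x t r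
    using G(1)[OF that(1), of n] G(1)[OF round_in(3)[OF that(3)], of "Suc n"] by (auto simp: PG_def abs_le_iff)
  have IG: "integrable law (functional (PG n) n)" for n
    by (rule functional_integrable(3)[of "PG n" "2 * B", OF mG bG])
  \<comment> \<open>The sign \<open>\<kappa>\<close> is 1 when Player I follows the good strategy
    and -1 when Player II does. It is the signed gain together with the potential that has
    nonnegative drift.\<close>
  have step: "0 \<le> \<kappa> * (\<integral>\<omega>. functional gain n \<omega> \<partial>law) + (\<integral>\<omega>. functional (PG n) n \<omega> \<partial>law)" for n
  proof -
    define \<phi> where "\<phi> x t r = \<kappa> * gain x t r + PG n x t r" for x t r
    have m: "(\<lambda>w. \<phi> x (fst w) (snd w)) \<in> borel_measurable (mb \<Otimes>\<^sub>M round_space)" if "x \<in> V" for x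
      unfolding \<phi>_def using gain_measurable[OF that] mG
      by (intro borel_measurable_add borel_measurable_times borel_measurable_const)
    have b: "\<bar>\<phi> x t r\<bar> \<le> 2 * D + 2 * B" if "x \<in> V" "t \<in> mspace T" "r \<in> space round_space" for x t r
    proof -
      have "\<bar>\<kappa> * gain x t r\<bar> \<le> 2 * D" using gain_bound[OF D(2) that] \<kappa> by auto
      then show ?thesis using bG[OF that, of n] unfolding \<phi>_def by linarith
    qed
    have "0 * prob (?al n) \<le> (\<integral>\<omega>. functional \<phi> n \<omega> \<partial>law)"
    proof (rule drift[OF m b])
      fix h assume h: "h \<in> space (history_space n)" "alive n h"
      have "2 * 0 \<le> \<phi> (position n h) (target n h) (q, t, True, a) + \<phi> (position n h) (target n h) (q, t, False, b)"
        if "adm n (position n h) q t a b" for q t a b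
        using G_drift[OF alive_position[OF h(2,1)] state_in(2)[OF h(1)] that] by (simp add: \<phi>_def PG_def)
      then show "AE q in opposeI \<sigma> n h. AE t in targetII \<tau> n h q. AE a in moveI \<sigma> n h q t. AE b in moveII \<tau> n h q t.
          2 * 0 \<le> \<phi> (position n h) (target n h) (q, t, True, a) + \<phi> (position n h) (target n h) (q, t, False, b)"
        using adm[OF h(1)] by (elim eventually_mono) blast
    qed (use D \<open>0 \<le> B\<close> in simp_all)
    also have "functional \<phi> n = (\<lambda>\<omega>. \<kappa> * functional gain n \<omega> + functional (PG n) n \<omega>)"
      by (simp add: fun_eq_iff functional_def \<phi>_def distrib_left)
    also have "(\<integral>\<omega>. \<kappa> * functional gain n \<omega> + functional (PG n) n \<omega> \<partial>law) =
        \<kappa> * (\<integral>\<omega>. functional gain n \<omega> \<partial>law) + (\<integral>\<omega>. functional (PG n) n \<omega> \<partial>law)"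
      using Ig(3) IG by (subst Bochner_Integration.integral_add) auto
    finally show ?thesis by simp
  qed
  \<comment> \<open>Stopped at the end of the game, the increments telescope to a value of at most
    \<open>\<epsilon>\<close> minus a nonnegative initial value.\<close>
  have sumG: "(\<Sum>n<N. \<integral>\<omega>. functional (PG n) n \<omega> \<partial>law) \<le> \<epsilon>" for N
  proof -
    have "(\<Sum>n<N. \<integral>\<omega>. functional (PG n) n \<omega> \<partial>law) = (\<integral>\<omega>. (\<Sum>n<N. functional (PG n) n \<omega>) \<partial>law)"
      using IG by (intro Bochner_Integration.integral_sum[symmetric])
    also have "\<dots> \<le> (\<integral>\<omega>. \<epsilon> \<partial>law)"
    proof (intro integral_mono)
      show "integrable law (\<lambda>\<omega>. \<Sum>n<N. functional (PG n) n \<omega>)"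
        using IG by (intro Bochner_Integration.integrable_sum)
      fix \<omega> assume \<omega>: "\<omega> \<in> space law"
      obtain k where "(\<Sum>n\<in>{0..<N}. of_bool (alive n \<omega>) * (G (Suc n) (position (Suc n) \<omega>) - G n (position n \<omega>))) =
          G k (position k \<omega>) - G 0 (position 0 \<omega>)"
        using stopped_sum[where alive = "\<lambda>n. alive n \<omega>" and a = "\<lambda>n. G n (position n \<omega>)", OF le0 alive_Suc] by blast
      moreover have "functional (PG n) n \<omega> = of_bool (alive n \<omega>) * (G (Suc n) (position (Suc n) \<omega>) - G n (position n \<omega>))" for n
        by (simp only: functional_def PG_def position_Suc)
      ultimately show "(\<Sum>n<N. functional (PG n) n \<omega>) \<le> \<epsilon>"
        using G(2)[OF position_in[OF \<omega>, of k], of k] G(3) by (simp add: atLeast0LessThan)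
    qed simp
    finally show ?thesis by (simp add: prob_space)
  qed
  have "- \<epsilon> \<le> \<kappa> * (\<integral>\<omega>. ?S \<omega> \<partial>law)"
  proof (rule LIMSEQ_le_const)
    show "(\<lambda>N. \<Sum>n<N. \<kappa> * (\<integral>\<omega>. functional gain n \<omega> \<partial>law)) \<longlonglongrightarrow> \<kappa> * (\<integral>\<omega>. ?S \<omega> \<partial>law)"
      using sums_mult[OF sums, of \<kappa>] by (simp add: sums_def)
    have "- \<epsilon> \<le> (\<Sum>n<N. \<kappa> * (\<integral>\<omega>. functional gain n \<omega> \<partial>law))" for N
    proof -
      have "0 \<le> (\<Sum>n<N. \<kappa> * (\<integral>\<omega>. functional gain n \<omega> \<partial>law) + (\<integral>\<omega>. functional (PG n) n \<omega> \<partial>law))"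
        by (rule sum_nonneg) (rule step)
      then show ?thesis using sumG[of N] by (simp add: sum.distrib)
    qed
    then show "\<exists>N0. \<forall>N\<ge>N0. - \<epsilon> \<le> (\<Sum>n<N. \<kappa> * (\<integral>\<omega>. functional gain n \<omega> \<partial>law))" by blast
  qed
  then show "- \<epsilon> \<le> \<kappa> * ((\<integral>\<omega>. payoff \<omega> \<partial>law) - d (u x0) t0)" by (simp only: excess)
qed

end

section \<open>Near-optimal strategies\<close>

context politics_AMLE
begin

text \<open>Play formally continues after \<open>Y\<close> is reached, so a legal move has to exist
  at every vertex. There are at least two vertices, \<open>x0\<close> and one of \<open>Y\<close>,
  so connectedness provides it.\<close>

lemma has_neighbour:
  assumes "x \<in> V"
  shows "\<exists>w. {x, w} \<in> E"
proof -
  obtain y where "y \<in> Y" using boundary by blast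
  then obtain z where "z \<in> V" "z \<noteq> x" using start boundary by blast
  then have "(x, z) \<in> {(a, b). {a, b} \<in> E}\<^sup>*"
    using connected_graph assms unfolding connected_graph_def by blast
  then show ?thesis
    using \<open>z \<noteq> x\<close> by (cases rule: converse_rtranclE) auto
qed

lemma AE_return_tree: "p \<in> mspace T \<Longrightarrow> AE q in return mb p. q = p"
proof -
  assume p: "p \<in> mspace T"
  have "Measurable.pred mb (\<lambda>q. d q p = 0)"
    using measurable_dist_const[OF p] by measurable
  then have "AE q in return mb p. d q p = 0"
    using p by (subst AE_return) auto
  moreover have "AE q in return mb p. q \<in> mspace T"
    using AE_space[of "return mb p"] by simp
  ultimately show ?thesis
    by eventually_elim (use p in auto)
qed

lemma AE_return_vertex: "v \<in> V \<Longrightarrow> AE x in return (count_space V) v. x = v"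
  by (subst AE_return) auto

lemma measurable_u: "X' \<in> N \<rightarrow>\<^sub>M count_space V \<Longrightarrow> (\<lambda>w. u (X' w)) \<in> N \<rightarrow>\<^sub>M mb"
  by (rule measurable_compose) (auto intro: u_in)

text \<open>
  Both players use the same pure moves: away from the point \<open>p\<close>, which is the new target for
  Player I and the opposition target for Player II, during the first \<open>n0\<close> rounds, and towards \<open>Y\<close> afterwards.
\<close>

definition far :: "('v \<Rightarrow> 'v) \<Rightarrow> ('v \<Rightarrow> 'v) \<Rightarrow> 'v \<Rightarrow> 'w cpoint \<Rightarrow> 'v" where
  "far y z x p = (if d p (u (z x)) \<le> d p (u (y x)) then y x else z x)"

definition pure_move :: "('v \<Rightarrow> 'v) \<Rightarrow> ('v \<Rightarrow> 'v) \<Rightarrow> ('v \<Rightarrow> 'v) \<Rightarrow> nat \<Rightarrow> nat \<Rightarrow> 'v \<Rightarrow> 'w cpoint \<Rightarrow> 'v" where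
  "pure_move y z m n0 n x p =
     (if x \<in> V - Y then if n < n0 then far y z x p else m x else (SOME w. {x, w} \<in> E))"

definition pure_I :: "(nat \<Rightarrow> 'v \<Rightarrow> 'w cpoint \<Rightarrow> 'v) \<Rightarrow> ('v, 'w cpoint) strategyI" where
  "pure_I mv = \<lparr>opposeI = \<lambda>n h. return mb (u (position n h)),
     moveI = \<lambda>n h q t. return (count_space V) (mv n (position n h) t)\<rparr>"

text \<open>The target uses \<open>mv 0\<close>, the choice of the first phase, even while the moves
  walk to \<open>Y\<close>. During the first phase \<open>mv 0\<close> and \<open>mv n\<close>
  coincide, so the target is the image of the intended move.\<close>

definition pure_II :: "(nat \<Rightarrow> 'v \<Rightarrow> 'w cpoint \<Rightarrow> 'v) \<Rightarrow> ('v, 'w cpoint) strategyII" where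
  "pure_II mv = \<lparr>targetII = \<lambda>n h q. return mb (u (mv 0 (position n h) q)),
     moveII = \<lambda>n h q t. return (count_space V) (mv n (position n h) q)\<rparr>"

lemma pure_simps:
  "opposeI (pure_I mv) n h = return mb (u (position n h))"
  "moveI (pure_I mv) n h q t = return (count_space V) (mv n (position n h) t)"
  "targetII (pure_II mv) n h q = return mb (u (mv 0 (position n h) q))"
  "moveII (pure_II mv) n h q t = return (count_space V) (mv n (position n h) q)"
  by (simp_all add: pure_I_def pure_II_def)

lemma pure_strategies:
  assumes adj: "\<And>n x p. x \<in> V \<Longrightarrow> {x, mv n x p} \<in> E"
    and meas: "\<And>n x. x \<in> V \<Longrightarrow> mv n x \<in> mb \<rightarrow>\<^sub>M count_space V"
  shows "pure_I mv \<in> strategiesI" "pure_II mv \<in> strategiesII"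
proof -
  have pos: "position n \<in> history_space n \<rightarrow>\<^sub>M count_space V" for n
    unfolding history_space_def by (rule position_measurable) simp
  have mv_meas: "(\<lambda>w. mv k (position n (H w)) (F w)) \<in> N \<rightarrow>\<^sub>M count_space V"
    if "H \<in> N \<rightarrow>\<^sub>M history_space n" "F \<in> N \<rightarrow>\<^sub>M mb"
    for k n and N :: "'a measure" and H F
    using measurable_vertex_case[OF measurable_compose[OF that(1) pos], of "\<lambda>x w. mv k x (F w)"]
      measurable_compose[OF that(2) meas] by simp
  have legal: "AE x in return (count_space V) (mv k (position n h) p). {position n h, x} \<in> E"
    if "h \<in> space (history_space n)" for k n h p
    using AE_return_vertex[OF edge_in_V[OF adj[OF state_in(1)[OF that]]]]
    by eventually_elim (use adj[OF state_in(1)[OF that]] in simp)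
  have "(\<lambda>h. return mb (u (position n h))) \<in> history_space n \<rightarrow>\<^sub>M prob_algebra mb" for n
    by (rule measurable_compose[OF measurable_u[OF pos] measurable_return_prob_space])
  moreover have "(\<lambda>(h, q, t). return (count_space V) (mv n (position n h) t)) \<in>
      history_space n \<Otimes>\<^sub>M mb \<Otimes>\<^sub>M mb \<rightarrow>\<^sub>M prob_algebra (count_space V)" for n
    unfolding split_def
    by (rule measurable_compose[OF mv_meas measurable_return_prob_space]) measurable
  ultimately show "pure_I mv \<in> strategiesI"
    using legal unfolding strategiesI_def legal_moves_def mem_Collect_eq pure_simps[abs_def] by blast
  have "(\<lambda>(h, q). return mb (u (mv 0 (position n h) q))) \<in> history_space n \<Otimes>\<^sub>M mb \<rightarrow>\<^sub>M prob_algebra mb" for n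
    unfolding split_def
    by (rule measurable_compose[OF measurable_u[OF mv_meas] measurable_return_prob_space]) measurable
  moreover have "(\<lambda>(h, q, t). return (count_space V) (mv n (position n h) q)) \<in>
      history_space n \<Otimes>\<^sub>M mb \<Otimes>\<^sub>M mb \<rightarrow>\<^sub>M prob_algebra (count_space V)" for n
    unfolding split_def
    by (rule measurable_compose[OF mv_meas measurable_return_prob_space]) measurable
  ultimately show "pure_II mv \<in> strategiesII"
    using legal unfolding strategiesII_def legal_moves_def mem_Collect_eq pure_simps[abs_def] by blast
qed

lemma legal_AE:
  assumes "h \<in> space (history_space n)" "q \<in> mspace T" "t \<in> mspace T"
  shows "\<sigma> \<in> strategiesI \<Longrightarrow> AE x in moveI \<sigma> n h q t. {position n h, x} \<in> E"
    and "\<tau> \<in> strategiesII \<Longrightarrow> AE x in moveII \<tau> n h q t. {position n h, x} \<in> E"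
  using assms by (auto simp: strategiesI_def strategiesII_def legal_moves_def)

lemma oppose_AE:
  assumes "\<sigma> \<in> strategiesI" "h \<in> space (history_space n)"
  shows "AE q in opposeI \<sigma> n h. q \<in> mspace T"
proof -
  have "opposeI \<sigma> n \<in> history_space n \<rightarrow>\<^sub>M prob_algebra mb"
    using assms(1) by (simp add: strategiesI_def)
  from measurable_space[OF this assms(2)] have "opposeI \<sigma> n h \<in> space (prob_algebra mb)" .
  then have "space (opposeI \<sigma> n h) = mspace T"
    using sets_eq_imp_space_eq[of "opposeI \<sigma> n h" mb] by (simp add: space_prob_algebra)
  then show ?thesis using AE_space[of "opposeI \<sigma> n h"] by simp
qed

lemma target_AE:
  assumes "\<tau> \<in> strategiesII" "h \<in> space (history_space n)" "q \<in> mspace T"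
  shows "AE t in targetII \<tau> n h q. t \<in> mspace T"
proof -
  have "(\<lambda>(h, q). targetII \<tau> n h q) \<in> history_space n \<Otimes>\<^sub>M mb \<rightarrow>\<^sub>M prob_algebra mb"
    using assms(1) by (simp add: strategiesII_def)
  from measurable_space[OF this, of "(h, q)"] have "targetII \<tau> n h q \<in> space (prob_algebra mb)"
    using assms by (simp add: space_pair_measure)
  then have "space (targetII \<tau> n h q) = mspace T"
    using sets_eq_imp_space_eq[of "targetII \<tau> n h q" mb] by (simp add: space_prob_algebra)
  then show ?thesis using AE_space[of "targetII \<tau> n h q"] by simp
qed

text \<open>Two opposite directions cannot both lead back towards \<open>p\<close>: the four-point
  condition bounds \<open>d p (u x) + 2 * R\<close> by \<open>R\<close> plus the larger of the
  distances from \<open>p\<close> to the two ends.\<close>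

lemma far_distance:
  assumes p: "p \<in> mspace T" and x: "x \<in> V" and E: "{x, y x} \<in> E" "{x, z x} \<in> E"
    and R: "d (u x) (u (y x)) = R" "d (u x) (u (z x)) = R" "d (u (y x)) (u (z x)) = 2 * R"
  shows "d p (u x) + R \<le> d p (u (far y z x p))"
proof -
  have in_T: "u x \<in> mspace T" "u (y x) \<in> mspace T" "u (z x) \<in> mspace T"
    using x E edge_in_V u_in by auto
  show ?thesis
    using four_point[OF p in_T] R by (auto simp: far_def T.commute max_def split: if_splits)
qed

lemma near_optimal_strategies:
  assumes "0 < \<epsilon>"
  shows "\<exists>\<sigma>\<in>strategiesI. \<forall>\<tau>\<in>strategiesII. d (u x0) t0 - \<epsilon> \<le> expected_payoff C \<sigma> \<tau>"
    and "\<exists>\<tau>\<in>strategiesII. \<forall>\<sigma>\<in>strategiesI. expected_payoff C \<sigma> \<tau> \<le> d (u x0) t0 + \<epsilon>"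
proof -
  have "V - Y \<noteq> {}" using start by blast
  from drift_potential[OF this assms] obtain G c y z
    where c: "0 < c" and G: "\<forall>x\<in>V. 0 \<le> G x \<and> G x \<le> \<epsilon>"
    and yz: "\<forall>x\<in>V - Y. {x, y x} \<in> E \<and> {x, z x} \<in> E \<and> d (u x) (u (y x)) = slope x \<and>
      d (u x) (u (z x)) = slope x \<and> d (u (y x)) (u (z x)) = 2 * slope x \<and>
      (\<forall>w a s. {x, w} \<in> E \<longrightarrow> a \<in> {y x, z x} \<longrightarrow> 0 \<le> s \<longrightarrow> 2 * slope x - s \<le> d (u a) (u w) \<longrightarrow>
        2 * G x + 2 * c - s \<le> G a + G w)"
    by (elim exE conjE)
  from vertex_potential[OF boundary] obtain \<psi> \<Psi> m
    where \<psi>: "\<forall>x\<in>V. 0 \<le> \<psi> x \<and> \<psi> x \<le> (\<Psi> :: real)"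
    and m: "\<forall>x\<in>V - Y. {x, m x} \<in> E \<and> (\<forall>w. {x, w} \<in> E \<longrightarrow> 2 * \<psi> x + 2 \<le> \<psi> (m x) + \<psi> w)"
    by (elim exE conjE)
  obtain D where D: "0 < D" "\<And>p q. p \<in> mspace T \<Longrightarrow> q \<in> mspace T \<Longrightarrow> d p q \<le> D"
    using tree_bound by blast
  have "x0 \<in> V" using start by simp
  then have "0 \<le> \<Psi>" using \<psi> by force
  \<comment> \<open>The walk to \<open>Y\<close> lasts at most \<open>\<Psi>\<close> rounds on
    average, each with a gain of at most \<open>2 * D\<close> in absolute value. This cost, and the
    bound \<open>\<epsilon>\<close> on \<open>G\<close>, must be exceeded by the drift of the first
    phase.\<close>
  obtain n0 where n0: "\<epsilon> + 2 * D * \<Psi> < real n0 * c"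
    using reals_Archimedean3[OF c] by blast
  have "0 \<le> D * \<Psi>" using D \<open>0 \<le> \<Psi>\<close> by simp
  have "0 < n0" using n0 assms \<open>0 \<le> D * \<Psi>\<close> by (cases n0) auto
  \<comment> \<open>The strategies of both players share these moves. In the time-dependent
    potential \<open>Gt\<close>, the drift of the first phase is spent on a decrease by
    \<open>c\<close> per round. The second phase begins with
    \<open>2 * D * (\<psi> x - \<Psi>)\<close>, which is at least \<open>- 2 * D * \<Psi>\<close>
    and by the choice of \<open>n0\<close> not below \<open>G x - c * real n0\<close>, so the switch
    does no harm.\<close>
  define mv where "mv = pure_move y z m n0"
  define Gt where "Gt n x = (if n < n0 then G x - c * real n else 2 * D * (\<psi> x - \<Psi>))" for n x
  have yzx: "{x, y x} \<in> E" "{x, z x} \<in> E" "d (u x) (u (y x)) = slope x"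
      "d (u x) (u (z x)) = slope x" "d (u (y x)) (u (z x)) = 2 * slope x" if "x \<in> V - Y" for x
    using yz that by blast+
  have pot: "2 * G x + 2 * c - s \<le> G (far y z x p) + G w"
    if "x \<in> V - Y" "{x, w} \<in> E" "0 \<le> s" "2 * slope x - s \<le> d (u (far y z x p)) (u w)" for x p w s
  proof -
    have "far y z x p \<in> {y x, z x}" by (simp add: far_def)
    then show ?thesis using yz that by blast
  qed
  have far_slope: "d (u x) (u (far y z x p)) = slope x" if "x \<in> V - Y" for x p
    using yzx[OF that] by (simp add: far_def)
  have far_ge: "d p (u x) + slope x \<le> d p (u (far y z x p))" if "x \<in> V - Y" "p \<in> mspace T" for x p
    using that yzx[OF that(1)] by (intro far_distance) auto
  have adj: "{x, mv n x p} \<in> E" if "x \<in> V" for n x p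
  proof (cases "x \<in> Y")
    case True
    then show ?thesis using someI_ex[OF has_neighbour[OF that]] by (simp add: mv_def pure_move_def)
  next
    case False
    then show ?thesis using yzx[of x] m that by (simp add: mv_def pure_move_def far_def)
  qed
  have meas: "mv n x \<in> mb \<rightarrow>\<^sub>M count_space V" if x: "x \<in> V" for n x
  proof (cases "x \<in> V - Y \<and> n < n0")
    case True
    then have V: "y x \<in> V" "z x \<in> V" using yzx[of x] edge_in_V by auto
    have "(\<lambda>p. d p (u v)) \<in> borel_measurable mb" if "v \<in> V" for v
      using that by (intro measurable_dist_const u_in)
    note le = borel_measurable_le[OF this[OF V(2)] this[OF V(1)]]
    have "(\<lambda>p. if d p (u (z x)) \<le> d p (u (y x)) then y x else z x) \<in> mb \<rightarrow>\<^sub>M count_space V"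
      using V by (intro measurable_If le measurable_const) simp_all
    then show ?thesis using True by (simp add: mv_def pure_move_def[abs_def] far_def[abs_def])
  next
    case False
    then have "mv n x = (\<lambda>p. mv n x t0)" by (auto simp: mv_def pure_move_def)
    then show ?thesis using edge_in_V[OF adj[OF x, of n t0]] by (metis measurable_const space_count_space)
  qed
  note pure = pure_strategies[of mv, OF adj meas]
  have V: "x \<in> V" if "{w, x} \<in> E" for w x using that by (rule edge_in_V)
  have Gt_bound: "\<bar>Gt n x\<bar> \<le> \<epsilon> + c * real n0 + 2 * D * \<Psi>" "Gt n x \<le> \<epsilon>" if "x \<in> V" for n x
  proof -
    have 1: "0 \<le> G x" "G x \<le> \<epsilon>" "0 \<le> \<psi> x" "\<psi> x \<le> \<Psi>" using G \<psi> that by auto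
    have 2: "0 \<le> c * real n" "n < n0 \<Longrightarrow> c * real n \<le> c * real n0" using c by auto
    have 3: "0 \<le> 2 * D * \<psi> x" "2 * D * \<psi> x \<le> 2 * D * \<Psi>" using 1 D by auto
    have 4: "2 * D * (\<psi> x - \<Psi>) = 2 * D * \<psi> x - 2 * D * \<Psi>" by (simp add: right_diff_distrib)
    have 5: "0 \<le> c * real n0" using c by simp
    show "\<bar>Gt n x\<bar> \<le> \<epsilon> + c * real n0 + 2 * D * \<Psi>" "Gt n x \<le> \<epsilon>"
      unfolding Gt_def 4 using 1 2 3 5 assms by (cases "n < n0"; simp add: abs_le_iff)+
  qed
  have Gt0: "0 \<le> Gt 0 x0" using \<open>0 < n0\<close> G \<open>x0 \<in> V\<close> by (simp add: Gt_def)
  have Gt_drift: "2 * Gt n x \<le> \<kappa> * gain x t' (q, t, True, a) + \<kappa> * gain x t' (q, t, False, b) + Gt (Suc n) a + Gt (Suc n) b"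
    if \<kappa>: "\<kappa> = 1 \<or> \<kappa> = -1" and x: "x \<in> V - Y" and in_T: "t' \<in> mspace T" "q \<in> mspace T" "t \<in> mspace T" and ab: "a \<in> V" "b \<in> V"
      and early: "n < n0 \<Longrightarrow> 2 * G x + 2 * c \<le> \<kappa> * gain x t' (q, t, True, a) + \<kappa> * gain x t' (q, t, False, b) + G a + G b"
      and late: "n0 \<le> n \<Longrightarrow> 2 * \<psi> x + 2 \<le> \<psi> a + \<psi> b"
    for \<kappa> n x t' q t a b
  proof (cases "n < n0")
    case True
    have "G w - c * real (Suc n) \<le> Gt (Suc n) w" if "w \<in> V" for w
    proof (cases "Suc n < n0")
      case False
      then have "Suc n = n0" using True by simp
      moreover have "0 \<le> 2 * D * \<psi> w" using D \<psi> that by simp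
      moreover have "2 * D * (\<psi> w - \<Psi>) = 2 * D * \<psi> w - 2 * D * \<Psi>" by (simp add: right_diff_distrib)
      moreover have "G w \<le> \<epsilon>" using G that by blast
      ultimately show ?thesis using n0 by (simp add: Gt_def mult.commute[of c])
    qed (simp add: Gt_def)
    from this[OF ab(1)] this[OF ab(2)] show ?thesis
      using early[OF True] True by (simp add: Gt_def algebra_simps)
  next
    case False
    have "r \<in> space round_space" if "r = (q, t, e, w)" "w \<in> V" for r e w
      using that in_T by (simp add: round_space_def space_pair_measure)
    then have "\<bar>gain x t' (q, t, True, a)\<bar> \<le> 2 * D" "\<bar>gain x t' (q, t, False, b)\<bar> \<le> 2 * D"
      using gain_bound[OF D(2), of x t'] x in_T ab by auto
    then have 1: "- (4 * D) \<le> \<kappa> * gain x t' (q, t, True, a) + \<kappa> * gain x t' (q, t, False, b)"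
      using \<kappa> by (auto simp: abs_le_iff)
    \<comment> \<open>The gains of the two outcomes together lose at most \<open>4 * D\<close>,
      which is exactly the drift guaranteed for \<open>2 * D * \<psi>\<close>.\<close>
    have "2 * D * (2 * \<psi> x + 2) \<le> 2 * D * (\<psi> a + \<psi> b)"
      using late False D by (intro mult_left_mono) auto
    then have "2 * (2 * D * (\<psi> x - \<Psi>)) + 4 * D \<le> 2 * D * (\<psi> a - \<Psi>) + 2 * D * (\<psi> b - \<Psi>)"
      by (simp add: algebra_simps)
    then show ?thesis using 1 False by (simp add: Gt_def)
  qed
  have \<psi>': "0 \<le> \<psi> x \<and> \<psi> x \<le> \<Psi>" if "x \<in> V" for x using \<psi> that by blast
  show "\<exists>\<sigma>\<in>strategiesI. \<forall>\<tau>\<in>strategiesII. d (u x0) t0 - \<epsilon> \<le> expected_payoff C \<sigma> \<tau>"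
  proof (intro bexI[of _ "pure_I mv"] ballI)
    show "pure_I mv \<in> strategiesI" by (rule pure(1))
    fix \<tau> assume \<tau>: "\<tau> \<in> strategiesII"
    interpret politics_play V E Y T f g x0 t0 "pure_I mv" \<tau>
      using pure(1) \<tau> by unfold_locales
    define adm where "adm n x q t a b \<longleftrightarrow> q = u x \<and> t \<in> mspace T \<and> a = mv n x t \<and> {x, b} \<in> E" for n x q t a b
    have AE_adm: "AE q in opposeI (pure_I mv) n h. AE t in targetII \<tau> n h q. AE a in moveI (pure_I mv) n h q t.
        AE b in moveII \<tau> n h q t. adm n (position n h) q t a b" if h: "h \<in> space (history_space n)" for n h
    proof -
      note x = state_in(1)[OF h]
      have "AE q in opposeI (pure_I mv) n h. q = u (position n h)"
        unfolding pure_simps by (rule AE_return_tree[OF u_in[OF x]])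
      then show ?thesis
      proof eventually_elim
        case (elim q)
        then have q: "q \<in> mspace T" using u_in[OF x] by simp
        from target_AE[OF \<tau> h q] show ?case
        proof eventually_elim
          case t: (elim t)
          have "AE a in moveI (pure_I mv) n h q t. a = mv n (position n h) t"
            unfolding pure_simps by (rule AE_return_vertex[OF V[OF adj[OF x]]])
          then show ?case
          proof eventually_elim
            case a: (elim a)
            show ?case using legal_AE(2)[OF h q t \<tau>]
              by eventually_elim (simp add: adm_def elim t a)
          qed
        qed
      qed
    qed
    have late: "2 * \<psi> x + 2 \<le> \<psi> a + \<psi> b" if "n0 \<le> n" "x \<in> V - Y" "adm n x q t a b" for n x q t a b
      using that m by (simp add: adm_def mv_def pure_move_def)
    have drift': "2 * Gt n x \<le> 1 * gain x t' (q, t, True, a) + 1 * gain x t' (q, t, False, b) + Gt (Suc n) a + Gt (Suc n) b"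
      if x: "x \<in> V - Y" and t': "t' \<in> mspace T" and ad: "adm n x q t a b" for n x t' q t a b
    proof (rule Gt_drift[OF _ x t'])
      have xV: "x \<in> V" using x by simp
      show q: "q \<in> mspace T" and t: "t \<in> mspace T" and b: "b \<in> V" and a: "a \<in> V"
        using ad u_in[OF xV] V adj[OF xV] by (auto simp: adm_def)
      assume "n < n0"
      then have a': "a = far y z x t" using ad x by (simp add: adm_def mv_def pure_move_def)
      have xb: "{x, b} \<in> E" and qx: "q = u x" using ad by (auto simp: adm_def)
      \<comment> \<open>As \<open>q = u x\<close>, the old target cancels from the gains. The chosen
        move contributes at least the slope and the reply \<open>b\<close> contributes
        \<open>s\<close> minus the slope, so the two gains sum to at least \<open>s\<close>.\<close>
      define s where "s = slope x + d (u b) t - d (u x) t"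
      note in_T = u_in[OF xV] u_in[OF a] u_in[OF b]
      have "d (u x) t \<le> d (u x) (u b) + d (u b) t" using in_T t by (intro T.triangle)
      then have "0 \<le> s" using slope_ge[OF xb] by (simp add: s_def)
      have fa: "d (u x) t + slope x \<le> d (u a) t" using far_ge[OF x t] a' by (simp add: T.commute)
      have "d (u a) t \<le> d (u a) (u b) + d (u b) t" using in_T t by (intro T.triangle)
      then have "2 * slope x - s \<le> d (u a) (u b)" using fa by (simp add: s_def)
      then have "2 * G x + 2 * c - s \<le> G a + G b" using pot[OF x xb \<open>0 \<le> s\<close>] a' by simp
      then show "2 * G x + 2 * c \<le> 1 * gain x t' (q, t, True, a) + 1 * gain x t' (q, t, False, b) + G a + G b"
        using fa by (simp add: gain_def qx s_def)
    qed (use late[OF _ x ad] in auto)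
    have bound: "(AE \<omega> in law. terminates \<omega>) \<and> integrable law payoff \<and>
        - \<epsilon> \<le> 1 * (expectation payoff - d (u x0) t0)"
      by (intro conjI; rule payoff_bound[where adm = adm and \<kappa> = "1" and \<psi> = \<psi> and \<Psi> = \<Psi> and ?n0.0 = n0
          and G = Gt and B = "\<epsilon> + c * real n0 + 2 * D * \<Psi>" and \<epsilon> = \<epsilon>];
        (erule AE_adm | erule (2) late | erule \<psi>' | erule Gt_bound | erule (2) drift' | rule Gt0 | simp))
    show "d (u x0) t0 - \<epsilon> \<le> expected_payoff C (pure_I mv) \<tau>"
      using bound by (simp add: expected_payoff_def)
  qed
  show "\<exists>\<tau>\<in>strategiesII. \<forall>\<sigma>\<in>strategiesI. expected_payoff C \<sigma> \<tau> \<le> d (u x0) t0 + \<epsilon>"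
  proof (intro bexI[of _ "pure_II mv"] ballI)
    show "pure_II mv \<in> strategiesII" by (rule pure(2))
    fix \<sigma> assume \<sigma>: "\<sigma> \<in> strategiesI"
    interpret politics_play V E Y T f g x0 t0 \<sigma> "pure_II mv"
      using pure(2) \<sigma> by unfold_locales
    define adm where "adm n x q t a b \<longleftrightarrow> q \<in> mspace T \<and> t = u (mv 0 x q) \<and> {x, a} \<in> E \<and> b = mv n x q" for n x q t a b
    have AE_adm: "AE q in opposeI \<sigma> n h. AE t in targetII (pure_II mv) n h q. AE a in moveI \<sigma> n h q t.
        AE b in moveII (pure_II mv) n h q t. adm n (position n h) q t a b" if h: "h \<in> space (history_space n)" for n h
    proof -
      note x = state_in(1)[OF h]
      from oppose_AE[OF \<sigma> h] show ?thesis
      proof eventually_elim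
        case q: (elim q)
        have tq: "u (mv 0 (position n h) q) \<in> mspace T" by (rule u_in[OF V[OF adj[OF x]]])
        have "AE t in targetII (pure_II mv) n h q. t = u (mv 0 (position n h) q)"
          unfolding pure_simps by (rule AE_return_tree[OF tq])
        then show ?case
        proof eventually_elim
          case t: (elim t)
          then have "t \<in> mspace T" using tq by simp
          from legal_AE(1)[OF h q this \<sigma>] show ?case
          proof eventually_elim
            case a: (elim a)
            have "AE b in moveII (pure_II mv) n h q t. b = mv n (position n h) q"
              unfolding pure_simps by (rule AE_return_vertex[OF V[OF adj[OF x]]])
            then show ?case
              by eventually_elim (simp add: adm_def q t a)
          qed
        qed
      qed
    qed
    have late: "2 * \<psi> x + 2 \<le> \<psi> a + \<psi> b" if "n0 \<le> n" "x \<in> V - Y" "adm n x q t a b" for n x q t a b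
      using that m by (simp add: adm_def mv_def pure_move_def add.commute)
    have drift': "2 * Gt n x \<le> - 1 * gain x t' (q, t, True, a) + - 1 * gain x t' (q, t, False, b) + Gt (Suc n) a + Gt (Suc n) b"
      if x: "x \<in> V - Y" and t': "t' \<in> mspace T" and ad: "adm n x q t a b" for n x t' q t a b
    proof (rule Gt_drift[OF _ x t'])
      have xV: "x \<in> V" using x by simp
      show q: "q \<in> mspace T" and t: "t \<in> mspace T" and b: "b \<in> V" and a: "a \<in> V"
        using ad u_in[OF V[OF adj[OF xV]]] V[OF adj[OF xV]] V by (auto simp: adm_def)
      assume "n < n0"
      then have b': "b = far y z x q" and tb: "t = u b"
        using ad x \<open>0 < n0\<close> by (auto simp: adm_def mv_def pure_move_def)
      have xa: "{x, a} \<in> E" using ad by (auto simp: adm_def)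
      \<comment> \<open>Since \<open>t = u b\<close>, the distance term left over is 0 at
        \<open>b\<close> and \<open>d (u a) (u b)\<close> at \<open>a\<close>. The choice of target
        is worth at least \<open>2 * slope x\<close> over both outcomes, which leaves Player II at
        least \<open>s\<close>.\<close>
      define s where "s = 2 * slope x - d (u a) (u b)"
      note in_T = u_in[OF xV] u_in[OF a] u_in[OF b]
      have "d (u a) (u b) \<le> d (u a) (u x) + d (u x) (u b)" using in_T by (intro T.triangle)
      then have "0 \<le> s" using slope_ge[OF xa] far_slope[OF x] b' by (simp add: s_def T.commute)
      have fb: "d q (u x) + slope x \<le> d q t" using far_ge[OF x q] b' tb by simp
      have qt: "d q t' \<le> d q (u x) + d (u x) t'" using in_T q t' by (intro T.triangle)
      have "2 * G x + 2 * c - s \<le> G b + G a" using pot[OF x xa \<open>0 \<le> s\<close>, of q] b' by (simp add: s_def T.commute)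
      moreover have "d (u b) t = 0" using tb in_T by simp
      ultimately show "2 * G x + 2 * c \<le> - 1 * gain x t' (q, t, True, a) + - 1 * gain x t' (q, t, False, b) + G a + G b"
        using fb qt tb by (simp add: gain_def s_def)
    qed (use late[OF _ x ad] in auto)
    have bound: "(AE \<omega> in law. terminates \<omega>) \<and> integrable law payoff \<and>
        - \<epsilon> \<le> - 1 * (expectation payoff - d (u x0) t0)"
      by (intro conjI; rule payoff_bound[where adm = adm and \<kappa> = "- 1" and \<psi> = \<psi> and \<Psi> = \<Psi> and ?n0.0 = n0
          and G = Gt and B = "\<epsilon> + c * real n0 + 2 * D * \<Psi>" and \<epsilon> = \<epsilon>];
        (erule AE_adm | erule (2) late | erule \<psi>' | erule Gt_bound | erule (2) drift' | rule Gt0 | simp))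
    show "expected_payoff C \<sigma> (pure_II mv) \<le> d (u x0) t0 + \<epsilon>"
      using bound by (simp add: expected_payoff_def)
  qed
qed

text \<open>The near-optimal strategies force termination and integrability against every opponent,
  so \<open>C\<close> does not affect the bounds; the inequality between the two values is weak
  minimax duality.\<close>

lemma politics_value: "has_value C (d (u x0) t0)"
proof -
  let ?v = "d (u x0) t0"
  have I: "ereal ?v \<le> valueI C"
  proof (rule ereal_le_epsilon2)
    fix \<epsilon> :: real assume "0 < \<epsilon>"
    then obtain \<sigma> where \<sigma>: "\<sigma> \<in> strategiesI" "\<And>\<tau>. \<tau> \<in> strategiesII \<Longrightarrow> ?v - \<epsilon> \<le> expected_payoff C \<sigma> \<tau>"
      using near_optimal_strategies(1)[of \<epsilon> C] by blast
    have "ereal (?v - \<epsilon>) \<le> valueI C"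
      unfolding valueI_def using \<sigma> by (intro SUP_upper2[OF \<sigma>(1)] INF_greatest) simp
    then have "ereal (?v - \<epsilon>) + ereal \<epsilon> \<le> valueI C + ereal \<epsilon>" by (rule add_right_mono)
    then show "ereal ?v \<le> valueI C + ereal \<epsilon>" by simp
  qed
  have II: "valueII C \<le> ereal ?v"
  proof (rule ereal_le_epsilon2)
    fix \<epsilon> :: real assume "0 < \<epsilon>"
    then obtain \<tau> where \<tau>: "\<tau> \<in> strategiesII" "\<And>\<sigma>. \<sigma> \<in> strategiesI \<Longrightarrow> expected_payoff C \<sigma> \<tau> \<le> ?v + \<epsilon>"
      using near_optimal_strategies(2)[of \<epsilon> C] by blast
    show "valueII C \<le> ereal ?v + ereal \<epsilon>"
      unfolding valueII_def using \<tau> by (intro INF_lower2[OF \<tau>(1)] SUP_least) simp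
  qed
  have "valueI C \<le> valueII C"
    unfolding valueI_def valueII_def
    by (intro SUP_least INF_greatest) (meson INF_lower SUP_upper order_trans)
  with I II show ?thesis
    unfolding has_value_def by (meson antisym order_trans)
qed

end

theorem proposition4:
  fixes V Y :: "'v set" and E :: "'v set set"
    and T :: "'w cpoint metric" and f :: "'v \<Rightarrow> 'w cpoint"
    and g :: "'v cpoint \<Rightarrow> 'w cpoint"
    and x0 :: 'v and t0 :: "'w cpoint" and C :: real
  assumes "finite_graph V E" and "connected_graph V E"
    and "Y \<subseteq> V" and "Y \<noteq> {}"
    and "metric_tree T"
    and "f \<in> Y \<rightarrow> mspace T"
    and "AMLE (metric_graph V E (\<lambda>_. 1)) T (Vertex ` Y) (f \<circ> the_vertex) g"
    and "x0 \<in> V - Y" and "t0 \<in> mspace T"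
  shows "politics.has_value V E Y T f x0 t0 C (mdist T (g (Vertex x0)) t0)"
proof -
  interpret politics_AMLE V E Y T f g x0 t0
    using assms by unfold_locales
  show ?thesis
    using politics_value[of C] by (simp add: u_def)
qed

end
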